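(* Let $1<p<\infty$ and let $T(a)+H(b)\in\mathcal F_{TH}^p(-2,2)$, with subordinated pair $(c,d)$, be invertible on $H^p$. With $d=\boldsymbol\sigma(d)d_+t^{-2}\tilde d_+^{-1}$ the Wiener–Hopf factorization of $d$ in $L^p$, $\omega^{a,b,+}:=T^{-1}(ct^{-2})T(\tilde a^{-1}t^{-1})\big(d_+^{-1}(1+\boldsymbol\sigma(d)t)\big)$ and $\hat\omega_0^{a,b,+}\neq0$ its zeroth Fourier coefficient, and $T_r^{-1}(d)$ any right inverse of $T(d)$, one has $$(T(a)+H(b))^{-1}=T(t^{-1})\Big(I-\tfrac{1}{\hat\omega_0^{a,b,+}}\,\omega^{a,b,+}\,tQt^{-1}\Big)\Big((I-H(t^2\tilde c))T^{-1}(t^{-2}c)T(\tilde a^{-1}t^{-1})T_r^{-1}(d)+H(a^{-1}t)T_r^{-1}(d)\Big),$$ where $\omega^{a,b,+}tQt^{-1}$ is the operator $f\mapsto \omega^{a,b,+}\cdot tQ(t^{-1}f)$, which on $f\in H^p$ equals $f\mapsto\hat f_0\,\omega^{a,b,+}$.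
   Context: $\mathbb T$ is the unit circle, $1<p<\infty$, $1/p+1/q=1$; $H^p=\{f\in L^p(\mathbb T):\hat f_n=0\ \forall n<0\}$, $\overline{H^p}=\{f\in L^p:\hat f_n=0\ \forall n>0\}$; $P$ is the Riesz projection onto $H^p$, $Q=I-P$, $(Jf)(t)=t^{-1}f(t^{-1})$, $\tilde a(t)=a(1/t)$; $t$ denotes $t\mapsto t$; functions as operators denote multiplication. On $H^p$: $T(a)f=P(af)$, $H(a)f=P(aQJf)$. A pair $(a,b)$ with $a\in GL^\infty(\mathbb T)$ (invertible in $L^\infty$) and $b\in L^\infty(\mathbb T)$ is a matching pair if $a\tilde a=b\tilde b$; the subordinated pair is $(c,d)$, $c:=a/b$, $d:=a/\tilde b$, with $c\tilde c=d\tilde d=1$. We write $T(a)+H(b)\in\mathcal F_{TH}^p(\kappa_1,\kappa_2)$ if $(a,b)$ is a matching pair whose subordinated operators $T(c),T(d)$ are Fredholm on $H^p$ with $\operatorname{ind}T(c)=\kappa_1$, $\operatorname{ind}T(d)=\kappa_2$. A Wiener–Hopf factorization of $a\in L^\infty$ in $L^p$ is $a=a_-t^ma_+$ with $m\in\mathbb Z$, $a_+\in H^q$, $a_+^{-1}\in H^p$, $a_-\in\overline{H^p}$, $a_-^{-1}\in\overline{H^q}$, and $\|a_+^{-1}P(a_+\varphi)\|_p\le c_p\|\varphi\|_p$ for all trigonometric polynomials $\varphi$. If $g$ satisfies $g\tilde g=1$ and $T(g)$ is Fredholm on $H^p$ with index $n$, its Wiener–Hopf factorization normalized by $g_-(\infty)=1$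 has the form $g=\boldsymbol\sigma(g)g_+t^{-n}\tilde g_+^{-1}$ with $\boldsymbol\sigma(g)=g_+(0)\in\{-1,1\}$ (the factorization signature) and plus factor $g_+$. *)

theory Defs
  imports "HOL-Analysis.Analysis"
begin

text \<open>Functions on the unit circle are modelled as complex \<Rightarrow> complex; only their
values on the circle matter. The circle is parametrized by cis on [0, 2 pi]
with Lebesgue measure; all identities between functions are up to null sets.\<close>

type_synonym cfun = "complex \<Rightarrow> complex"

definition aeq :: "cfun \<Rightarrow> cfun \<Rightarrow> bool" where
  "aeq f g \<longleftrightarrow> (AE \<theta> in lborel. \<theta> \<in> {0..2*pi} \<longrightarrow> f (cis \<theta>) = g (cis \<theta>))"

definition meas :: "cfun \<Rightarrow> bool" where
  "meas f \<longleftrightarrow> (\<lambda>\<theta>. f (cis \<theta>)) \<in> borel_measurable lborel"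

definition Lp :: "real \<Rightarrow> cfun \<Rightarrow> bool" where
  "Lp p f \<longleftrightarrow> meas f \<and> set_integrable lborel {0..2*pi} (\<lambda>\<theta>. norm (f (cis \<theta>)) powr p)"

definition normp :: "real \<Rightarrow> cfun \<Rightarrow> real" where
  "normp p f = (set_lebesgue_integral lborel {0..2*pi} (\<lambda>\<theta>. norm (f (cis \<theta>)) powr p)) powr (1/p)"

definition Linf :: "cfun \<Rightarrow> bool" where
  "Linf f \<longleftrightarrow> meas f \<and> (\<exists>C. AE \<theta> in lborel. \<theta> \<in> {0..2*pi} \<longrightarrow> norm (f (cis \<theta>)) \<le> C)"

definition GLinf :: "cfun \<Rightarrow> bool" where
  "GLinf a \<longleftrightarrow> Linf a \<and> (\<exists>b. Linf b \<and> aeq (\<lambda>z. a z * b z) (\<lambda>_. 1))"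

definition fc :: "cfun \<Rightarrow> int \<Rightarrow> complex" where
  "fc f n = (1 / (2*pi)) * set_lebesgue_integral lborel {0..2*pi}
              (\<lambda>\<theta>. f (cis \<theta>) * cis (- (real_of_int n * \<theta>)))"

definition Hp :: "real \<Rightarrow> cfun set" where
  "Hp p = {f. Lp p f \<and> (\<forall>n<0. fc f n = 0)}"

definition Hbar :: "real \<Rightarrow> cfun set" where
  "Hbar p = {f. Lp p f \<and> (\<forall>n>0. fc f n = 0)}"

definition trigpoly :: "cfun \<Rightarrow> bool" where
  "trigpoly \<phi> \<longleftrightarrow> (\<exists>N::nat. \<exists>c::int \<Rightarrow> complex.
      \<forall>z. \<phi> z = (\<Sum>k\<in>{- int N..int N}. c k * z powi k))"

text \<open>Riesz projection: the (a.e. unique) integrable function whose Fourier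
coefficients are those of f with nonnegative index.\<close>
definition Pr :: "cfun \<Rightarrow> cfun" where
  "Pr f = (SOME g. Lp 1 g \<and> (\<forall>n. fc g n = (if 0 \<le> n then fc f n else 0)))"

definition Qr :: "cfun \<Rightarrow> cfun" where
  "Qr f = (\<lambda>z. f z - Pr f z)"

definition Jop :: "cfun \<Rightarrow> cfun" where
  "Jop f = (\<lambda>z. inverse z * f (inverse z))"

definition tld :: "cfun \<Rightarrow> cfun" where
  "tld a = (\<lambda>z. a (inverse z))"

definition Toep :: "cfun \<Rightarrow> cfun \<Rightarrow> cfun" where
  "Toep a f = Pr (\<lambda>z. a z * f z)"

definition Hank :: "cfun \<Rightarrow> cfun \<Rightarrow> cfun" where
  "Hank a f = Pr (\<lambda>z. a z * Qr (Jop f) z)"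

definition inv_on :: "real \<Rightarrow> (cfun \<Rightarrow> cfun) \<Rightarrow> (cfun \<Rightarrow> cfun) \<Rightarrow> bool" where
  "inv_on p A B \<longleftrightarrow> (\<forall>g\<in>Hp p. B g \<in> Hp p \<and> aeq (A (B g)) g) \<and> (\<forall>f\<in>Hp p. aeq (B (A f)) f)"

definition invertible_on :: "real \<Rightarrow> (cfun \<Rightarrow> cfun) \<Rightarrow> bool" where
  "invertible_on p A \<longleftrightarrow> (\<forall>f\<in>Hp p. A f \<in> Hp p) \<and> (\<exists>B. inv_on p A B)"

definition opinv :: "real \<Rightarrow> (cfun \<Rightarrow> cfun) \<Rightarrow> (cfun \<Rightarrow> cfun)" where
  "opinv p A = (SOME B. inv_on p A B)"

definition indep_mod :: "(cfun \<Rightarrow> bool) \<Rightarrow> cfun list \<Rightarrow> bool" where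
  "indep_mod S fs \<longleftrightarrow> (\<forall>c::nat \<Rightarrow> complex.
      S (\<lambda>z. \<Sum>i<length fs. c i * (fs ! i) z) \<longrightarrow> (\<forall>i<length fs. c i = 0))"

definition kerdim :: "real \<Rightarrow> (cfun \<Rightarrow> cfun) \<Rightarrow> nat \<Rightarrow> bool" where
  "kerdim p A n \<longleftrightarrow>
     (\<exists>fs. length fs = n \<and> set fs \<subseteq> {f\<in>Hp p. aeq (A f) (\<lambda>_. 0)} \<and> indep_mod (\<lambda>h. aeq h (\<lambda>_. 0)) fs) \<and>
     \<not> (\<exists>fs. length fs = Suc n \<and> set fs \<subseteq> {f\<in>Hp p. aeq (A f) (\<lambda>_. 0)} \<and> indep_mod (\<lambda>h. aeq h (\<lambda>_. 0)) fs)"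

definition cokerdim :: "real \<Rightarrow> (cfun \<Rightarrow> cfun) \<Rightarrow> nat \<Rightarrow> bool" where
  "cokerdim p A n \<longleftrightarrow>
     (let R = (\<lambda>h. \<exists>f\<in>Hp p. aeq h (A f)) in
     (\<exists>gs. length gs = n \<and> set gs \<subseteq> Hp p \<and> indep_mod R gs) \<and>
     \<not> (\<exists>gs. length gs = Suc n \<and> set gs \<subseteq> Hp p \<and> indep_mod R gs))"

text \<open>A (bounded) operator on H^p is Fredholm with index kappa: finite-dimensional kernel,
finite-codimensional range (hence closed), and dim ker - dim coker = kappa.\<close>
definition fredholm_index :: "real \<Rightarrow> (cfun \<Rightarrow> cfun) \<Rightarrow> int \<Rightarrow> bool" where
  "fredholm_index p A \<kappa> \<longleftrightarrow> (\<exists>m n. kerdim p A m \<and> cokerdim p A n \<and> \<kappa> = int m - int n)"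

definition matching_pair :: "cfun \<Rightarrow> cfun \<Rightarrow> bool" where
  "matching_pair a b \<longleftrightarrow> GLinf a \<and> Linf b \<and>
     aeq (\<lambda>z. a z * tld a z) (\<lambda>z. b z * tld b z)"

definition sub_c :: "cfun \<Rightarrow> cfun \<Rightarrow> cfun" where
  "sub_c a b = (\<lambda>z. a z / b z)"

definition sub_d :: "cfun \<Rightarrow> cfun \<Rightarrow> cfun" where
  "sub_d a b = (\<lambda>z. a z / tld b z)"

definition F_TH :: "real \<Rightarrow> cfun \<Rightarrow> cfun \<Rightarrow> int \<Rightarrow> int \<Rightarrow> bool" where
  "F_TH p a b \<kappa>1 \<kappa>2 \<longleftrightarrow> matching_pair a b \<and>
     fredholm_index p (Toep (sub_c a b)) \<kappa>1 \<and> fredholm_index p (Toep (sub_d a b)) \<kappa>2"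

definition WH_fact :: "real \<Rightarrow> cfun \<Rightarrow> cfun \<Rightarrow> int \<Rightarrow> cfun \<Rightarrow> bool" where
  "WH_fact p g gm m gp \<longleftrightarrow>
     (let q = p / (p - 1) in
      aeq g (\<lambda>z. gm z * z powi m * gp z) \<and>
      gp \<in> Hp q \<and> (\<lambda>z. inverse (gp z)) \<in> Hp p \<and>
      gm \<in> Hbar p \<and> (\<lambda>z. inverse (gm z)) \<in> Hbar q \<and>
      (\<exists>C. \<forall>\<phi>. trigpoly \<phi> \<longrightarrow>
          normp p (\<lambda>z. inverse (gp z) * Pr (\<lambda>w. gp w * \<phi> w) z) \<le> C * normp p \<phi>))"

text \<open>Normalized by g_-(infinity) = 0th Fourier coefficient of g_- = 1.\<close>
definition WH_fact_norm :: "real \<Rightarrow> cfun \<Rightarrow> cfun \<Rightarrow> int \<Rightarrow> cfun \<Rightarrow> bool" where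
  "WH_fact_norm p g gm m gp \<longleftrightarrow> WH_fact p g gm m gp \<and> fc gm 0 = 1"

end

theory Submission
  imports Defs "HOL-Complex_Analysis.Complex_Analysis"
begin

text \<open>
  Write \<open>J\<close> for the flip, so that \<open>T(a) + H(b) = P (a + b J)\<close> on \<open>H\<^sup>p\<close>, and let \<open>T\<^sub>0 = T(c t\<^sup>-\<^sup>2)\<close>. By Coburn's
  lemma \<open>T\<^sub>0\<close> is invertible, and \<open>d h = J h\<close> has the one-dimensional solution space spanned by
  \<open>h\<^sup>+ = d\<^sub>+\<^sup>-\<^sup>1 (1 + \<sigma> t)\<close>. If \<open>T\<^sub>0 u = T(1 / (a~ t)) \<rho>\<close>, then
  \<open>n = t\<^sup>2 c~ J u - a\<^sup>-\<^sup>1 t J \<rho>\<close> lies in \<open>H\<^sup>p\<close>, and \<open>\<psi> = t\<^sup>-\<^sup>1 (u - n)\<close> satisfies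
  \<open>a \<psi> + b J \<psi> = d \<rho> + J \<rho>\<close> because \<open>a a~ = b b~\<close>. Hence \<open>P (a \<psi> + b J \<psi>) = T(d) \<rho>\<close>, and only the
  coefficient of \<open>t\<^sup>-\<^sup>1\<close> keeps \<open>\<psi>\<close> out of \<open>H\<^sup>p\<close>; it is removed by a multiple of \<open>t\<^sup>-\<^sup>1 \<omega>\<close>, since
  \<open>(a + b J) (t\<^sup>-\<^sup>1 \<omega>) = J h\<^sup>+\<close>. Conversely every \<open>t\<^sup>-\<^sup>1 y\<close> with \<open>y \<in> H\<^sup>p\<close> that \<open>P (a + b J)\<close> annihilates is
  a multiple of \<open>t\<^sup>-\<^sup>1 \<omega>\<close>; comparing with the solution of \<open>(T(a) + H(b)) f = P (a + b J) t\<^sup>-\<^sup>1\<close> shows that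
  the zeroth coefficient of \<open>\<omega>\<close> does not vanish.

  \<open>Pr\<close> is meaningful on \<open>L\<^sup>p\<close> only by the theorem of M. Riesz, which for \<open>p \<le> 2\<close> follows from the mean value
  property of \<open>F\<^sup>p\<close> for analytic \<open>F\<close> with positive real part, and for \<open>p > 2\<close> by duality. Since Fredholmness is
  given purely algebraically, Coburn's lemma also needs a Baire category argument.
\<close>

text \<open>The powers of \<open>t\<close> in the formula come from a change of pair. The pair
  \<open>(a / t, b t)\<close> is again matching, and its subordinated pair is
  \<open>(c t\<^sup>-\<^sup>2, d)\<close>: the index \<open>-2\<close> of \<open>T(c)\<close> is
  compensated while \<open>d\<close> is untouched. For the new pair the operator
  \<open>P (a + b J) t\<^sup>-\<^sup>1\<close> on \<open>H\<^sup>p\<close> is onto, its kernel is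
  spanned by \<open>\<omega>\<close>, and up to a multiplication by \<open>t\<close> the operator
  \<open>T(a) + H(b)\<close> is its restriction to the functions divisible by \<open>t\<close>.
  Inverting \<open>T(a) + H(b)\<close> therefore means to choose, among all preimages of
  \<open>g\<close> under the larger operator, the one whose zeroth coefficient vanishes. That choice
  exists for every \<open>g\<close> exactly when \<open>\<omega>\<close> itself has a nonzero zeroth
  coefficient. For the same reason any right inverse of \<open>T(d)\<close> may be taken: two of
  them lead to preimages that differ by a multiple of \<open>\<omega>\<close>, which the correction
  term removes.\<close>

definition cm :: "real measure" where "cm = restrict_space lborel {0..2*pi}"

lemma space_cm [simp]: "space cm = {0..2*pi}"
  by (simp add: cm_def space_restrict_space)

lemma emeasure_cm_space: "emeasure cm {0..2*pi} = ennreal (2*pi)"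
  by (simp add: cm_def emeasure_restrict_space)

interpretation cm: finite_measure cm
  by (rule finite_measureI) (simp add: emeasure_cm_space)

lemma measure_cm_space [simp]: "measure cm {0..2*pi} = 2*pi"
  by (simp add: measure_def emeasure_cm_space)

lemma measurable_cm: "f \<in> borel_measurable lborel \<Longrightarrow> f \<in> borel_measurable cm"
  unfolding cm_def by (rule measurable_restrict_space1)

lemma AE_cm_iff: "(AE \<theta> in cm. P \<theta>) \<longleftrightarrow> (AE \<theta> in lborel. \<theta> \<in> {0..2*pi} \<longrightarrow> P \<theta>)"
  unfolding cm_def by (subst AE_restrict_space_iff) auto

lemma aeq_cm: "aeq f g \<longleftrightarrow> (AE \<theta> in cm. f (cis \<theta>) = g (cis \<theta>))"
  by (simp add: aeq_def AE_cm_iff)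

lemma meas_cm: "meas f \<Longrightarrow> (\<lambda>\<theta>. f (cis \<theta>)) \<in> borel_measurable cm"
  by (simp add: meas_def measurable_cm)

lemma set_integrable_cm:
  fixes f :: "real \<Rightarrow> 'b::{banach, second_countable_topology}"
  shows "set_integrable lborel {0..2*pi} f \<longleftrightarrow> integrable cm f"
  unfolding set_integrable_def cm_def by (subst integrable_restrict_space) auto

lemma set_integral_cm:
  fixes f :: "real \<Rightarrow> 'b::{banach, second_countable_topology}"
  shows "set_lebesgue_integral lborel {0..2*pi} f = integral\<^sup>L cm f"
  unfolding set_lebesgue_integral_def cm_def by (subst integral_restrict_space) auto

lemma Lp_cm: "Lp p f \<longleftrightarrow> meas f \<and> integrable cm (\<lambda>\<theta>. norm (f (cis \<theta>)) powr p)"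
  by (simp add: Lp_def set_integrable_cm)

lemma normp_cm: "normp p f = (\<integral>\<theta>. norm (f (cis \<theta>)) powr p \<partial>cm) powr (1/p)"
  by (simp add: normp_def set_integral_cm)

lemma fc_cm: "fc f n = (1 / (2*pi)) * (\<integral>\<theta>. f (cis \<theta>) * cis (- (real_of_int n * \<theta>)) \<partial>cm)"
  by (simp add: fc_def set_integral_cm)

lemma Linf_cm: "Linf f \<longleftrightarrow> meas f \<and> (\<exists>C. AE \<theta> in cm. norm (f (cis \<theta>)) \<le> C)"
  by (simp add: Linf_def AE_cm_iff)

lemma Lp_meas: "Lp p f \<Longrightarrow> meas f" by (simp add: Lp_def)
lemma Linf_meas: "Linf f \<Longrightarrow> meas f" by (simp add: Linf_def)

lemma Linf_E:
  assumes "Linf f" obtains C where "0 < C" "AE \<theta> in cm. norm (f (cis \<theta>)) \<le> C"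
proof -
  obtain C where C: "AE \<theta> in cm. norm (f (cis \<theta>)) \<le> C" using assms by (auto simp: Linf_cm)
  show thesis
    by (rule that[of "max 1 C"]) (use C in auto)
qed

section \<open>Measurability and equality almost everywhere\<close>

lemma meas_const [intro, simp]: "meas (\<lambda>_. k)" by (simp add: meas_def)
lemma meas_add [intro]: "meas f \<Longrightarrow> meas g \<Longrightarrow> meas (\<lambda>z. f z + g z)" by (simp add: meas_def)
lemma meas_diff [intro]: "meas f \<Longrightarrow> meas g \<Longrightarrow> meas (\<lambda>z. f z - g z)" by (simp add: meas_def)
lemma meas_minus [intro]: "meas f \<Longrightarrow> meas (\<lambda>z. - f z)" by (simp add: meas_def)
lemma meas_mult [intro]: "meas f \<Longrightarrow> meas g \<Longrightarrow> meas (\<lambda>z. f z * g z)" by (simp add: meas_def)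
lemma meas_inverse [intro]: "meas f \<Longrightarrow> meas (\<lambda>z. inverse (f z))" by (simp add: meas_def)
lemma meas_power [intro]: "meas f \<Longrightarrow> meas (\<lambda>z. f z ^ k)" by (simp add: meas_def)
lemma meas_sum [intro]: "(\<And>i. i \<in> I \<Longrightarrow> meas (f i)) \<Longrightarrow> meas (\<lambda>z. \<Sum>i\<in>I. f i z)"
  by (simp add: meas_def)
lemma cis_borel_measurable [measurable]: "cis \<in> borel_measurable borel"
  by (intro borel_measurable_continuous_onI continuous_intros)

lemma meas_ident [intro, simp]: "meas (\<lambda>z. z)"
  by (simp add: meas_def)

lemma cis_powi: "cis \<theta> powi k = cis (of_int k * \<theta>)"
  by (cases k rule: int_cases2) (auto simp: power_int_minus Complex.DeMoivre)

lemma meas_powi [intro, simp]: "meas (\<lambda>z. z powi k)"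
  unfolding meas_def cis_powi by simp

lemma meas_tld [intro]: "meas f \<Longrightarrow> meas (tld f)"
  unfolding meas_def tld_def cis_inverse
  using measurable_compose[of uminus lborel lborel "\<lambda>\<theta>. f (cis \<theta>)" borel] by simp

lemma Jop_tld: "Jop f = (\<lambda>z. inverse z * tld f z)"
  by (simp add: Jop_def tld_def fun_eq_iff)

lemma meas_Jop [intro]: "meas f \<Longrightarrow> meas (Jop f)"
  unfolding Jop_tld by (intro meas_mult meas_inverse meas_ident meas_tld)

lemma aeq_refl [intro, simp]: "aeq f f" by (simp add: aeq_cm)
lemma aeq_sym: "aeq f g \<Longrightarrow> aeq g f" by (auto simp: aeq_cm elim: AE_mp)
lemma aeq_trans [trans]: "aeq f g \<Longrightarrow> aeq g h \<Longrightarrow> aeq f h"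
  unfolding aeq_cm by (rule AE_mp, assumption, rule AE_mp, assumption) auto
lemma aeq_add: "aeq f f' \<Longrightarrow> aeq g g' \<Longrightarrow> aeq (\<lambda>z. f z + g z) (\<lambda>z. f' z + g' z)"
  unfolding aeq_cm by (rule AE_mp, assumption, rule AE_mp, assumption) auto
lemma aeq_diff: "aeq f f' \<Longrightarrow> aeq g g' \<Longrightarrow> aeq (\<lambda>z. f z - g z) (\<lambda>z. f' z - g' z)"
  unfolding aeq_cm by (rule AE_mp, assumption, rule AE_mp, assumption) auto
lemma aeq_mult: "aeq f f' \<Longrightarrow> aeq g g' \<Longrightarrow> aeq (\<lambda>z. f z * g z) (\<lambda>z. f' z * g' z)"
  unfolding aeq_cm by (rule AE_mp, assumption, rule AE_mp, assumption) auto
lemma aeq_cmult: "aeq f f' \<Longrightarrow> aeq (\<lambda>z. k z * f z) (\<lambda>z. k z * f' z)"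
  by (rule aeq_mult) auto
lemma aeq_sum: "finite I \<Longrightarrow> (\<And>i. i \<in> I \<Longrightarrow> aeq (f i) (g i)) \<Longrightarrow> aeq (\<lambda>z. \<Sum>i\<in>I. f i z) (\<lambda>z. \<Sum>i\<in>I. g i z)"
  by (induction I rule: finite_induct) (auto intro: aeq_add)
lemma aeq_pointwise: "(\<And>z. norm z = 1 \<Longrightarrow> f z = g z) \<Longrightarrow> aeq f g"
  unfolding aeq_cm by (rule AE_I2) simp

section \<open>Reflection of the circle\<close>

lemma cm_reflect: "distr cm cm (\<lambda>\<theta>. 2*pi - \<theta>) = cm"
proof -
  have m: "(\<lambda>\<theta>. 2*pi - \<theta>) \<in> measurable cm cm"
    unfolding cm_def by (rule measurable_restrict_space3) auto
  \<comment> \<open>On the parameter the map \<open>z \<mapsto> inverse z\<close> becomes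
    \<open>\<theta> \<mapsto> 2*pi - \<theta>\<close>, which preserves the interval, so the claim is
    the invariance of Lebesgue measure under an affine map of slope \<open>-1\<close>.\<close>
  have r: "distr lborel borel (\<lambda>\<theta>::real. 2*pi - \<theta>) = lborel"
    using lborel_real_affine[of "-1" "2*pi"] by (simp add: density_1)
  show ?thesis
  proof (rule measure_eqI)
    fix A assume "A \<in> sets (distr cm cm (\<lambda>\<theta>. 2*pi - \<theta>))"
    then have A: "A \<in> sets cm" by simp
    then have Ab: "A \<in> sets borel" "A \<subseteq> {0..2*pi}"
      by (auto simp: cm_def sets_restrict_space)
    have "emeasure (distr cm cm (\<lambda>\<theta>. 2*pi - \<theta>)) A = emeasure cm ((\<lambda>\<theta>. 2*pi - \<theta>) -` A \<inter> {0..2*pi})"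
      using A m by (simp add: emeasure_distr)
    also have "\<dots> = emeasure lborel ((\<lambda>\<theta>. 2*pi - \<theta>) -` A)"
    proof -
      have "(\<lambda>\<theta>. 2*pi - \<theta>) -` A \<inter> {0..2*pi} = (\<lambda>\<theta>. 2*pi - \<theta>) -` A" using Ab by auto
      then show ?thesis using Ab unfolding cm_def
        by (subst emeasure_restrict_space) auto
    qed
    also have "\<dots> = emeasure (distr lborel borel (\<lambda>\<theta>::real. 2*pi - \<theta>)) A"
      using Ab by (subst emeasure_distr) auto
    also have "\<dots> = emeasure cm A"
      using Ab unfolding r cm_def by (subst emeasure_restrict_space) auto
    finally show "emeasure (distr cm cm (\<lambda>\<theta>. 2*pi - \<theta>)) A = emeasure cm A" .
  qed simp
qed

lemma measurable_reflect: "(\<lambda>\<theta>. 2*pi - \<theta>) \<in> measurable cm cm"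
  unfolding cm_def by (rule measurable_restrict_space3) auto

lemma cis_reflect: "cis (2*pi - \<theta>) = inverse (cis \<theta>)"
  by (simp add: cis_divide[symmetric] divide_inverse)

lemma integral_reflect:
  fixes f :: "complex \<Rightarrow> 'b::{banach, second_countable_topology}"
  assumes "(\<lambda>\<theta>. f (cis \<theta>)) \<in> borel_measurable cm"
  shows "(\<integral>\<theta>. f (inverse (cis \<theta>)) \<partial>cm) = (\<integral>\<theta>. f (cis \<theta>) \<partial>cm)"
  using integral_distr[OF measurable_reflect assms] unfolding cm_reflect cis_reflect by simp

lemma integrable_reflect:
  fixes f :: "complex \<Rightarrow> 'b::{banach, second_countable_topology}"
  assumes "integrable cm (\<lambda>\<theta>. f (cis \<theta>))"
  shows "integrable cm (\<lambda>\<theta>. f (inverse (cis \<theta>)))"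
  using integrable_distr[OF measurable_reflect, of "\<lambda>\<theta>. f (cis \<theta>)"] assms
  unfolding cm_reflect cis_reflect by simp

lemma AE_reflect:
  assumes "AE \<theta> in cm. P (cis \<theta>)" shows "AE \<theta> in cm. P (inverse (cis \<theta>))"
proof -
  have "AE \<theta> in distr cm cm (\<lambda>\<theta>. 2*pi - \<theta>). P (cis \<theta>)" unfolding cm_reflect by (rule assms)
  then have "AE \<theta> in cm. P (cis (2*pi - \<theta>))" by (rule AE_distrD[OF measurable_reflect])
  then show ?thesis by (simp add: cis_reflect)
qed

lemma aeq_tld: "aeq f g \<Longrightarrow> aeq (tld f) (tld g)"
  unfolding aeq_cm tld_def by (rule AE_reflect)

lemma aeq_Jop: "aeq f g \<Longrightarrow> aeq (Jop f) (Jop g)"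
  unfolding Jop_tld by (intro aeq_cmult aeq_tld)

lemma tld_tld [simp]: "tld (tld f) = f" by (simp add: tld_def)

section \<open>Lebesgue spaces on the circle\<close>

lemma Lp_bounded:
  assumes "meas f" "AE \<theta> in cm. norm (f (cis \<theta>)) \<le> C" "0 \<le> p"
  shows "Lp p f"
  unfolding Lp_cm
proof
  show "integrable cm (\<lambda>\<theta>. norm (f (cis \<theta>)) powr p)"
  proof (rule cm.integrable_const_bound[of _ "C powr p"])
    show "AE \<theta> in cm. norm (norm (f (cis \<theta>)) powr p) \<le> C powr p"
      using assms(2) by eventually_elim (use assms(3) in \<open>auto intro: powr_mono2\<close>)
  qed (use meas_cm[OF assms(1)] in measurable)
qed fact

lemma Linf_Lp: "Linf f \<Longrightarrow> 0 \<le> p \<Longrightarrow> Lp p f"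
  by (auto simp: Linf_cm intro: Lp_bounded)

lemma Lp1_iff: "Lp 1 f \<longleftrightarrow> meas f \<and> integrable cm (\<lambda>\<theta>. f (cis \<theta>))"
  unfolding Lp_cm using integrable_norm_iff[of "\<lambda>\<theta>. f (cis \<theta>)" cm] by (auto simp: meas_cm)

lemma Lp1_integrable: "Lp 1 f \<Longrightarrow> integrable cm (\<lambda>\<theta>. f (cis \<theta>))" by (simp add: Lp1_iff)

lemma Lp_integrable: "Lp p f \<Longrightarrow> integrable cm (\<lambda>\<theta>. norm (f (cis \<theta>)) powr p)"
  by (simp add: Lp_cm)

lemma Lp_cong: "Lp p f \<Longrightarrow> aeq f g \<Longrightarrow> meas g \<Longrightarrow> Lp p g"
  unfolding Lp_cm aeq_cm
proof safe
  assume *: "AE \<theta> in cm. f (cis \<theta>) = g (cis \<theta>)" "integrable cm (\<lambda>\<theta>. norm (f (cis \<theta>)) powr p)" "meas f" "meas g"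
  show "integrable cm (\<lambda>\<theta>. norm (g (cis \<theta>)) powr p)"
    by (rule integrable_cong_AE_imp[OF *(2)]) (use * meas_cm in \<open>auto elim: AE_mp\<close>)
qed

lemma normp_cong: "aeq f g \<Longrightarrow> meas f \<Longrightarrow> meas g \<Longrightarrow> normp p f = normp p g"
  unfolding normp_cm aeq_cm
  by (rule arg_cong[of _ _ "\<lambda>x. x powr (1/p)"], rule integral_cong_AE) (use meas_cm in \<open>auto elim: AE_mp\<close>)

lemma powr_add_le:
  fixes x y p :: real assumes "0 \<le> x" "0 \<le> y" "0 \<le> p"
  shows "(x + y) powr p \<le> 2 powr p * (x powr p + y powr p)"
proof -
  have "(x + y) powr p \<le> (2 * max x y) powr p" using assms by (intro powr_mono2) auto
  also have "\<dots> = 2 powr p * max x y powr p" using assms by (simp add: powr_mult)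
  also have "\<dots> \<le> 2 powr p * (x powr p + y powr p)"
    by (intro mult_left_mono) (auto simp: max_def)
  finally show ?thesis .
qed

lemma Lp_add: assumes "Lp p f" "Lp p g" "0 \<le> p" shows "Lp p (\<lambda>z. f z + g z)"
  unfolding Lp_cm
proof
  show m: "meas (\<lambda>z. f z + g z)" using assms by (auto dest: Lp_meas)
  show "integrable cm (\<lambda>\<theta>. norm (f (cis \<theta>) + g (cis \<theta>)) powr p)"
  proof (rule Bochner_Integration.integrable_bound)
    show "integrable cm (\<lambda>\<theta>. 2 powr p * (norm (f (cis \<theta>)) powr p + norm (g (cis \<theta>)) powr p))"
      using assms by (intro integrable_mult_right Bochner_Integration.integrable_add Lp_integrable)
    show "AE \<theta> in cm. norm (norm (f (cis \<theta>) + g (cis \<theta>)) powr p) \<le> norm (2 powr p * (norm (f (cis \<theta>)) powr p + norm (g (cis \<theta>)) powr p))"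
    proof (rule AE_I2)
      fix \<theta>
      have "norm (f (cis \<theta>) + g (cis \<theta>)) powr p \<le> (norm (f (cis \<theta>)) + norm (g (cis \<theta>))) powr p"
        by (intro powr_mono2 norm_triangle_ineq) (use assms in auto)
      also have "\<dots> \<le> 2 powr p * (norm (f (cis \<theta>)) powr p + norm (g (cis \<theta>)) powr p)"
        by (rule powr_add_le) (use assms in auto)
      finally show "norm (norm (f (cis \<theta>) + g (cis \<theta>)) powr p) \<le> norm (2 powr p * (norm (f (cis \<theta>)) powr p + norm (g (cis \<theta>)) powr p))"
        by simp
    qed
    show "(\<lambda>\<theta>. norm (f (cis \<theta>) + g (cis \<theta>)) powr p) \<in> borel_measurable cm"
      using meas_cm[OF m] by measurable
  qed
qed

lemma Lp_mult_Linf: assumes "Linf a" "Lp p f" "0 \<le> p" shows "Lp p (\<lambda>z. a z * f z)"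
  unfolding Lp_cm
proof
  obtain C where C: "0 < C" "AE \<theta> in cm. norm (a (cis \<theta>)) \<le> C" using assms(1) by (rule Linf_E)
  show m: "meas (\<lambda>z. a z * f z)" using assms by (auto dest: Lp_meas Linf_meas)
  show "integrable cm (\<lambda>\<theta>. norm (a (cis \<theta>) * f (cis \<theta>)) powr p)"
  proof (rule Bochner_Integration.integrable_bound)
    show "integrable cm (\<lambda>\<theta>. C powr p * norm (f (cis \<theta>)) powr p)"
      using assms by (intro integrable_mult_right Lp_integrable)
    show "AE \<theta> in cm. norm (norm (a (cis \<theta>) * f (cis \<theta>)) powr p) \<le> norm (C powr p * norm (f (cis \<theta>)) powr p)"
      using C(2)
    proof eventually_elim
      case (elim \<theta>)
      have "norm (a (cis \<theta>) * f (cis \<theta>)) powr p \<le> (C * norm (f (cis \<theta>))) powr p"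
        using elim assms(3) by (intro powr_mono2) (auto simp: norm_mult intro: mult_right_mono)
      also have "\<dots> = C powr p * norm (f (cis \<theta>)) powr p" using C by (simp add: powr_mult)
      finally show ?case by simp
    qed
    show "(\<lambda>\<theta>. norm (a (cis \<theta>) * f (cis \<theta>)) powr p) \<in> borel_measurable cm"
      using meas_cm[OF m] by measurable
  qed
qed

lemma Linf_const [simp]: "Linf (\<lambda>_. k)" by (auto simp: Linf_cm)
lemma Linf_powi [simp]: "Linf (\<lambda>z. z powi k)"
  unfolding Linf_cm by (auto intro!: exI[of _ 1] simp: cis_powi)
lemma Linf_ident [simp]: "Linf (\<lambda>z. z)"
  unfolding Linf_cm by (auto intro!: exI[of _ 1])
lemma Linf_inverse_ident [simp]: "Linf (\<lambda>z. inverse z)"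
  unfolding Linf_cm by (auto intro!: exI[of _ 1] simp: norm_inverse)
lemma Linf_mult: assumes "Linf f" "Linf g" shows "Linf (\<lambda>z. f z * g z)"
proof -
  obtain C where C: "0 < C" "AE \<theta> in cm. norm (f (cis \<theta>)) \<le> C" using assms(1) by (rule Linf_E)
  obtain D where D: "0 < D" "AE \<theta> in cm. norm (g (cis \<theta>)) \<le> D" using assms(2) by (rule Linf_E)
  have "AE \<theta> in cm. norm (f (cis \<theta>) * g (cis \<theta>)) \<le> C * D"
    using C(2) D(2) by eventually_elim (use C D in \<open>auto simp: norm_mult intro: mult_mono\<close>)
  then show ?thesis using assms by (auto simp: Linf_cm)
qed
lemma Linf_power: "Linf f \<Longrightarrow> Linf (\<lambda>z. f z ^ k)"
  by (induction k) (auto intro: Linf_mult)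
lemma Linf_tld: "Linf f \<Longrightarrow> Linf (tld f)"
proof -
  assume f: "Linf f"
  then obtain C where C: "AE \<theta> in cm. norm (f (cis \<theta>)) \<le> C" by (rule Linf_E)
  from AE_reflect[of "\<lambda>z. norm (f z) \<le> C", OF C] show ?thesis
    using f by (auto simp: Linf_cm tld_def[symmetric] meas_tld simp del: cis_inverse) (auto simp: tld_def)
qed
lemma Lp_cmult: "Lp p f \<Longrightarrow> 0 \<le> p \<Longrightarrow> Lp p (\<lambda>z. k * f z)" by (rule Lp_mult_Linf) auto
lemma Lp_minus: "Lp p f \<Longrightarrow> 0 \<le> p \<Longrightarrow> Lp p (\<lambda>z. - f z)" using Lp_cmult[of p f "-1"] by simp
lemma Lp_diff: "Lp p f \<Longrightarrow> Lp p g \<Longrightarrow> 0 \<le> p \<Longrightarrow> Lp p (\<lambda>z. f z - g z)"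
  using Lp_add[of p f "\<lambda>z. - g z"] Lp_minus by auto
lemma Lp_const: "0 \<le> p \<Longrightarrow> Lp p (\<lambda>_. k)" by (rule Linf_Lp) auto
lemma Lp_sum: "finite I \<Longrightarrow> (\<And>i. i \<in> I \<Longrightarrow> Lp p (f i)) \<Longrightarrow> 0 \<le> p \<Longrightarrow> Lp p (\<lambda>z. \<Sum>i\<in>I. f i z)"
  by (induction I rule: finite_induct) (auto intro: Lp_add Lp_const)

lemma Lp_tld: "Lp p f \<Longrightarrow> Lp p (tld f)"
  unfolding Lp_cm using integrable_reflect[of "\<lambda>z. norm (f z) powr p"] meas_tld
  by (auto simp: tld_def)

lemma normp_tld: "meas f \<Longrightarrow> normp p (tld f) = normp p f"
proof -
  assume "meas f"
  then have "(\<lambda>\<theta>. norm (f (cis \<theta>)) powr p) \<in> borel_measurable cm" using meas_cm by measurable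
  then show ?thesis unfolding normp_cm tld_def using integral_reflect[of "\<lambda>z. norm (f z) powr p"] by simp
qed

lemma Lp_Jop: "Lp p f \<Longrightarrow> 0 \<le> p \<Longrightarrow> Lp p (Jop f)"
  unfolding Jop_tld by (intro Lp_mult_Linf Lp_tld) auto

lemma Lp_imp_Lp1: assumes "Lp p f" "1 \<le> p" shows "Lp 1 f"
  unfolding Lp1_iff
proof
  show m: "meas f" using assms by (auto dest: Lp_meas)
  show "integrable cm (\<lambda>\<theta>. f (cis \<theta>))"
  proof (rule Bochner_Integration.integrable_bound)
    show "integrable cm (\<lambda>\<theta>. 1 + norm (f (cis \<theta>)) powr p)"
      using assms by (intro Bochner_Integration.integrable_add Lp_integrable) auto
    show "AE \<theta> in cm. norm (f (cis \<theta>)) \<le> norm (1 + norm (f (cis \<theta>)) powr p)"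
    proof (rule AE_I2)
      fix \<theta>
      show "norm (f (cis \<theta>)) \<le> norm (1 + norm (f (cis \<theta>)) powr p)"
      proof (cases "norm (f (cis \<theta>)) \<le> 1")
        case True
        moreover have "1 \<le> 1 + norm (f (cis \<theta>)) powr p" by simp
        ultimately show ?thesis unfolding real_norm_def by linarith
      next
        case False
        then have "norm (f (cis \<theta>)) powr 1 \<le> norm (f (cis \<theta>)) powr p"
          using assms by (intro powr_mono) auto
        then show ?thesis by simp
      qed
    qed
  qed (use m meas_cm in auto)
qed

lemma normp_nonneg [simp]: "0 \<le> normp p f" by (simp add: normp_cm)

lemma integral_powr_nonneg: "0 \<le> (\<integral>\<theta>. norm (f (cis \<theta>)) powr p \<partial>cm)"
  by (rule integral_nonneg_AE) auto

lemma normp_powr: "0 < p \<Longrightarrow> normp p f powr p = (\<integral>\<theta>. norm (f (cis \<theta>)) powr p \<partial>cm)"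
  unfolding normp_cm using integral_powr_nonneg[of f p] by (simp add: powr_powr)

lemma normp_le_iff:
  assumes "0 < p" "0 \<le> K"
  shows "normp p f \<le> K \<longleftrightarrow> (\<integral>\<theta>. norm (f (cis \<theta>)) powr p \<partial>cm) \<le> K powr p"
proof -
  have "normp p f \<le> K \<longleftrightarrow> normp p f powr p \<le> K powr p"
    using assms powr_mono2[of p "normp p f" K] powr_less_mono2[of p K "normp p f"] by fastforce
  then show ?thesis using assms by (simp add: normp_powr)
qed

lemma normp_zero: "0 < p \<Longrightarrow> aeq f (\<lambda>_. 0) \<Longrightarrow> meas f \<Longrightarrow> normp p f = 0"
  by (subst normp_cong[of f "\<lambda>_. 0"]) (auto simp: normp_cm)

lemma normp_Linf_mult:
  assumes "meas a" "AE \<theta> in cm. norm (a (cis \<theta>)) \<le> C" "0 \<le> C" "Lp p f" "0 < p"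
  shows "normp p (\<lambda>z. a z * f z) \<le> C * normp p f"
proof -
  have "Linf a" using assms by (auto simp: Linf_cm)
  have "(\<integral>\<theta>. norm (a (cis \<theta>) * f (cis \<theta>)) powr p \<partial>cm) \<le> (\<integral>\<theta>. C powr p * norm (f (cis \<theta>)) powr p \<partial>cm)"
  proof (rule integral_mono_AE)
    show "integrable cm (\<lambda>\<theta>. norm (a (cis \<theta>) * f (cis \<theta>)) powr p)"
      using Lp_mult_Linf[OF \<open>Linf a\<close> assms(4)] assms by (simp add: Lp_cm)
    show "AE \<theta> in cm. norm (a (cis \<theta>) * f (cis \<theta>)) powr p \<le> C powr p * norm (f (cis \<theta>)) powr p"
      using assms(2)
    proof eventually_elim
      case (elim \<theta>)
      have "norm (a (cis \<theta>) * f (cis \<theta>)) powr p \<le> (C * norm (f (cis \<theta>))) powr p"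
        using elim assms by (intro powr_mono2) (auto simp: norm_mult intro: mult_right_mono)
      then show ?case using assms by (simp add: powr_mult)
    qed
  qed (use assms in \<open>auto intro: Lp_integrable\<close>)
  also have "\<dots> = (C * normp p f) powr p"
    using assms by (simp add: powr_mult normp_powr)
  finally show ?thesis using assms by (subst normp_le_iff) auto
qed

lemma normp_cmult: assumes "Lp p f" "0 < p" shows "normp p (\<lambda>z. k * f z) = norm k * normp p f"
  using assms unfolding normp_cm
  by (simp add: norm_mult powr_mult powr_powr integral_powr_nonneg)

lemma normp_minus: "normp p (\<lambda>z. - f z) = normp p f" by (simp add: normp_cm)

lemma normp_minus_commute: "normp p (\<lambda>z. f z - g z) = normp p (\<lambda>z. g z - f z)"
  by (simp add: normp_cm norm_minus_commute)

text \<open>On the open half line this is convexity of the power. If \<open>x\<close> or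
  \<open>y\<close> is zero only one term survives, and the claim becomes
  \<open>s powr p \<le> s\<close> for a weight \<open>s\<close> between 0 and 1.\<close>

lemma powr_convex_nonneg:
  fixes x y t p :: real
  assumes "1 \<le> p" "0 \<le> x" "0 \<le> y" "0 \<le> t" "t \<le> 1"
  shows "((1 - t) * x + t * y) powr p \<le> (1 - t) * x powr p + t * y powr p"
proof -
  have small: "(s * u) powr p \<le> s * u powr p" if "0 \<le> s" "s \<le> 1" "0 \<le> u" for s u :: real
  proof (cases "s = 0")
    case False
    then have "s powr p \<le> s powr 1" using that assms by (intro powr_mono') auto
    then show ?thesis using that by (simp add: powr_mult mult_right_mono)
  qed simp
  consider "x = 0" | "y = 0" | "0 < x" "0 < y" using assms by linarith
  then show ?thesis
  proof cases
    case 1 then show ?thesis using small[of t y] assms by simp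
  next
    case 2 then show ?thesis using small[of "1 - t" x] assms by simp
  next
    case 3
    have "convex_on {0<..} (\<lambda>x::real. x powr p)" using assms(1) by (rule powr_convex)
    from convex_onD[OF this, of t x y] 3 assms show ?thesis by simp
  qed
qed

text \<open>Convexity of \<open>x powr p\<close>, applied to the weights \<open>\<alpha> / (\<alpha> + \<beta>)\<close> and \<open>\<beta> / (\<alpha> + \<beta>)\<close>
  with \<open>\<alpha>, \<beta>\<close> the two norms.\<close>
lemma normp_triangle:
  assumes "Lp p f" "Lp p g" "1 \<le> p"
  shows "normp p (\<lambda>z. f z + g z) \<le> normp p f + normp p g"
proof -
  have key: "normp p (\<lambda>z. f z + g z) \<le> \<alpha> + \<beta>"
    if ab: "normp p f \<le> \<alpha>" "normp p g \<le> \<beta>" "0 < \<alpha>" "0 < \<beta>" for \<alpha> \<beta>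
  proof -
    define s t where "s = \<alpha> / (\<alpha> + \<beta>)" and "t = \<beta> / (\<alpha> + \<beta>)"
    have st: "0 \<le> s" "0 \<le> t" "s + t = 1" using ab by (auto simp: s_def t_def add_divide_distrib[symmetric])
    have pt: "norm (f z + g z) powr p \<le> (\<alpha> + \<beta>) powr p * (s * (norm (f z) powr p / \<alpha> powr p) + t * (norm (g z) powr p / \<beta> powr p))" for z
    proof -
      let ?x = "norm (f z) / \<alpha>" and ?y = "norm (g z) / \<beta>"
      have s: "s = 1 - t" using st by simp
      have "(\<alpha> + \<beta>) * s = \<alpha>" "(\<alpha> + \<beta>) * t = \<beta>" using ab by (auto simp: s_def t_def)
      then have "(\<alpha> + \<beta>) * (s * ?x + t * ?y) = \<alpha> * ?x + \<beta> * ?y"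
        by (metis distrib_left mult.assoc)
      then have eq: "norm (f z) + norm (g z) = (\<alpha> + \<beta>) * (s * ?x + t * ?y)" using ab by simp
      have conv: "(s * ?x + t * ?y) powr p \<le> s * ?x powr p + t * ?y powr p"
        unfolding s by (rule powr_convex_nonneg) (use st ab assms(3) in auto)
      have "norm (f z + g z) powr p \<le> (norm (f z) + norm (g z)) powr p"
        using assms by (intro powr_mono2 norm_triangle_ineq) auto
      also have "\<dots> = (\<alpha> + \<beta>) powr p * (s * ?x + t * ?y) powr p"
        unfolding eq by (rule powr_mult)
      also have "\<dots> \<le> (\<alpha> + \<beta>) powr p * (s * ?x powr p + t * ?y powr p)"
        by (rule mult_left_mono[OF conv]) simp
      finally show ?thesis using ab by (simp only: powr_divide)
    qed
    have If: "(\<integral>\<theta>. norm (f (cis \<theta>)) powr p \<partial>cm) / \<alpha> powr p \<le> 1"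
      using ab assms normp_le_iff[of p \<alpha> f] by simp
    have Ig: "(\<integral>\<theta>. norm (g (cis \<theta>)) powr p \<partial>cm) / \<beta> powr p \<le> 1"
      using ab assms normp_le_iff[of p \<beta> g] by simp
    have intf: "integrable cm (\<lambda>\<theta>. norm (f (cis \<theta>)) powr p)" "integrable cm (\<lambda>\<theta>. norm (g (cis \<theta>)) powr p)"
      using assms by (auto intro: Lp_integrable)
    have "(\<integral>\<theta>. norm (f (cis \<theta>) + g (cis \<theta>)) powr p \<partial>cm)
       \<le> (\<integral>\<theta>. (\<alpha> + \<beta>) powr p * (s * (norm (f (cis \<theta>)) powr p / \<alpha> powr p) + t * (norm (g (cis \<theta>)) powr p / \<beta> powr p)) \<partial>cm)"
      by (rule integral_mono[OF Lp_integrable[OF Lp_add[OF assms(1,2)]]]) (use assms(3) intf pt in simp_all)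
    also have "\<dots> = (\<alpha> + \<beta>) powr p * (s * ((\<integral>\<theta>. norm (f (cis \<theta>)) powr p \<partial>cm) / \<alpha> powr p) + t * ((\<integral>\<theta>. norm (g (cis \<theta>)) powr p \<partial>cm) / \<beta> powr p))"
      using intf by simp
    also have "\<dots> \<le> (\<alpha> + \<beta>) powr p * (s * 1 + t * 1)"
      using If Ig st by (intro mult_left_mono add_mono) auto
    also have "\<dots> = (\<alpha> + \<beta>) powr p" using st by simp
    finally show ?thesis using ab assms by (subst normp_le_iff) auto
  qed
  show ?thesis
  proof (rule field_le_epsilon)
    fix e :: real assume "0 < e"
    with key[of "normp p f + e/2" "normp p g + e/2"] show "normp p (\<lambda>z. f z + g z) \<le> normp p f + normp p g + e"
      by (simp add: add_nonneg_pos)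
  qed
qed

lemma normp_triangle_diff:
  assumes "Lp p f" "Lp p g" "1 \<le> p"
  shows "normp p (\<lambda>z. f z - g z) \<le> normp p f + normp p g"
  using normp_triangle[of p f "\<lambda>z. - g z"] assms Lp_minus[of p g] by (simp add: normp_minus)

lemma normp_sum:
  assumes "finite I" "\<And>i. i \<in> I \<Longrightarrow> Lp p (f i)" "1 \<le> p"
  shows "normp p (\<lambda>z. \<Sum>i\<in>I. f i z) \<le> (\<Sum>i\<in>I. normp p (f i))"
  using assms
proof (induction I rule: finite_induct)
  case empty then show ?case by (simp add: normp_cm)
next
  case (insert i I)
  have "normp p (\<lambda>z. f i z + (\<Sum>i\<in>I. f i z)) \<le> normp p (f i) + normp p (\<lambda>z. \<Sum>i\<in>I. f i z)"
    using insert.prems insert.hyps by (intro normp_triangle Lp_sum) auto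
  also have "\<dots> \<le> normp p (f i) + (\<Sum>i\<in>I. normp p (f i))"
    using insert by (intro add_left_mono insert.IH) auto
  finally show ?case using insert.hyps by simp
qed

text \<open>Young's inequality is applied to \<open>f / \<alpha>\<close> and
  \<open>g / \<beta>\<close> for arbitrary positive upper bounds of the two norms, and the bounds
  then shrink to the norms. Keeping them positive spares a separate treatment of functions of norm
  zero.\<close>

lemma holder:
  assumes "Lp p f" "Lp q g" "1 < p" "1/p + 1/q = 1"
  shows Lp_mult: "Lp 1 (\<lambda>z. f z * g z)"
    and holder_bound: "(\<integral>\<theta>. norm (f (cis \<theta>) * g (cis \<theta>)) \<partial>cm) \<le> normp p f * normp q g"
proof -
  have q: "1 < q"
  proof -
    have "1/q = 1 - 1/p" using assms(4) by linarith
    moreover have "0 < 1 - 1/p" "1 - 1/p < 1" using assms(3) by auto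
    ultimately have "0 < 1/q" "1/q < 1" by linarith+
    then show ?thesis by (simp add: divide_less_eq split: if_splits)
  qed
  have intf: "integrable cm (\<lambda>\<theta>. norm (f (cis \<theta>)) powr p)" "integrable cm (\<lambda>\<theta>. norm (g (cis \<theta>)) powr q)"
    using assms(1,2) by (auto intro: Lp_integrable)
  have m: "meas (\<lambda>z. f z * g z)" using assms(1,2) by (auto dest: Lp_meas)
  have young: "norm (f z * g z) \<le> \<alpha> * \<beta> * (norm (f z) powr p / \<alpha> powr p / p + norm (g z) powr q / \<beta> powr q / q)"
    if "0 < \<alpha>" "0 < \<beta>" for \<alpha> \<beta> z
  proof -
    have "(norm (f z) / \<alpha>) * (norm (g z) / \<beta>) \<le> (norm (f z) / \<alpha>) powr p / p + (norm (g z) / \<beta>) powr q / q"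
      by (rule Youngs_inequality[OF assms(3) q assms(4)]) (use that in auto)
    also have "\<dots> = norm (f z) powr p / \<alpha> powr p / p + norm (g z) powr q / \<beta> powr q / q"
      using that by (simp add: powr_divide)
    finally have "(norm (f z) / \<alpha>) * (norm (g z) / \<beta>) * (\<alpha> * \<beta>) \<le> (norm (f z) powr p / \<alpha> powr p / p + norm (g z) powr q / \<beta> powr q / q) * (\<alpha> * \<beta>)"
      using that by (intro mult_right_mono) auto
    then show ?thesis using that by (simp add: norm_mult mult.commute)
  qed
  have int1: "integrable cm (\<lambda>\<theta>. f (cis \<theta>) * g (cis \<theta>))"
  proof (rule Bochner_Integration.integrable_bound)
    show "integrable cm (\<lambda>\<theta>. norm (f (cis \<theta>)) powr p / p + norm (g (cis \<theta>)) powr q / q)"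
      using intf by simp
    show "AE \<theta> in cm. norm (f (cis \<theta>) * g (cis \<theta>)) \<le> norm (norm (f (cis \<theta>)) powr p / p + norm (g (cis \<theta>)) powr q / q)"
    proof (rule AE_I2)
      fix \<theta>
      have "norm (f (cis \<theta>) * g (cis \<theta>)) \<le> norm (f (cis \<theta>)) powr p / p + norm (g (cis \<theta>)) powr q / q"
        using young[of 1 1 "cis \<theta>"] by simp
      then show "norm (f (cis \<theta>) * g (cis \<theta>)) \<le> norm (norm (f (cis \<theta>)) powr p / p + norm (g (cis \<theta>)) powr q / q)"
        by (rule order_trans) simp
    qed
  qed (rule meas_cm[OF m])
  then show "Lp 1 (\<lambda>z. f z * g z)" using m by (simp add: Lp1_iff)
  have key: "(\<integral>\<theta>. norm (f (cis \<theta>) * g (cis \<theta>)) \<partial>cm) \<le> \<alpha> * \<beta>"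
    if ab: "normp p f \<le> \<alpha>" "normp q g \<le> \<beta>" "0 < \<alpha>" "0 < \<beta>" for \<alpha> \<beta>
  proof -
    have If: "(\<integral>\<theta>. norm (f (cis \<theta>)) powr p \<partial>cm) / \<alpha> powr p \<le> 1"
      using ab assms(3) normp_le_iff[of p \<alpha> f] by simp
    have Ig: "(\<integral>\<theta>. norm (g (cis \<theta>)) powr q \<partial>cm) / \<beta> powr q \<le> 1"
      using ab q normp_le_iff[of q \<beta> g] by simp
    have "(\<integral>\<theta>. norm (f (cis \<theta>) * g (cis \<theta>)) \<partial>cm) \<le> (\<integral>\<theta>. \<alpha> * \<beta> * (norm (f (cis \<theta>)) powr p / \<alpha> powr p / p + norm (g (cis \<theta>)) powr q / \<beta> powr q / q) \<partial>cm)"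
      by (rule integral_mono) (use int1 intf young[OF ab(3,4)] in simp_all)
    also have "\<dots> = \<alpha> * \<beta> * ((\<integral>\<theta>. norm (f (cis \<theta>)) powr p \<partial>cm) / \<alpha> powr p / p + (\<integral>\<theta>. norm (g (cis \<theta>)) powr q \<partial>cm) / \<beta> powr q / q)"
      using intf by simp
    also have "\<dots> \<le> \<alpha> * \<beta> * (1 / p + 1 / q)"
      using If Ig ab assms(3) q by (intro mult_left_mono add_mono divide_right_mono) auto
    finally show ?thesis unfolding assms(4) by simp
  qed
  have "((\<lambda>e. (normp p f + e) * (normp q g + e)) \<longlongrightarrow> (normp p f + 0) * (normp q g + 0)) (at_right 0)"
    by (intro tendsto_intros)
  then have lim: "((\<lambda>e. (normp p f + e) * (normp q g + e)) \<longlongrightarrow> normp p f * normp q g) (at_right 0)" by simp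
  have "\<forall>\<^sub>F e in at_right 0. (\<integral>\<theta>. norm (f (cis \<theta>) * g (cis \<theta>)) \<partial>cm) \<le> (normp p f + e) * (normp q g + e)"
    unfolding eventually_at_right_field
  proof (intro exI[of _ 1] conjI allI impI)
    fix e :: real assume "0 < e"
    then show "(\<integral>\<theta>. norm (f (cis \<theta>) * g (cis \<theta>)) \<partial>cm) \<le> (normp p f + e) * (normp q g + e)"
      by (intro key) (auto intro: add_nonneg_pos)
  qed auto
  from tendsto_lowerbound[OF lim this] show "(\<integral>\<theta>. norm (f (cis \<theta>) * g (cis \<theta>)) \<partial>cm) \<le> normp p f * normp q g"
    by simp
qed

lemma integral_norm_le_normp:
  assumes "Lp p f" "1 < p"
  shows "(\<integral>\<theta>. norm (f (cis \<theta>)) \<partial>cm) \<le> 2 * pi * normp p f"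
proof -
  define q where "q = p / (p - 1)"
  have q: "1 < q" "1/p + 1/q = 1" using assms by (auto simp: q_def field_simps)
  \<comment> \<open>The exact factor is \<open>(2*pi) powr (1/q)\<close>; it is replaced by the
    larger \<open>2*pi\<close>, which does not depend on the exponent.\<close>
  have "normp q (\<lambda>_. 1) = (2*pi) powr (1/q)" by (simp add: normp_cm)
  also have "\<dots> \<le> (2*pi) powr 1" using q pi_ge_two by (intro powr_mono) auto
  finally have "normp q (\<lambda>_. 1) \<le> 2*pi" by simp
  then have "normp p f * normp q (\<lambda>_. 1) \<le> normp p f * (2*pi)" by (rule mult_left_mono) simp
  moreover have "(\<integral>\<theta>. norm (f (cis \<theta>)) \<partial>cm) \<le> normp p f * normp q (\<lambda>_. 1)"
    using holder_bound[OF assms(1) Lp_const[of q 1] assms(2) q(2)] q(1) by simp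
  ultimately show ?thesis by (simp add: mult.commute)
qed

section \<open>Fourier coefficients\<close>

lemma Lp1_cis_integrable: "Lp 1 f \<Longrightarrow> integrable cm (\<lambda>\<theta>. f (cis \<theta>) * cis (- (real_of_int n * \<theta>)))"
proof -
  assume "Lp 1 f"
  then have "Lp 1 (\<lambda>z. z powi (-n) * f z)" by (intro Lp_mult_Linf) auto
  then have "integrable cm (\<lambda>\<theta>. cis \<theta> powi (-n) * f (cis \<theta>))" by (rule Lp1_integrable)
  then show ?thesis unfolding cis_powi by (simp add: mult.commute)
qed

lemma fc_powi_form: "fc f n = (1 / (2*pi)) * (\<integral>\<theta>. f (cis \<theta>) * cis \<theta> powi (-n) \<partial>cm)"
  unfolding fc_cm cis_powi by simp

lemma fc_add: "Lp 1 f \<Longrightarrow> Lp 1 g \<Longrightarrow> fc (\<lambda>z. f z + g z) n = fc f n + fc g n"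
  unfolding fc_cm using Lp1_cis_integrable[of f n] Lp1_cis_integrable[of g n] by (simp add: algebra_simps)

lemma fc_diff: "Lp 1 f \<Longrightarrow> Lp 1 g \<Longrightarrow> fc (\<lambda>z. f z - g z) n = fc f n - fc g n"
  unfolding fc_cm using Lp1_cis_integrable[of f n] Lp1_cis_integrable[of g n] by (simp add: algebra_simps)

lemma fc_cmult: "fc (\<lambda>z. k * f z) n = k * fc f n"
  unfolding fc_cm by (simp add: mult.assoc)

lemma fc_minus: "fc (\<lambda>z. - f z) n = - fc f n"
  using fc_cmult[of "-1"] by simp

lemma fc_zero [simp]: "fc (\<lambda>_. 0) n = 0" by (simp add: fc_cm)

lemma fc_sum: "finite I \<Longrightarrow> (\<And>i. i \<in> I \<Longrightarrow> Lp 1 (f i)) \<Longrightarrow> fc (\<lambda>z. \<Sum>i\<in>I. f i z) n = (\<Sum>i\<in>I. fc (f i) n)"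
  by (induction I rule: finite_induct) (auto simp: fc_add Lp_sum)

lemma integral_cong_AE_complex:
  fixes f g :: "real \<Rightarrow> complex"
  assumes "AE \<theta> in M. f \<theta> = g \<theta>" "f \<in> borel_measurable M" "g \<in> borel_measurable M"
  shows "integral\<^sup>L M f = integral\<^sup>L M g"
  using assms by (intro integral_cong_AE) auto

lemma fc_cong: assumes "aeq f g" "meas f" "meas g" shows "fc f = fc g"
proof
  fix n
  have m: "(\<lambda>\<theta>. cis (- (real_of_int n * \<theta>))) \<in> borel_measurable cm" by (rule measurable_cm) measurable
  have "(\<integral>\<theta>. f (cis \<theta>) * cis (- (real_of_int n * \<theta>)) \<partial>cm) = (\<integral>\<theta>. g (cis \<theta>) * cis (- (real_of_int n * \<theta>)) \<partial>cm)"
    using assms(1) m meas_cm[OF assms(2)] meas_cm[OF assms(3)] unfolding aeq_cm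
    by (intro integral_cong_AE_complex) (auto elim: AE_mp)
  then show "fc f n = fc g n" unfolding fc_cm by simp
qed

lemma fc_powi_mult: "fc (\<lambda>z. z powi k * f z) n = fc f (n - k)"
proof -
  have "cis \<theta> powi k * f (cis \<theta>) * cis (- (real_of_int n * \<theta>)) = f (cis \<theta>) * cis (- (real_of_int (n - k) * \<theta>))" for \<theta>
  proof -
    have "cis \<theta> powi k * cis (- (real_of_int n * \<theta>)) = cis (- (real_of_int (n - k) * \<theta>))"
      unfolding cis_powi cis_mult by (simp add: algebra_simps)
    then show ?thesis by (metis mult.assoc mult.commute)
  qed
  then show ?thesis unfolding fc_cm by presburger
qed

lemma fc_ident_mult: "fc (\<lambda>z. z * f z) n = fc f (n - 1)"
  using fc_powi_mult[of 1 f n] by simp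

lemma fc_inverse_mult: "fc (\<lambda>z. inverse z * f z) n = fc f (n + 1)"
  using fc_powi_mult[of "-1" f n] by (simp add: power_int_minus)

lemma fc_tld: assumes "meas f" shows "fc (tld f) n = fc f (- n)"
proof -
  have "(\<lambda>\<theta>. f (cis \<theta>) * cis \<theta> powi n) \<in> borel_measurable cm"
    using meas_cm[OF meas_mult[OF assms meas_powi[of n]]] by simp
  from integral_reflect[of "\<lambda>z. f z * z powi n", OF this]
  moreover have "inverse (cis \<theta>) powi n = cis \<theta> powi (- n)" for \<theta>
    by (simp add: power_int_minus power_int_inverse del: cis_inverse)
  ultimately show ?thesis unfolding fc_powi_form tld_def
    by (simp del: cis_inverse)
qed

text \<open>The map \<open>n \<mapsto> - n - 1\<close> exchanges nonnegative and negative indices.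
  This is why the flip carries the factor \<open>inverse z\<close>: it swaps the ranges of
  \<open>P\<close> and \<open>Q\<close> exactly.\<close>

lemma fc_Jop: "meas f \<Longrightarrow> fc (Jop f) n = fc f (- n - 1)"
  unfolding Jop_tld by (simp add: fc_inverse_mult fc_tld)

lemma integral_cis: "(\<integral>\<theta>. cis (real_of_int k * \<theta>) \<partial>cm) = (if k = 0 then 2*pi else 0)"
proof (cases "k = 0")
  case False
  have "((\<lambda>\<theta>. cis (real_of_int k * \<theta>)) has_integral
     (cis (real_of_int k * (2*pi)) / (\<i> * of_int k) - cis (real_of_int k * 0) / (\<i> * of_int k))) {0..2*pi}"
  proof (rule fundamental_theorem_of_calculus)
    fix x :: real
    have "((\<lambda>\<theta>. exp (\<i> * of_int k * of_real \<theta>) / (\<i> * of_int k)) has_vector_derivative exp (\<i> * of_int k * of_real x)) (at x within {0..2*pi})"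
      by (rule has_vector_derivative_real_field) (use False in \<open>auto intro!: derivative_eq_intros\<close>)
    then show "((\<lambda>\<theta>. cis (real_of_int k * \<theta>) / (\<i> * of_int k)) has_vector_derivative cis (real_of_int k * x)) (at x within {0..2*pi})"
      by (simp add: cis_conv_exp mult_ac)
  qed simp
  moreover have "cis (real_of_int k * (2*pi)) = 1"
    using cis_multiple_2pi[of "real_of_int k"] by (simp add: mult_ac)
  ultimately have hi: "((\<lambda>\<theta>. cis (real_of_int k * \<theta>)) has_integral 0) {0..2*pi}" by simp
  have "Lp 1 (\<lambda>z. z powi k)" by (rule Linf_Lp) auto
  then have "integrable cm (\<lambda>\<theta>. cis (real_of_int k * \<theta>))" by (auto dest: Lp1_integrable simp: cis_powi)
  then have "set_integrable lborel {0..2*pi} (\<lambda>\<theta>. cis (real_of_int k * \<theta>))" by (simp add: set_integrable_cm)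
  from set_borel_integral_eq_integral(2)[OF this] hi show ?thesis
    using False by (simp add: set_integral_cm integral_unique)
qed (simp add: scaleR_conv_of_real)

lemma fc_powi: "fc (\<lambda>z. z powi k) n = (if n = k then 1 else 0)"
proof -
  have "cis \<theta> powi k * cis (- (real_of_int n * \<theta>)) = cis (real_of_int (k - n) * \<theta>)" for \<theta>
    unfolding cis_powi cis_mult by (simp add: algebra_simps)
  then show ?thesis unfolding fc_cm using integral_cis[of "k - n"] by simp
qed

lemma fc_const: "fc (\<lambda>_. k) n = (if n = 0 then k else 0)"
  using fc_cmult[of k "\<lambda>z. z powi 0" n] fc_powi[of 0 n] by simp

lemma norm_fc_le: assumes "Lp p f" "1 < p" shows "norm (fc f n) \<le> normp p f"
proof -
  have "norm (\<integral>\<theta>. f (cis \<theta>) * cis (- (real_of_int n * \<theta>)) \<partial>cm) \<le> (\<integral>\<theta>. norm (f (cis \<theta>)) \<partial>cm)"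
    by (rule order_trans[OF integral_norm_bound]) (simp add: norm_mult)
  also have "\<dots> \<le> 2 * pi * normp p f" by (rule integral_norm_le_normp[OF assms])
  finally show ?thesis unfolding fc_cm by (simp add: norm_mult norm_divide field_simps)
qed

section \<open>Completeness\<close>

text \<open>Fatou's lemma for the p-th powers. Pointwise convergence with bounded norms suffices,
  and this is all that is known of partial sums before their convergence in norm is
  established.\<close>

lemma Lp_Fatou:
  assumes "\<And>m. Lp p (h m)" "meas g" "AE \<theta> in cm. (\<lambda>m. h m (cis \<theta>)) \<longlonglongrightarrow> g (cis \<theta>)"
    and "\<And>m. normp p (h m) \<le> K" "0 < p" "0 \<le> K"
  shows "Lp p g" "normp p g \<le> K"
proof -
  have bd: "(\<integral>\<^sup>+\<theta>. ennreal (norm (h m (cis \<theta>)) powr p) \<partial>cm) \<le> ennreal (K powr p)" for m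
    using assms(4)[of m] assms(5,6) Lp_integrable[OF assms(1)[of m]]
    by (subst nn_integral_eq_integral) (auto simp: normp_le_iff intro: ennreal_leI)
  have "(\<integral>\<^sup>+\<theta>. ennreal (norm (g (cis \<theta>)) powr p) \<partial>cm)
      = (\<integral>\<^sup>+\<theta>. liminf (\<lambda>m. ennreal (norm (h m (cis \<theta>)) powr p)) \<partial>cm)"
  proof (rule nn_integral_cong_AE)
    show "AE \<theta> in cm. ennreal (norm (g (cis \<theta>)) powr p) = liminf (\<lambda>m. ennreal (norm (h m (cis \<theta>)) powr p))"
      using assms(3)
    proof eventually_elim
      case (elim \<theta>)
      have "(\<lambda>m. ennreal (norm (h m (cis \<theta>)) powr p)) \<longlonglongrightarrow> ennreal (norm (g (cis \<theta>)) powr p)"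
        by (intro tendsto_ennrealI tendsto_powr2 tendsto_norm elim tendsto_const) (use assms(5) in auto)
      then show ?case by (rule lim_imp_Liminf[OF trivial_limit_sequentially, symmetric])
    qed
  qed
  also have "\<dots> \<le> liminf (\<lambda>m. \<integral>\<^sup>+\<theta>. ennreal (norm (h m (cis \<theta>)) powr p) \<partial>cm)"
    by (intro nn_integral_liminf) (use meas_cm[OF Lp_meas[OF assms(1)]] in measurable)
  also have "\<dots> \<le> liminf (\<lambda>m. ennreal (K powr p))"
    by (intro Liminf_mono always_eventually allI bd)
  finally have le: "(\<integral>\<^sup>+\<theta>. ennreal (norm (g (cis \<theta>)) powr p) \<partial>cm) \<le> ennreal (K powr p)"
    by (simp add: Liminf_const)
  have m: "(\<lambda>\<theta>. norm (g (cis \<theta>)) powr p) \<in> borel_measurable cm" using meas_cm[OF assms(2)] by measurable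
  have int: "integrable cm (\<lambda>\<theta>. norm (g (cis \<theta>)) powr p)"
    using le m by (intro integrableI_bounded) (auto simp: le_less_trans)
  then show "Lp p g" using assms by (simp add: Lp_cm)
  have "ennreal (\<integral>\<theta>. norm (g (cis \<theta>)) powr p \<partial>cm) \<le> ennreal (K powr p)"
    using le int by (subst (asm) nn_integral_eq_integral) auto
  then show "normp p g \<le> K" using assms by (subst normp_le_iff) (auto simp: ennreal_le_iff)
qed

text \<open>Completeness in the form used below: an explicit bound for every tail, not just a limit.
  Summability of the L^1 norms gives absolute convergence almost everywhere, and Fatou's lemma then
  controls the tails in \<open>normp p\<close>.\<close>

lemma Lp_series:
  assumes p: "1 < p" and f: "\<And>j. Lp p (f j)" and r: "\<And>j. normp p (f j) \<le> r j" "summable r"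
  obtains g where "Lp p g" "\<And>k. normp p (\<lambda>z. g z - (\<Sum>j<k. f j z)) \<le> (\<Sum>j. r (j + k))"
proof -
  define g where "g z = (\<Sum>j. f j z)" for z
  have r0: "0 \<le> r j" for j using r(1)[of j] normp_nonneg[of p "f j"] by linarith
  have mf: "(\<lambda>\<theta>. f j (cis \<theta>)) \<in> borel_measurable cm" for j using f by (intro meas_cm Lp_meas)
  have mg: "meas g"
    unfolding meas_def g_def using Lp_meas[OF f] unfolding meas_def by (intro borel_measurable_suminf)
  have intf: "integrable cm (\<lambda>\<theta>. f j (cis \<theta>))" for j
    using f p by (intro Lp1_integrable Lp_imp_Lp1) auto
  have "AE \<theta> in cm. (\<Sum>j. ennreal (norm (f j (cis \<theta>)))) \<noteq> \<infinity>"
  proof (rule nn_integral_noteq_infinite)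
    have "(\<integral>\<^sup>+\<theta>. (\<Sum>j. ennreal (norm (f j (cis \<theta>)))) \<partial>cm) = (\<Sum>j. \<integral>\<^sup>+\<theta>. ennreal (norm (f j (cis \<theta>))) \<partial>cm)"
      using mf by (intro nn_integral_suminf) measurable
    also have "\<dots> \<le> (\<Sum>j. ennreal (2 * pi * r j))"
    proof (rule suminf_le)
      fix j
      have "(\<integral>\<theta>. norm (f j (cis \<theta>)) \<partial>cm) \<le> 2 * pi * normp p (f j)" by (rule integral_norm_le_normp[OF f p])
      also have "\<dots> \<le> 2 * pi * r j" using r by (intro mult_left_mono) auto
      finally show "(\<integral>\<^sup>+\<theta>. ennreal (norm (f j (cis \<theta>))) \<partial>cm) \<le> ennreal (2 * pi * r j)"
        using intf by (subst nn_integral_eq_integral) (auto intro: ennreal_leI)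
    qed auto
    also have "\<dots> = ennreal (\<Sum>j. 2 * pi * r j)"
      using r0 r by (intro suminf_ennreal2 summable_mult) auto
    also have "\<dots> < \<infinity>" by simp
    finally show "(\<integral>\<^sup>+\<theta>. (\<Sum>j. ennreal (norm (f j (cis \<theta>)))) \<partial>cm) \<noteq> \<infinity>" by simp
  qed (use mf in measurable)
  then have lim: "AE \<theta> in cm. (\<lambda>m. \<Sum>j<m. f j (cis \<theta>)) \<longlonglongrightarrow> g (cis \<theta>)"
  proof eventually_elim
    case (elim \<theta>)
    have "summable (\<lambda>j. norm (f j (cis \<theta>)))" using elim by (intro summable_suminf_not_top) auto
    then have "summable (\<lambda>j. f j (cis \<theta>))" by (rule summable_norm_cancel)
    then show ?case unfolding g_def by (rule summable_LIMSEQ)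
  qed
  have key: "Lp p (\<lambda>z. g z - (\<Sum>j<k. f j z)) \<and> normp p (\<lambda>z. g z - (\<Sum>j<k. f j z)) \<le> (\<Sum>j. r (j + k))" for k
  proof -
    have sr: "summable (\<lambda>j. r (j + k))" using r(2) by (simp add: summable_iff_shift)
    define h where "h m z = (\<Sum>j<m. f (j + k) z)" for m z
    have a1: "Lp p (h m)" for m unfolding h_def using f p by (intro Lp_sum) auto
    have a2: "meas (\<lambda>z. g z - (\<Sum>j<k. f j z))" by (intro meas_diff mg meas_sum Lp_meas[OF f])
    have a3: "AE \<theta> in cm. (\<lambda>m. h m (cis \<theta>)) \<longlonglongrightarrow> g (cis \<theta>) - (\<Sum>j<k. f j (cis \<theta>))"
      using lim
    proof eventually_elim
      case (elim \<theta>)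
      have "(\<lambda>m. (\<Sum>j<m+k. f j (cis \<theta>)) - (\<Sum>j<k. f j (cis \<theta>))) \<longlonglongrightarrow> g (cis \<theta>) - (\<Sum>j<k. f j (cis \<theta>))"
        using elim by (intro tendsto_diff tendsto_const LIMSEQ_ignore_initial_segment)
      moreover have "(\<Sum>j<m+k. f j (cis \<theta>)) - (\<Sum>j<k. f j (cis \<theta>)) = h m (cis \<theta>)" for m
        unfolding h_def by (induction m) auto
      ultimately show ?case by simp
    qed
    have a4: "normp p (h m) \<le> (\<Sum>j. r (j + k))" for m
    proof -
      have "normp p (h m) \<le> (\<Sum>j<m. normp p (f (j + k)))"
        unfolding h_def using f p by (intro normp_sum) auto
      also have "\<dots> \<le> (\<Sum>j<m. r (j + k))" by (intro sum_mono r)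
      also have "\<dots> \<le> (\<Sum>j. r (j + k))" using sr r0 by (intro sum_le_suminf) auto
      finally show ?thesis .
    qed
    have a5: "0 \<le> (\<Sum>j. r (j + k))" using sr r0 by (intro suminf_nonneg) auto
    show ?thesis using Lp_Fatou[OF a1 a2 a3 a4 _ a5] p by simp
  qed
  show thesis
  proof (rule that)
    show "Lp p g" using key[of 0] by simp
  qed (use key in blast)
qed

lemma suminf_tail_tendsto_0:
  fixes r :: "nat \<Rightarrow> real"
  assumes "summable r" shows "(\<lambda>k. \<Sum>j. r (j + k)) \<longlonglongrightarrow> 0"
proof -
  have "(\<lambda>k. suminf r - (\<Sum>j<k. r j)) \<longlonglongrightarrow> suminf r - suminf r"
    using assms by (intro tendsto_diff tendsto_const summable_LIMSEQ)
  then show ?thesis using suminf_minus_initial_segment[OF assms] by simp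
qed

section \<open>Trigonometric polynomials\<close>

text \<open>The condition is restricted to the circle because \<open>z powi k\<close> is not multiplicative in \<open>k\<close> at \<open>0\<close>.\<close>
definition trig :: "cfun \<Rightarrow> bool" where
  "trig f \<longleftrightarrow> (\<exists>A c. finite A \<and> (\<forall>z. norm z = 1 \<longrightarrow> f z = (\<Sum>k\<in>A. c k * z powi k)))"

lemma trig_cong: "trig f \<Longrightarrow> (\<And>z. norm z = 1 \<Longrightarrow> f z = g z) \<Longrightarrow> trig g"
  unfolding trig_def by metis

lemma trig_monom: "trig (\<lambda>z. k * z powi n)"
  unfolding trig_def by (intro exI[of _ "{n}"] exI[of _ "\<lambda>_. k"]) auto

lemma trig_const: "trig (\<lambda>_. k)" using trig_monom[of k 0] by simp

lemma trig_add: assumes "trig f" "trig g" shows "trig (\<lambda>z. f z + g z)"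
proof -
  obtain A c where A: "finite A" "\<And>z. norm z = 1 \<Longrightarrow> f z = (\<Sum>k\<in>A. c k * z powi k)"
    using assms(1) by (auto simp: trig_def)
  obtain B d where B: "finite B" "\<And>z. norm z = 1 \<Longrightarrow> g z = (\<Sum>k\<in>B. d k * z powi k)"
    using assms(2) by (auto simp: trig_def)
  let ?c = "\<lambda>k. (if k \<in> A then c k else 0) + (if k \<in> B then d k else 0)"
  have "f z + g z = (\<Sum>k\<in>A\<union>B. ?c k * z powi k)" if "norm z = 1" for z
  proof -
    have "(\<Sum>k\<in>A. c k * z powi k) = (\<Sum>k\<in>A\<union>B. (if k \<in> A then c k else 0) * z powi k)"
      using A B by (intro sum.mono_neutral_cong_left) auto
    moreover have "(\<Sum>k\<in>B. d k * z powi k) = (\<Sum>k\<in>A\<union>B. (if k \<in> B then d k else 0) * z powi k)"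
      using A B by (intro sum.mono_neutral_cong_left) auto
    ultimately show ?thesis using A(2)[OF that] B(2)[OF that] by (simp add: sum.distrib distrib_right)
  qed
  then show ?thesis unfolding trig_def using A(1) B(1) by (intro exI[of _ "A\<union>B"] exI[of _ ?c]) auto
qed

lemma trig_sum: "finite I \<Longrightarrow> (\<And>i. i \<in> I \<Longrightarrow> trig (f i)) \<Longrightarrow> trig (\<lambda>z. \<Sum>i\<in>I. f i z)"
  by (induction I rule: finite_induct) (auto intro: trig_add trig_const)

lemma trig_mult: assumes "trig f" "trig g" shows "trig (\<lambda>z. f z * g z)"
proof -
  obtain A c where A: "finite A" "\<And>z. norm z = 1 \<Longrightarrow> f z = (\<Sum>k\<in>A. c k * z powi k)"
    using assms(1) by (auto simp: trig_def)
  obtain B d where B: "finite B" "\<And>z. norm z = 1 \<Longrightarrow> g z = (\<Sum>k\<in>B. d k * z powi k)"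
    using assms(2) by (auto simp: trig_def)
  have "trig (\<lambda>z. \<Sum>k\<in>A. \<Sum>j\<in>B. (c k * d j) * z powi (k + j))"
    using A B by (intro trig_sum trig_monom) auto
  then show ?thesis
  proof (rule trig_cong)
    fix z :: complex assume z: "norm z = 1"
    then have "z \<noteq> 0" by auto
    then show "(\<Sum>k\<in>A. \<Sum>j\<in>B. (c k * d j) * z powi (k + j)) = f z * g z"
      unfolding A(2)[OF z] B(2)[OF z] by (simp add: sum_product power_int_add mult_ac)
  qed
qed

lemma trig_cmult: "trig f \<Longrightarrow> trig (\<lambda>z. k * f z)"
  by (intro trig_mult trig_const)

lemma trig_diff: "trig f \<Longrightarrow> trig g \<Longrightarrow> trig (\<lambda>z. f z - g z)"
  using trig_add[of f "\<lambda>z. -1 * g z"] trig_cmult[of g "-1"] by simp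

lemma trig_Linf: assumes "trig f" "meas f" shows "Linf f"
proof -
  obtain A c where A: "finite A" "\<And>z. norm z = 1 \<Longrightarrow> f z = (\<Sum>k\<in>A. c k * z powi k)"
    using assms(1) by (auto simp: trig_def)
  have "norm (f (cis \<theta>)) \<le> (\<Sum>k\<in>A. norm (c k))" for \<theta>
    unfolding A(2)[OF norm_cis] by (rule order_trans[OF norm_sum]) (simp add: norm_mult cis_powi)
  then show ?thesis using assms by (auto simp: Linf_cm)
qed

lemma trig_meas: assumes "trig f" shows "meas f"
proof -
  obtain A c where A: "finite A" "\<And>z. norm z = 1 \<Longrightarrow> f z = (\<Sum>k\<in>A. c k * z powi k)"
    using assms(1) by (auto simp: trig_def)
  have "meas (\<lambda>z. \<Sum>k\<in>A. c k * z powi k)" by (intro meas_sum meas_mult) auto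
  then show ?thesis unfolding meas_def by (simp add: A(2))
qed

lemma trig_Lp: "trig f \<Longrightarrow> 0 \<le> p \<Longrightarrow> Lp p f"
  by (intro Linf_Lp trig_Linf trig_meas)

lemma trig_fourier:
  assumes "trig f"
  obtains N :: nat where "\<And>z. norm z = 1 \<Longrightarrow> f z = (\<Sum>k\<in>{- int N..int N}. fc f k * z powi k)"
    "\<And>k. k \<notin> {- int N..int N} \<Longrightarrow> fc f k = 0"
proof -
  obtain A c where A: "finite A" "\<And>z. norm z = 1 \<Longrightarrow> f z = (\<Sum>k\<in>A. c k * z powi k)"
    using assms(1) by (auto simp: trig_def)
  have fc: "fc f n = (if n \<in> A then c n else 0)" for n
  proof -
    have "fc f n = fc (\<lambda>z. \<Sum>k\<in>A. c k * z powi k) n"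
      by (simp add: fc_cm A(2))
    also have "\<dots> = (\<Sum>k\<in>A. fc (\<lambda>z. c k * z powi k) n)"
      using A(1) by (intro fc_sum trig_Lp trig_monom) auto
    also have "\<dots> = (\<Sum>k\<in>A. if n = k then c k else 0)"
      by (intro sum.cong refl) (simp add: fc_cmult fc_powi)
    finally show ?thesis using A(1) by simp
  qed
  define N where "N = nat (Max (insert 0 (abs ` A)))"
  have N: "A \<subseteq> {- int N..int N}"
  proof
    fix k assume "k \<in> A"
    then have "\<bar>k\<bar> \<le> Max (insert 0 (abs ` A))" using A(1) by (intro Max_ge) auto
    then have "\<bar>k\<bar> \<le> int N" unfolding N_def by (metis abs_ge_zero int_nat_eq order_trans)
    then show "k \<in> {- int N..int N}" by auto
  qed
  show thesis
  proof (rule that[of N])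
    fix z :: complex assume z: "norm z = 1"
    have "(\<Sum>k\<in>A. c k * z powi k) = (\<Sum>k\<in>{- int N..int N}. fc f k * z powi k)"
      using N by (intro sum.mono_neutral_cong_left) (auto simp: fc)
    then show "f z = (\<Sum>k\<in>{- int N..int N}. fc f k * z powi k)" using A(2)[OF z] by simp
  qed (use N in \<open>auto simp: fc\<close>)
qed

lemma real_polynomial_trig:
  assumes "real_polynomial_function g" shows "trig (\<lambda>z. complex_of_real (g z))"
  using assms
proof induction
  case (linear f)
  interpret bounded_linear f by fact
  have Re: "trig (\<lambda>z. complex_of_real (Re z))"
  proof (rule trig_cong)
    show "trig (\<lambda>z. (1/2) * z powi 1 + (1/2) * z powi (-1))" by (intro trig_add trig_monom)
    fix z :: complex assume "norm z = 1"
    then have "inverse z = cnj z" by (simp add: inverse_complex_def complex_eq_iff cmod_def)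
    then show "(1/2) * z powi 1 + (1/2) * z powi (-1) = complex_of_real (Re z)"
      by (simp add: power_int_minus complex_eq_iff)
  qed
  have Im: "trig (\<lambda>z. complex_of_real (Im z))"
  proof (rule trig_cong)
    show "trig (\<lambda>z. (-\<i>/2) * z powi 1 + (\<i>/2) * z powi (-1))" by (intro trig_add trig_monom)
    fix z :: complex assume "norm z = 1"
    then have "inverse z = cnj z" by (simp add: inverse_complex_def complex_eq_iff cmod_def)
    then show "(-\<i>/2) * z powi 1 + (\<i>/2) * z powi (-1) = complex_of_real (Im z)"
      by (simp add: power_int_minus complex_eq_iff)
  qed
  have "f z = f (Re z *\<^sub>R 1 + Im z *\<^sub>R \<i>)" for z
    by (rule arg_cong[of _ _ f]) (simp add: complex_eq_iff)
  then have fz: "f z = Re z * f 1 + Im z * f \<i>" for z by (metis add scaleR real_scaleR_def)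
  have "trig (\<lambda>z. complex_of_real (f 1) * complex_of_real (Re z) + complex_of_real (f \<i>) * complex_of_real (Im z))"
    by (intro trig_add trig_cmult Re Im)
  then show ?case
  proof (rule trig_cong)
    fix z
    show "complex_of_real (f 1) * complex_of_real (Re z) + complex_of_real (f \<i>) * complex_of_real (Im z) = complex_of_real (f z)"
      unfolding fz[of z] by simp
  qed
qed (simp_all add: trig_const trig_add trig_mult)

lemma trig_uniform_approx:
  assumes "continuous_on (sphere 0 1) f" "0 < e"
  obtains \<phi> where "trig \<phi>" "\<And>z. norm z = 1 \<Longrightarrow> norm (f z - \<phi> z) < e"
proof -
  have c: "continuous_on (sphere 0 1) (\<lambda>z. Re (f z))" "continuous_on (sphere 0 1) (\<lambda>z. Im (f z))"
    using assms(1) by (auto intro: continuous_intros)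
  obtain g where g: "real_polynomial_function g" "\<And>x. x \<in> sphere 0 1 \<Longrightarrow> \<bar>Re (f x) - g x\<bar> < e/2"
    using Stone_Weierstrass_real_polynomial_function[OF compact_sphere c(1), of "e/2"] assms(2) by auto
  obtain h where h: "real_polynomial_function h" "\<And>x. x \<in> sphere 0 1 \<Longrightarrow> \<bar>Im (f x) - h x\<bar> < e/2"
    using Stone_Weierstrass_real_polynomial_function[OF compact_sphere c(2), of "e/2"] assms(2) by auto
  show thesis
  proof (rule that)
    show "trig (\<lambda>z. complex_of_real (g z) + \<i> * complex_of_real (h z))"
      using g h by (intro trig_add trig_cmult real_polynomial_trig)
    fix z :: complex assume z: "norm z = 1"
    have "norm (f z - (complex_of_real (g z) + \<i> * complex_of_real (h z))) \<le> \<bar>Re (f z) - g z\<bar> + \<bar>Im (f z) - h z\<bar>"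
      by (rule order_trans[OF cmod_le]) simp
    also have "\<dots> < e/2 + e/2" using g(2)[of z] h(2)[of z] z by (intro add_strict_mono) auto
    finally show "norm (f z - (complex_of_real (g z) + \<i> * complex_of_real (h z))) < e" by simp
  qed
qed

text \<open>Measurable functions are almost everywhere limits of continuous ones; the cutoff vanishing at both
  end points of the interval makes those periodic.\<close>
lemma trig_approx_AE:
  assumes h: "meas h" "AE \<theta> in cm. norm (h (cis \<theta>)) \<le> C" and C: "0 < C"
  obtains \<phi> :: "nat \<Rightarrow> cfun" where "\<And>n. trig (\<phi> n)" "\<And>n z. norm z = 1 \<Longrightarrow> norm (\<phi> n z) \<le> C + 1"
    "AE \<theta> in cm. (\<lambda>n. \<phi> n (cis \<theta>)) \<longlonglongrightarrow> h (cis \<theta>)"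
proof -
  have "(\<lambda>\<theta>. h (cis \<theta>)) \<in> borel_measurable lebesgue"
    using h(1) unfolding meas_def by (intro measurable_completion)
  then have "(\<lambda>\<theta>. h (cis \<theta>)) measurable_on UNIV"
    by (subst measurable_on_iff_borel_measurable) (auto simp: lebesgue_on_UNIV_eq)
  then obtain N g where N: "negligible N" and gc: "\<And>n. continuous_on UNIV (g n)"
    and gl: "\<And>x. x \<notin> N \<Longrightarrow> (\<lambda>n. g n x) \<longlonglongrightarrow> h (cis x)"
    unfolding measurable_on_def if_P[OF UNIV_I] by blast
  \<comment> \<open>Radial retraction onto the disk of radius \<open>C\<close>. The continuous
    approximants \<open>g n\<close> come without a bound; since \<open>h\<close> takes its values in
    the disk, retracting them keeps the limit and makes them uniformly bounded.\<close>
  define tr where "tr w = (C / max C (norm w)) *\<^sub>R w" for w :: complex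
  have trc: "isCont tr w" for w unfolding tr_def using C by (intro continuous_intros) (auto simp: max_def)
  have trb: "norm (tr w) \<le> C" for w
  proof -
    have "C * norm w \<le> C * max C (norm w)" using C by (intro mult_left_mono) auto
    then have "C * norm w / max C (norm w) \<le> C" using C by (subst pos_divide_le_eq) (auto simp: less_max_iff_disj)
    then show ?thesis using C by (simp add: tr_def)
  qed
  have tri: "tr w = w" if "norm w \<le> C" for w using that C by (simp add: tr_def max_def)
  define ct where "ct n \<theta> = min 1 (real n * min \<theta> (2*pi - \<theta>))" for n and \<theta> :: real
  have chib: "\<bar>ct n \<theta>\<bar> \<le> 1" if "\<theta> \<in> {0..2*pi}" for n \<theta>
    using that by (auto simp: ct_def min_def)
  define G where "G n \<theta> = ct n \<theta> *\<^sub>R tr (g n \<theta>)" for n \<theta>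
  have Gc: "continuous_on S (G n)" for n S
  proof -
    have "continuous_on UNIV (\<lambda>\<theta>. tr (g n \<theta>))"
      using continuous_on_compose2[OF continuous_at_imp_continuous_on[of UNIV tr] gc[of n]] trc by auto
    then have "continuous_on UNIV (G n)" unfolding G_def ct_def by (intro continuous_intros) auto
    then show ?thesis by (rule continuous_on_subset) auto
  qed
  have Gb: "norm (G n \<theta>) \<le> C" if "\<theta> \<in> {0..2*pi}" for n \<theta>
    using mult_mono[OF chib[OF that, of n] trb[of "g n \<theta>"]] C by (simp add: G_def)
  define K where "K n z = G n (Arg2pi z)" for n z
  have Kc: "continuous_on (sphere 0 1) (K n)" for n
  proof -
    \<comment> \<open>\<open>G n\<close> has equal values at both ends and so defines a loop;
      passing from loops to circle maps gives continuity across the branch cut of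
      \<open>Arg2pi\<close>.\<close>
    define \<gamma> where "\<gamma> t = G n (2*pi*t)" for t
    have "path \<gamma>" unfolding path_def \<gamma>_def
      by (intro continuous_on_compose2[OF Gc[of UNIV]] continuous_intros) auto
    moreover have "pathfinish \<gamma> = pathstart \<gamma>"
      by (simp add: pathfinish_def pathstart_def \<gamma>_def G_def ct_def)
    ultimately have "homotopic_loops UNIV \<gamma> \<gamma>" by (simp add: homotopic_loops_refl)
    from homotopic_with_imp_continuous[OF homotopic_loops_imp_homotopic_circlemaps[OF this]]
    have "continuous_on (sphere 0 1) (\<gamma> \<circ> (\<lambda>z. Arg2pi z / (2*pi)))" by simp
    moreover have "\<gamma> \<circ> (\<lambda>z. Arg2pi z / (2*pi)) = K n" by (simp add: fun_eq_iff \<gamma>_def K_def)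
    ultimately show ?thesis by simp
  qed
  have Kb: "norm (K n z) \<le> C" for n z
    unfolding K_def using Arg2pi_ge_0[of z] Arg2pi_lt_2pi[of z] by (intro Gb) auto
  have "\<exists>\<phi>. trig \<phi> \<and> (\<forall>z. norm z = 1 \<longrightarrow> norm (K n z - \<phi> z) < inverse (real (Suc n)))" for n
    using trig_uniform_approx[OF Kc, of "inverse (real (Suc n))" n] by auto
  then obtain \<phi> where \<phi>: "\<And>n. trig (\<phi> n)" "\<And>n z. norm z = 1 \<Longrightarrow> norm (K n z - \<phi> n z) < inverse (real (Suc n))"
    by metis
  show thesis
  proof (rule that)
    fix n and z :: complex assume z: "norm z = 1"
    have "norm (\<phi> n z) \<le> norm (K n z) + norm (K n z - \<phi> n z)"
      by (metis norm_minus_commute norm_triangle_sub)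
    also have "\<dots> \<le> C + inverse (real (Suc n))" using Kb[of n z] \<phi>(2)[OF z, of n] by linarith
    also have "\<dots> \<le> C + 1" using inverse_le_1_iff[of "real (Suc n)"] by simp
    finally show "norm (\<phi> n z) \<le> C + 1" .
  next
    have "N \<in> null_sets lebesgue" using N by (simp add: negligible_iff_null_sets)
    then have "AE x in lebesgue. x \<notin> N" by (rule AE_not_in)
    then have "AE x in lborel. x \<notin> N" by (simp add: AE_completion_iff)
    then have "AE x in cm. x \<notin> N" unfolding AE_cm_iff by eventually_elim auto
    moreover have "AE x in cm. x \<noteq> 0 \<and> x \<noteq> 2*pi"
      unfolding AE_cm_iff using AE_lborel_singleton[of 0] AE_lborel_singleton[of "2*pi"]
      by eventually_elim auto
    moreover have "AE x in cm. x \<in> {0..2*pi}" using AE_space[of cm] by simp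
    ultimately show "AE \<theta> in cm. (\<lambda>n. \<phi> n (cis \<theta>)) \<longlonglongrightarrow> h (cis \<theta>)"
      using h(2)
    proof eventually_elim
      case (elim \<theta>)
      then have th: "0 < \<theta>" "\<theta> < 2*pi" by auto
      have K: "K n (cis \<theta>) = G n \<theta>" for n
        unfolding K_def using th Arg2pi_unique[of 1 \<theta> "cis \<theta>"] by (simp add: cis_conv_exp)
      have "(\<lambda>n. ct n \<theta>) \<longlonglongrightarrow> 1"
      proof (rule tendsto_eventually)
        obtain n0 :: nat where n0: "1 < real n0 * min \<theta> (2*pi - \<theta>)"
          using reals_Archimedean3[of "min \<theta> (2*pi - \<theta>)"] th by auto
        show "\<forall>\<^sub>F n in sequentially. ct n \<theta> = 1"
          using eventually_ge_at_top[of n0]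
        proof eventually_elim
          case (elim n)
          then have "real n0 * min \<theta> (2*pi - \<theta>) \<le> real n * min \<theta> (2*pi - \<theta>)"
            using th by (intro mult_right_mono) auto
          then show ?case using n0 by (simp add: ct_def)
        qed
      qed
      moreover have "(\<lambda>n. tr (g n \<theta>)) \<longlonglongrightarrow> tr (h (cis \<theta>))"
        using trc gl elim by (intro isCont_tendsto_compose[of _ tr]) auto
      ultimately have "(\<lambda>n. G n \<theta>) \<longlonglongrightarrow> 1 *\<^sub>R tr (h (cis \<theta>))" unfolding G_def by (rule tendsto_scaleR)
      then have 1: "(\<lambda>n. K n (cis \<theta>)) \<longlonglongrightarrow> h (cis \<theta>)" using elim by (simp add: K tri)
      have "(\<lambda>n. K n (cis \<theta>) - \<phi> n (cis \<theta>)) \<longlonglongrightarrow> 0"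
        by (rule Lim_null_comparison[OF _ LIMSEQ_inverse_real_of_nat])
          (use \<phi>(2)[of "cis \<theta>"] in \<open>auto intro!: always_eventually less_imp_le\<close>)
      from tendsto_diff[OF 1 this] show ?case by simp
    qed
  qed (use \<phi> in auto)
qed

section \<open>Uniqueness of Fourier coefficients and density of trigonometric polynomials\<close>

lemma trig_integral_zero:
  assumes "Lp 1 f" "\<And>n. fc f n = 0" "trig \<phi>"
  shows "(\<integral>\<theta>. f (cis \<theta>) * \<phi> (cis \<theta>) \<partial>cm) = 0"
proof -
  obtain A c where A: "finite A" "\<And>z. norm z = 1 \<Longrightarrow> \<phi> z = (\<Sum>k\<in>A. c k * z powi k)"
    using assms(3) by (auto simp: trig_def)
  have "(\<integral>\<theta>. f (cis \<theta>) * \<phi> (cis \<theta>) \<partial>cm) = (\<integral>\<theta>. (\<Sum>k\<in>A. c k * (f (cis \<theta>) * cis (- (real_of_int (-k) * \<theta>)))) \<partial>cm)"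
    by (simp add: A(2) cis_powi sum_distrib_left mult_ac)
  also have "\<dots> = (\<Sum>k\<in>A. c k * (\<integral>\<theta>. f (cis \<theta>) * cis (- (real_of_int (-k) * \<theta>)) \<partial>cm))"
    by (subst Bochner_Integration.integral_sum) (auto intro!: integrable_mult_right Lp1_cis_integrable[OF assms(1)] simp del: of_int_minus)
  also have "\<dots> = 0"
  proof (rule sum.neutral, rule ballI)
    fix k
    show "c k * (\<integral>\<theta>. f (cis \<theta>) * cis (- (real_of_int (-k) * \<theta>)) \<partial>cm) = 0"
      using assms(2)[of "-k"] unfolding fc_cm by simp
  qed
  finally show ?thesis .
qed

lemma borel_measurable_cnj: "f \<in> borel_measurable M \<Longrightarrow> (\<lambda>x. cnj (f x)) \<in> borel_measurable M"
  by (rule borel_measurable_continuous_on[of cnj]) (intro continuous_intros)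

lemma mult_cnj_sgn: "z * cnj (sgn z) = complex_of_real (norm z)"
proof (cases "z = 0")
  case False
  have "z * cnj (sgn z) = (z * cnj z) /\<^sub>R norm z" by (simp add: sgn_div_norm)
  also have "\<dots> = complex_of_real ((norm z)\<^sup>2) /\<^sub>R norm z" by (subst complex_norm_square) simp
  finally show ?thesis using False by (simp add: scaleR_conv_of_real power2_eq_square)
qed simp

text \<open>Pairing \<open>f\<close> with \<open>cnj (sgn f)\<close> gives the L^1 norm of
  \<open>f\<close>. This multiplier is an almost everywhere limit of uniformly bounded trigonometric
  polynomials, against each of which \<open>f\<close> integrates to zero, so dominated convergence
  makes the norm vanish.\<close>

theorem fourier_unique_zero:
  assumes "Lp 1 f" "\<And>n. fc f n = 0" shows "aeq f (\<lambda>_. 0)"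
proof -
  define h where "h z = cnj (sgn (f z))" for z
  have mf: "(\<lambda>\<theta>. f (cis \<theta>)) \<in> borel_measurable lborel" using assms(1) by (auto dest: Lp_meas simp: meas_def)
  have hm: "meas h" unfolding meas_def h_def sgn_div_norm complex_cnj_scaleR
    using mf borel_measurable_cnj[OF mf] by measurable
  have hb: "AE \<theta> in cm. norm (h (cis \<theta>)) \<le> 1" by (simp add: h_def norm_sgn)
  obtain \<phi> :: "nat \<Rightarrow> cfun" where \<phi>: "\<And>n. trig (\<phi> n)" "\<And>n z. norm z = 1 \<Longrightarrow> norm (\<phi> n z) \<le> 1 + 1"
    "AE \<theta> in cm. (\<lambda>n. \<phi> n (cis \<theta>)) \<longlonglongrightarrow> h (cis \<theta>)"
    using trig_approx_AE[OF hm hb] by auto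
  have "(\<lambda>n. \<integral>\<theta>. f (cis \<theta>) * \<phi> n (cis \<theta>) \<partial>cm) \<longlonglongrightarrow> (\<integral>\<theta>. f (cis \<theta>) * h (cis \<theta>) \<partial>cm)"
  proof (rule integral_dominated_convergence)
    show "integrable cm (\<lambda>\<theta>. 2 * norm (f (cis \<theta>)))" using assms(1) by (auto simp: Lp1_iff)
    show "AE \<theta> in cm. (\<lambda>n. f (cis \<theta>) * \<phi> n (cis \<theta>)) \<longlonglongrightarrow> f (cis \<theta>) * h (cis \<theta>)"
      using \<phi>(3) by eventually_elim (intro tendsto_intros)
    show "AE \<theta> in cm. norm (f (cis \<theta>) * \<phi> n (cis \<theta>)) \<le> 2 * norm (f (cis \<theta>))" for n
    proof (rule AE_I2)
      fix \<theta>
      show "norm (f (cis \<theta>) * \<phi> n (cis \<theta>)) \<le> 2 * norm (f (cis \<theta>))"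
        using mult_left_mono[OF \<phi>(2)[of "cis \<theta>" n], of "norm (f (cis \<theta>))"] by (simp add: norm_mult)
    qed
  qed (use mf hm trig_meas[OF \<phi>(1)] in \<open>auto intro!: measurable_cm borel_measurable_times simp: meas_def\<close>)
  then have "(\<integral>\<theta>. f (cis \<theta>) * h (cis \<theta>) \<partial>cm) = 0"
    using trig_integral_zero[OF assms \<phi>(1)] by (simp add: LIMSEQ_const_iff)
  moreover have "f (cis \<theta>) * h (cis \<theta>) = complex_of_real (norm (f (cis \<theta>)))" for \<theta>
    unfolding h_def by (rule mult_cnj_sgn)
  ultimately have "(\<integral>\<theta>. norm (f (cis \<theta>)) \<partial>cm) = 0" by simp
  then have "AE \<theta> in cm. norm (f (cis \<theta>)) = 0"
    using assms(1) by (subst (asm) integral_nonneg_eq_0_iff_AE) (auto simp: Lp1_iff)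
  then show ?thesis by (simp add: aeq_cm)
qed

lemma fourier_unique:
  assumes "Lp 1 f" "Lp 1 g" "\<And>n. fc f n = fc g n" shows "aeq f g"
proof -
  have "aeq (\<lambda>z. f z - g z) (\<lambda>_. 0)"
    by (rule fourier_unique_zero) (use assms in \<open>auto intro: Lp_diff simp: fc_diff\<close>)
  then show ?thesis by (simp add: aeq_cm)
qed

lemma tendsto_normp_zero:
  assumes "(\<lambda>n. \<integral>\<theta>. norm (f n (cis \<theta>)) powr p \<partial>cm) \<longlonglongrightarrow> 0" "1 < p"
  shows "(\<lambda>n. normp p (f n)) \<longlonglongrightarrow> 0"
  unfolding normp_cm
  using tendsto_powr2[OF assms(1) tendsto_const[of "1/p"]] assms(2) integral_powr_nonneg by simp

text \<open>Truncation at height \<open>M\<close> makes \<open>f\<close> bounded, and a bounded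
  function is an almost everywhere limit of uniformly bounded trigonometric polynomials. Dominated
  convergence turns each of the two pointwise limits into an approximation in norm.\<close>

lemma trig_dense:
  assumes f: "Lp p f" and p: "1 < p" and e: "0 < e"
  obtains \<phi> where "trig \<phi>" "normp p (\<lambda>z. f z - \<phi> z) < e"
proof -
  have mf: "(\<lambda>\<theta>. f (cis \<theta>)) \<in> borel_measurable lborel" using f by (auto dest: Lp_meas simp: meas_def)
  define F where "F M z = (if norm (f z) \<le> real M then f z else 0)" for M z
  have mF: "meas (F M)" for M unfolding meas_def F_def using mf by measurable
  have "(\<lambda>M. \<integral>\<theta>. norm (f (cis \<theta>) - F M (cis \<theta>)) powr p \<partial>cm) \<longlonglongrightarrow> (\<integral>\<theta>. 0 \<partial>cm)"
  proof (rule integral_dominated_convergence)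
    show "integrable cm (\<lambda>\<theta>. norm (f (cis \<theta>)) powr p)" by (rule Lp_integrable[OF f])
    show "AE \<theta> in cm. norm (norm (f (cis \<theta>) - F M (cis \<theta>)) powr p) \<le> norm (f (cis \<theta>)) powr p" for M
      by (auto simp: F_def)
    show "AE \<theta> in cm. (\<lambda>M. norm (f (cis \<theta>) - F M (cis \<theta>)) powr p) \<longlonglongrightarrow> 0"
    proof (rule AE_I2, rule tendsto_eventually)
      fix \<theta>
      obtain M0 :: nat where "norm (f (cis \<theta>)) \<le> real M0" using real_arch_simple by blast
      then have "norm (f (cis \<theta>)) \<le> real M" if "M0 \<le> M" for M
        using that by (meson of_nat_mono order_trans)
      then show "\<forall>\<^sub>F M in sequentially. norm (f (cis \<theta>) - F M (cis \<theta>)) powr p = 0"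
        unfolding F_def by (intro eventually_sequentiallyI[of M0]) simp
    qed
    show "(\<lambda>\<theta>. norm (f (cis \<theta>) - F M (cis \<theta>)) powr p) \<in> borel_measurable cm" for M
      using meas_cm[OF meas_diff[OF Lp_meas[OF f] mF]] by measurable
  qed simp
  then have "(\<lambda>M. normp p (\<lambda>z. f z - F M z)) \<longlonglongrightarrow> 0"
    using p by (intro tendsto_normp_zero) auto
  then have "\<forall>\<^sub>F M in sequentially. normp p (\<lambda>z. f z - F M z) < e/2" using e by (intro order_tendstoD) auto
  then obtain M where M: "normp p (\<lambda>z. f z - F M z) < e/2" by (auto dest: eventually_happens)
  have Fb: "AE \<theta> in cm. norm (F M (cis \<theta>)) \<le> real M + 1" by (auto simp: F_def)
  obtain \<phi> :: "nat \<Rightarrow> cfun" where \<phi>: "\<And>n. trig (\<phi> n)" "\<And>n z. norm z = 1 \<Longrightarrow> norm (\<phi> n z) \<le> (real M + 1) + 1"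
    "AE \<theta> in cm. (\<lambda>n. \<phi> n (cis \<theta>)) \<longlonglongrightarrow> F M (cis \<theta>)"
    using trig_approx_AE[OF mF Fb] by auto
  have "(\<lambda>n. \<integral>\<theta>. norm (F M (cis \<theta>) - \<phi> n (cis \<theta>)) powr p \<partial>cm) \<longlonglongrightarrow> (\<integral>\<theta>. 0 \<partial>cm)"
  proof (rule integral_dominated_convergence)
    show "integrable cm (\<lambda>\<theta>. ((real M + 1) + (real M + 2)) powr p)" by simp
    show "AE \<theta> in cm. norm (norm (F M (cis \<theta>) - \<phi> n (cis \<theta>)) powr p) \<le> ((real M + 1) + (real M + 2)) powr p" for n
      using Fb
    proof eventually_elim
      case (elim \<theta>)
      have "norm (F M (cis \<theta>) - \<phi> n (cis \<theta>)) \<le> (real M + 1) + (real M + 2)"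
        using elim \<phi>(2)[of "cis \<theta>" n] by (intro order_trans[OF norm_triangle_ineq4]) auto
      then show ?case using p by (simp add: powr_mono2)
    qed
    show "AE \<theta> in cm. (\<lambda>n. norm (F M (cis \<theta>) - \<phi> n (cis \<theta>)) powr p) \<longlonglongrightarrow> 0"
      using \<phi>(3)
    proof eventually_elim
      case (elim \<theta>)
      have "(\<lambda>n. norm (F M (cis \<theta>) - \<phi> n (cis \<theta>))) \<longlonglongrightarrow> norm (F M (cis \<theta>) - F M (cis \<theta>))"
        by (intro tendsto_intros elim)
      from tendsto_powr2[OF this tendsto_const[of p]] show ?case using p by simp
    qed
    show "(\<lambda>\<theta>. norm (F M (cis \<theta>) - \<phi> n (cis \<theta>)) powr p) \<in> borel_measurable cm" for n
      using meas_cm[OF meas_diff[OF mF trig_meas[OF \<phi>(1)]]] by measurable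
  qed simp
  then have "(\<lambda>n. normp p (\<lambda>z. F M z - \<phi> n z)) \<longlonglongrightarrow> 0"
    using p by (intro tendsto_normp_zero) auto
  then have "\<forall>\<^sub>F n in sequentially. normp p (\<lambda>z. F M z - \<phi> n z) < e/2" using e by (intro order_tendstoD) auto
  then obtain n where n: "normp p (\<lambda>z. F M z - \<phi> n z) < e/2" by (auto dest: eventually_happens)
  have LF: "Lp p (F M)" using mF Fb p by (intro Lp_bounded) auto
  have L\<phi>: "Lp p (\<phi> n)" using \<phi>(1) p by (intro trig_Lp) auto
  have "normp p (\<lambda>z. (f z - F M z) + (F M z - \<phi> n z)) \<le> normp p (\<lambda>z. f z - F M z) + normp p (\<lambda>z. F M z - \<phi> n z)"
    using f LF L\<phi> p by (intro normp_triangle Lp_diff) auto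
  then have "normp p (\<lambda>z. f z - \<phi> n z) < e" using M n by simp
  then show thesis using that \<phi>(1) by blast
qed

section \<open>The theorem of M. Riesz\<close>

text \<open>As \<open>1 < p\<close>, the angle \<open>p * t\<close> passes \<open>pi/2\<close>
  before \<open>t\<close> does; as \<open>p \<le> 2\<close>, it stays where the cosine decreases.
  Hence \<open>cos (p * t)\<close> is negative and bounded away from zero wherever
  \<open>cos t\<close> is small, and one of the two terms always dominates.\<close>

lemma one_le_cos_powr:
  fixes p :: real assumes p: "1 < p" "p \<le> 2"
  obtains A B where "0 \<le> A" "0 \<le> B" "\<And>t. \<bar>t\<bar> < pi/2 \<Longrightarrow> 1 \<le> A * cos t powr p - B * cos (p * t)"
proof -
  \<comment> \<open>The midpoint of \<open>pi / (2 * p)\<close>, where \<open>cos (p * t)\<close>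
    changes sign, and \<open>pi / 2\<close>, where \<open>cos t\<close> vanishes.\<close>
  define t0 where "t0 = pi * (1 + p) / (4 * p)"
  have pt0: "p * t0 = pi * (1 + p) / 4" using p by (simp add: t0_def)
  have "pi * (1 + p) < pi * (2 * p)" using p by (intro mult_strict_left_mono) auto
  then have t0: "0 < t0" "t0 < pi/2" using p by (auto simp: t0_def pos_divide_less_eq zero_less_mult_iff)
  have pt1: "pi/2 < p * t0"
  proof -
    have "pi * 2 < pi * (1 + p)" using p by (intro mult_strict_left_mono) auto
    then show ?thesis unfolding pt0 by simp
  qed
  have pt2: "p * t0 \<le> pi"
  proof -
    have "pi * (1 + p) \<le> pi * 4" using p by (intro mult_left_mono) auto
    then show ?thesis unfolding pt0 by simp
  qed
  define d where "d = - cos (p * t0)"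
  have "cos (p * t0) < cos (pi/2)" using pt1 pt2 by (intro cos_monotone_0_pi) auto
  then have d: "0 < d" by (simp add: d_def)
  \<comment> \<open>\<open>B\<close> makes the second term contribute at least 1 beyond
    \<open>t0\<close>. Before \<open>t0\<close>, \<open>A\<close> makes the first term at least
    \<open>1 + B\<close>, enough to pay for a loss of at most \<open>B\<close>.\<close>
  define B where "B = 1 / d"
  have B: "0 < B" using d by (simp add: B_def)
  have ct0: "0 < cos t0" using t0 by (intro cos_gt_zero) auto
  define A where "A = (1 + B) / cos t0 powr p"
  have A: "0 < A" using B ct0 by (simp add: A_def)
  show thesis
  proof (rule that[of A B])
    fix t :: real assume t: "\<bar>t\<bar> < pi/2"
    have ceq: "cos (p * t) = cos (p * \<bar>t\<bar>)" "cos t = cos \<bar>t\<bar>" by (auto simp: abs_if)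
    show "1 \<le> A * cos t powr p - B * cos (p * t)"
    proof (cases "t0 \<le> \<bar>t\<bar>")
      case True
      have "p * \<bar>t\<bar> \<le> 2 * (pi/2)" using t p by (intro mult_mono) auto
      then have "cos (p * \<bar>t\<bar>) \<le> cos (p * t0)" using True p pt1 t0
        by (intro cos_monotone_0_pi_le) auto
      then have "B * d \<le> B * - cos (p * t)" using B unfolding ceq d_def by (intro mult_left_mono) auto
      moreover have "B * d = 1" using d by (simp add: B_def)
      moreover have "0 \<le> A * cos t powr p" using A by simp
      ultimately show ?thesis by simp
    next
      case False
      then have "cos t0 \<le> cos \<bar>t\<bar>" using t0 by (intro cos_monotone_0_pi_le) auto
      then have "A * cos t0 powr p \<le> A * cos t powr p"
        using A p ct0 unfolding ceq by (intro mult_left_mono powr_mono2) auto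
      moreover have "A * cos t0 powr p = 1 + B" using ct0 by (simp add: A_def)
      moreover have "B * cos (p * t) \<le> B * 1" using B by (intro mult_left_mono) auto
      ultimately show ?thesis by simp
    qed
  qed (use A B in auto)
qed

section \<open>Continuous functions on the circle and conjugate functions\<close>

lemma integrable_cm_continuous:
  fixes f :: "complex \<Rightarrow> 'b::{banach, second_countable_topology}"
  assumes "continuous_on (sphere 0 1) f"
  shows "integrable cm (\<lambda>\<theta>. f (cis \<theta>))"
  unfolding set_integrable_cm[symmetric]
  by (rule borel_integrable_atLeastAtMost', rule continuous_on_compose2[OF assms]) (auto intro: continuous_intros)

lemma meas_continuous:
  assumes "continuous_on (sphere 0 1) f" shows "meas f"
proof -
  have "continuous_on UNIV (\<lambda>\<theta>. f (cis \<theta>))"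
    by (rule continuous_on_compose2[OF assms]) (auto intro: continuous_intros)
  then show ?thesis unfolding meas_def by (simp add: borel_measurable_continuous_onI)
qed

lemma Linf_continuous:
  assumes "continuous_on (sphere 0 1) f" shows "Linf f"
proof -
  have "bounded (f ` sphere 0 1)" using assms by (intro compact_imp_bounded compact_continuous_image) auto
  then obtain C where C: "\<And>z. z \<in> sphere 0 1 \<Longrightarrow> norm (f z) \<le> C" unfolding bounded_iff by blast
  have "norm (f (cis \<theta>)) \<le> C" for \<theta> by (rule C) simp
  then show ?thesis unfolding Linf_cm using meas_continuous[OF assms] by auto
qed

lemma Lp_continuous: "continuous_on (sphere 0 1) f \<Longrightarrow> 0 \<le> p \<Longrightarrow> Lp p f"
  by (intro Linf_Lp Linf_continuous)

lemma trig_continuous: assumes "trig f" shows "continuous_on (sphere 0 1) f"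
proof -
  obtain A c where A: "finite A" "\<And>z. norm z = 1 \<Longrightarrow> f z = (\<Sum>k\<in>A. c k * z powi k)"
    using assms(1) by (auto simp: trig_def)
  have "continuous_on (sphere 0 1) (\<lambda>z::complex. \<Sum>k\<in>A. c k * z powi k)"
    by (intro continuous_intros) auto
  then show ?thesis by (rule continuous_on_eq) (simp add: A(2))
qed

lemma mean_value_circle:
  fixes f :: cfun
  assumes "continuous_on (cball 0 1) f" "f holomorphic_on ball 0 1"
  shows "(\<integral>\<theta>. f (cis \<theta>) \<partial>cm) = 2 * pi * f 0"
proof -
  have "((\<lambda>u. f u / (u - 0)) has_contour_integral 2 * complex_of_real pi * \<i> * f 0) (part_circlepath 0 1 0 (2*pi))"
    using Cauchy_integral_circlepath[OF assms, of 0] by (simp add: circlepath_def)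
  then have "((\<lambda>t. f (cis t) * \<i>) has_integral 2 * complex_of_real pi * \<i> * f 0) {0..2*pi}"
    by (subst (asm) has_contour_integral_part_circlepath_iff) (auto simp: mult.assoc)
  from has_integral_mult_right[OF this, of "- \<i>"]
  have hi: "((\<lambda>t. f (cis t)) has_integral 2 * complex_of_real pi * f 0) {0..2*pi}" by (simp add: mult_ac)
  have "integrable cm (\<lambda>\<theta>. f (cis \<theta>))"
    using assms(1) by (intro integrable_cm_continuous) (auto intro: continuous_on_subset)
  then have "set_integrable lborel {0..2*pi} (\<lambda>\<theta>. f (cis \<theta>))" by (simp add: set_integrable_cm)
  from set_borel_integral_eq_integral(2)[OF this] hi show ?thesis
    by (simp add: set_integral_cm integral_unique)
qed

lemma entire_continuous: "F holomorphic_on UNIV \<Longrightarrow> continuous_on S F"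
  by (meson continuous_on_subset holomorphic_on_imp_continuous_on subset_UNIV)

text \<open>Minimum principle for \<open>Re F\<close>, read off from the maximum modulus of
  \<open>exp (- F)\<close>. Positivity inside the disk is what permits a holomorphic power of
  \<open>F\<close> there.\<close>

lemma Re_pos_ball:
  assumes F: "F holomorphic_on UNIV" and pos: "\<And>z. norm z = 1 \<Longrightarrow> 0 < Re (F z)" and z: "norm z \<le> 1"
  shows "0 < Re (F z)"
proof -
  have cF: "continuous_on S F" for S
    by (rule entire_continuous[OF F])
  have "continuous_on (sphere 0 1) (\<lambda>z. Re (F z))" using cF by (intro continuous_intros)
  then obtain w where w: "w \<in> sphere 0 1" "\<And>u. u \<in> sphere 0 1 \<Longrightarrow> Re (F w) \<le> Re (F u)"
    using continuous_attains_inf[of "sphere (0::complex) 1" "\<lambda>z. Re (F z)"] by fastforce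
  have "norm (exp (- F z)) \<le> exp (- Re (F w))"
  proof (rule maximum_modulus_frontier[of "\<lambda>z. exp (- F z)" "cball 0 1"])
    show "(\<lambda>z. exp (- F z)) holomorphic_on interior (cball 0 1)"
      using F by (intro holomorphic_intros) (auto intro: holomorphic_on_subset)
    show "continuous_on (closure (cball 0 1)) (\<lambda>z. exp (- F z))"
      using cF by (intro continuous_intros)
    fix u :: complex assume "u \<in> frontier (cball 0 1)"
    then have "u \<in> sphere 0 1" by simp
    then show "norm (exp (- F u)) \<le> exp (- Re (F w))" using w(2) by simp
  qed (use z in auto)
  then have "Re (F w) \<le> Re (F z)" by simp
  then show ?thesis using pos[of w] w by simp
qed

lemma normp_mono:
  assumes "meas f" "Lp p g" "AE \<theta> in cm. norm (f (cis \<theta>)) \<le> norm (g (cis \<theta>))" "0 < p"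
  shows "Lp p f" "normp p f \<le> normp p g"
proof -
  have le: "AE \<theta> in cm. norm (f (cis \<theta>)) powr p \<le> norm (g (cis \<theta>)) powr p"
    using assms(3) by eventually_elim (use assms(4) in \<open>auto intro: powr_mono2\<close>)
  have int: "integrable cm (\<lambda>\<theta>. norm (f (cis \<theta>)) powr p)"
  proof (rule Bochner_Integration.integrable_bound[OF Lp_integrable[OF assms(2)]])
    show "(\<lambda>\<theta>. norm (f (cis \<theta>)) powr p) \<in> borel_measurable cm" using meas_cm[OF assms(1)] by measurable
    show "AE \<theta> in cm. norm (norm (f (cis \<theta>)) powr p) \<le> norm (norm (g (cis \<theta>)) powr p)" using le by simp
  qed
  then show "Lp p f" using assms by (simp add: Lp_cm)
  have "(\<integral>\<theta>. norm (f (cis \<theta>)) powr p \<partial>cm) \<le> (\<integral>\<theta>. norm (g (cis \<theta>)) powr p \<partial>cm)"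
    using int le Lp_integrable[OF assms(2)] by (intro integral_mono_AE)
  then show "normp p f \<le> normp p g" using assms(4) by (subst normp_le_iff) (auto simp: normp_powr)
qed

text \<open>The mean of \<open>F\<^sup>p\<close> over the circle is \<open>F(0)\<^sup>p \<ge> 0\<close>, and \<open>\<bar>F\<bar>\<^sup>p \<le> A (Re F)\<^sup>p - B Re (F\<^sup>p)\<close> pointwise.\<close>
lemma conjugate_bound_positive:
  assumes p: "1 < p" "p \<le> 2"
  obtains K where "0 \<le> K" "\<And>F. F holomorphic_on UNIV \<Longrightarrow> Im (F 0) = 0 \<Longrightarrow> (\<And>z. norm z = 1 \<Longrightarrow> 0 < Re (F z))
    \<Longrightarrow> normp p F \<le> K * normp p (\<lambda>z. of_real (Re (F z)))"
proof -
  obtain A B where AB: "0 \<le> A" "0 \<le> B" "\<And>t. \<bar>t\<bar> < pi/2 \<Longrightarrow> 1 \<le> A * cos t powr p - B * cos (p * t)"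
    using one_le_cos_powr[OF p] by blast
  have pt: "norm w powr p \<le> A * Re w powr p - B * Re (exp (p * Ln w))" if w: "0 < Re w" for w
  proof -
    define t where "t = Im (Ln w)"
    have w0: "w \<noteq> 0" using w by auto
    have t: "\<bar>t\<bar> < pi/2" unfolding t_def using w by (rule Re_Ln_pos_lt_imp)
    have "w = exp (Ln w)" using w0 by simp
    then have "Re w = exp (Re (Ln w)) * cos (Im (Ln w))" by (metis Re_exp)
    then have re: "Re w = norm w * cos t" using w0 by (simp add: t_def)
    have "Re (exp (p * Ln w)) = exp (p * ln (norm w)) * cos (p * t)"
      using w0 by (simp add: Re_exp t_def)
    also have "exp (p * ln (norm w)) = norm w powr p" using w0 by (simp add: powr_def)
    finally have re2: "Re (exp (p * Ln w)) = norm w powr p * cos (p * t)" .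
    have "norm w powr p * 1 \<le> norm w powr p * (A * cos t powr p - B * cos (p * t))"
      using AB(3)[OF t] by (intro mult_left_mono) auto
    then show ?thesis unfolding re2 re powr_mult by (simp add: algebra_simps)
  qed
  show thesis
  proof (rule that[of "A powr (1/p)"])
    fix F assume F: "F holomorphic_on UNIV" "Im (F 0) = 0" and pos: "\<And>z. norm z = 1 \<Longrightarrow> 0 < Re (F z)"
    have posb: "0 < Re (F z)" if "norm z \<le> 1" for z using Re_pos_ball[OF F(1) pos that] .
    have cF: "continuous_on S F" for S
      by (rule entire_continuous[OF F(1)])
    have nnp: "F z \<notin> \<real>\<^sub>\<le>\<^sub>0" if "norm z \<le> 1" for z
      using posb[OF that] by (simp add: complex_nonpos_Reals_iff)
    \<comment> \<open>The p-th power of \<open>F\<close> by the principal branch, whose cut the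
      right half plane avoids.\<close>
    define G where "G z = exp (p * Ln (F z))" for z
    have hG: "G holomorphic_on ball 0 1"
      unfolding G_def using F(1) nnp by (intro holomorphic_intros) (auto intro: holomorphic_on_subset)
    have cG: "continuous_on (cball 0 1) G"
      unfolding G_def using nnp by (intro continuous_intros cF) auto
    have cGs: "continuous_on (sphere 0 1) G" using cG by (rule continuous_on_subset) auto
    have iG: "integrable cm (\<lambda>\<theta>. G (cis \<theta>))" by (rule integrable_cm_continuous[OF cGs])
    have "F 0 = of_real (Re (F 0))" using F(2) by (simp add: complex_eq_iff)
    then have "G 0 = exp (p * Ln (of_real (Re (F 0))))" by (simp add: G_def)
    also have "\<dots> = of_real (exp (p * ln (Re (F 0))))"
      using posb[of 0] by (simp add: Ln_of_real exp_of_real[symmetric])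
    finally have G0: "0 \<le> Re (G 0)" by simp
    have "Re (\<integral>\<theta>. G (cis \<theta>) \<partial>cm) = 2 * pi * Re (G 0)"
      using mean_value_circle[OF cG hG] by simp
    then have mean: "0 \<le> (\<integral>\<theta>. Re (G (cis \<theta>)) \<partial>cm)" using G0 iG by simp
    have LF: "Lp p F" "Lp p (\<lambda>z. of_real (Re (F z)))"
      using p by (auto intro!: Lp_continuous continuous_intros cF)
    have iR: "integrable cm (\<lambda>\<theta>. Re (F (cis \<theta>)) powr p)"
      using Lp_integrable[OF LF(2)] posb[of "cis _"] by (simp add: less_imp_le)
    have "(\<integral>\<theta>. norm (F (cis \<theta>)) powr p \<partial>cm) \<le> (\<integral>\<theta>. A * Re (F (cis \<theta>)) powr p - B * Re (G (cis \<theta>)) \<partial>cm)"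
      using Lp_integrable[OF LF(1)] iR iG pt posb unfolding G_def by (intro integral_mono) auto
    also have "\<dots> = A * (\<integral>\<theta>. Re (F (cis \<theta>)) powr p \<partial>cm) - B * (\<integral>\<theta>. Re (G (cis \<theta>)) \<partial>cm)"
      using iR iG by simp
    also have "\<dots> \<le> A * (\<integral>\<theta>. Re (F (cis \<theta>)) powr p \<partial>cm)" using mean AB by simp
    also have "(\<integral>\<theta>. Re (F (cis \<theta>)) powr p \<partial>cm) = normp p (\<lambda>z. of_real (Re (F z))) powr p"
      using p posb[of "cis _"] by (simp add: normp_powr less_imp_le)
    also have "A * normp p (\<lambda>z. of_real (Re (F z))) powr p = (A powr (1/p) * normp p (\<lambda>z. of_real (Re (F z)))) powr p"
      using AB(1) p by (simp add: powr_mult powr_powr)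
    finally show "normp p F \<le> A powr (1/p) * normp p (\<lambda>z. of_real (Re (F z)))"
      using p by (subst normp_le_iff) auto
  qed simp
qed

text \<open>The analytic completion of \<open>Re (\<Sum> c\<^sub>k z\<^sup>k)\<close>.\<close>
definition acompl :: "(int \<Rightarrow> complex) \<Rightarrow> nat \<Rightarrow> cfun" where
  "acompl c N z = of_real (Re (c 0)) + (\<Sum>k=1..N. (c (int k) + cnj (c (- int k))) * z ^ k)"

lemma acompl_holomorphic: "acompl c N holomorphic_on S"
  unfolding acompl_def by (intro holomorphic_intros)

lemma acompl_0: "Im (acompl c N 0) = 0"
  unfolding acompl_def by (simp add: power_0_left)

lemma sum_symmetric_interval:
  fixes g :: "int \<Rightarrow> complex"
  shows "(\<Sum>k\<in>{- int N..int N}. g k) = g 0 + (\<Sum>k=1..N. g (int k) + g (- int k))"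
proof (induction N)
  case (Suc N)
  have "{- int (Suc N)..int (Suc N)} = insert (int (Suc N)) (insert (- int (Suc N)) {- int N..int N})" by auto
  then show ?case using Suc by simp
qed simp

lemma inverse_eq_cnj: "norm z = 1 \<Longrightarrow> inverse z = cnj z"
  by (simp add: inverse_complex_def complex_eq_iff cmod_def)

text \<open>On the circle \<open>z powi (- k)\<close> is the conjugate of \<open>z ^ k\<close>, and
  a term may be replaced by its conjugate without changing the real part.\<close>

lemma Re_acompl:
  assumes "norm z = 1"
  shows "Re (acompl c N z) = Re (\<Sum>k\<in>{- int N..int N}. c k * z powi k)"
proof -
  have "Re (c (- int k) * z powi (- int k)) = Re (cnj (c (- int k)) * z ^ k)" for k
  proof -
    have "z powi (- int k) = cnj (z ^ k)"
      using inverse_eq_cnj[OF assms] by (simp add: power_int_minus power_inverse[symmetric])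
    then have "c (- int k) * z powi (- int k) = cnj (cnj (c (- int k)) * z ^ k)" by simp
    then have "Re (c (- int k) * z powi (- int k)) = Re (cnj (cnj (c (- int k)) * z ^ k))" by (rule arg_cong)
    then show ?thesis unfolding cnj.sel .
  qed
  then show ?thesis unfolding sum_symmetric_interval acompl_def
    by (simp add: Re_sum distrib_right)
qed

text \<open>\<open>acompl\<close> is only real linear in the coefficients. Multiplying them by
  \<open>- \<i>\<close> turns the real part of the sum into its imaginary part, so the two terms
  complete both parts; in the combination the conjugated coefficients cancel. The analytic part
  appears twice, except for its constant term.\<close>

lemma acompl_combine:
  "acompl c N z + \<i> * acompl (\<lambda>k. - \<i> * c k) N z = c 0 + 2 * (\<Sum>k=1..N. c (int k) * z ^ k)"
proof -
  have "acompl c N z + \<i> * acompl (\<lambda>k. - \<i> * c k) N z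
     = (of_real (Re (c 0)) + \<i> * of_real (Im (c 0))) + (\<Sum>k=1..N. (c (int k) + cnj (c (- int k))) * z ^ k + \<i> * ((- \<i> * c (int k) + cnj (- \<i> * c (- int k))) * z ^ k))"
    unfolding acompl_def by (simp add: sum.distrib sum_distrib_left distrib_left)
  also have "(\<Sum>k=1..N. (c (int k) + cnj (c (- int k))) * z ^ k + \<i> * ((- \<i> * c (int k) + cnj (- \<i> * c (- int k))) * z ^ k))
      = (\<Sum>k=1..N. 2 * (c (int k) * z ^ k))"
    by (intro sum.cong refl) (simp add: algebra_simps)
  also have "of_real (Re (c 0)) + \<i> * of_real (Im (c 0)) = c 0" by (simp add: complex_eq_iff)
  finally show ?thesis by (simp add: sum_distrib_left)
qed

text \<open>Split \<open>Re F\<close> into the difference of two strictly positive trigonometric polynomials that are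
  dominated by \<open>\<bar>Re F\<bar> + 2\<epsilon>\<close>, and complete both analytically.\<close>
lemma conjugate_bound:
  assumes p: "1 < p" "p \<le> 2"
  obtains K where "0 \<le> K" "\<And>F. F holomorphic_on UNIV \<Longrightarrow> Im (F 0) = 0
    \<Longrightarrow> normp p F \<le> K * normp p (\<lambda>z. of_real (Re (F z)))"
proof -
  obtain K where K: "0 \<le> K" "\<And>F. F holomorphic_on UNIV \<Longrightarrow> Im (F 0) = 0 \<Longrightarrow> (\<And>z. norm z = 1 \<Longrightarrow> 0 < Re (F z))
    \<Longrightarrow> normp p F \<le> K * normp p (\<lambda>z. of_real (Re (F z)))"
    using conjugate_bound_positive[OF p] by blast
  show thesis
  proof (rule that[of "2 * K"])
    fix F assume F: "F holomorphic_on UNIV" "Im (F 0) = 0"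
    have cF: "continuous_on S F" for S
      by (rule entire_continuous[OF F(1)])
    define u where "u z = Re (F z)" for z
    let ?u = "\<lambda>z. complex_of_real (u z)"
    have Lu: "Lp p ?u" unfolding u_def using p by (auto intro!: Lp_continuous continuous_intros cF)
    define N1 where "N1 = normp p (\<lambda>_. 1)"
    have key: "normp p F \<le> 2 * K * normp p ?u + 4 * K * N1 * e" if e: "0 < e" for e
    proof -
      \<comment> \<open>The shift by \<open>e\<close> absorbs the approximation error: the real part
        of the approximant stays above both 0 and \<open>u\<close>, which makes \<open>Re F1\<close>
        and \<open>Re (F1 - F)\<close> strictly positive.\<close>
      have "continuous_on (sphere 0 1) (\<lambda>z. complex_of_real (max 0 (u z) + e))"
        unfolding u_def by (intro continuous_intros cF)
      from trig_uniform_approx[OF this e] obtain \<phi> where \<phi>: "trig \<phi>"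
        "\<And>z. norm z = 1 \<Longrightarrow> norm (complex_of_real (max 0 (u z) + e) - \<phi> z) < e" by blast
      obtain N where N: "\<And>z. norm z = 1 \<Longrightarrow> \<phi> z = (\<Sum>k\<in>{- int N..int N}. fc \<phi> k * z powi k)"
        "\<And>k. k \<notin> {- int N..int N} \<Longrightarrow> fc \<phi> k = 0"
        using trig_fourier[OF \<phi>(1)] by blast
      define F1 where "F1 = acompl (fc \<phi>) N"
      define F2 where "F2 z = F1 z - F z" for z
      have h1: "F1 holomorphic_on UNIV" "Im (F1 0) = 0" by (auto simp: F1_def acompl_holomorphic acompl_0)
      have h2: "F2 holomorphic_on UNIV" "Im (F2 0) = 0"
        unfolding F2_def using h1 F by (intro holomorphic_on_diff | simp)+
      have r1: "\<bar>max 0 (u z) + e - Re (F1 z)\<bar> < e" if z: "norm z = 1" for z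
      proof -
        have "Re (F1 z) = Re (\<phi> z)" unfolding F1_def Re_acompl[OF z] N(1)[OF z] ..
        then show ?thesis using \<phi>(2)[OF z] abs_Re_le_cmod[of "complex_of_real (max 0 (u z) + e) - \<phi> z"] by simp
      qed
      have pos1: "0 < Re (F1 z)" and pos2: "0 < Re (F2 z)"
        and le1: "Re (F1 z) \<le> \<bar>u z\<bar> + 2 * e" and le2: "Re (F2 z) \<le> \<bar>u z\<bar> + 2 * e" if z: "norm z = 1" for z
      proof -
        have "max 0 (u z) < Re (F1 z)" "Re (F1 z) < max 0 (u z) + 2 * e" using r1[OF z] by linarith+
        moreover have "0 \<le> max 0 (u z)" "u z \<le> max 0 (u z)" "max 0 (u z) \<le> \<bar>u z\<bar>" "max 0 (u z) - u z \<le> \<bar>u z\<bar>" by linarith+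
        moreover have "Re (F2 z) = Re (F1 z) - u z" by (simp add: F2_def u_def)
        ultimately show "0 < Re (F1 z)" "0 < Re (F2 z)" "Re (F1 z) \<le> \<bar>u z\<bar> + 2 * e" "Re (F2 z) \<le> \<bar>u z\<bar> + 2 * e"
          by linarith+
      qed
      have cc: "continuous_on (sphere 0 1) F1" "continuous_on (sphere 0 1) F2"
        using h1 h2 entire_continuous by blast+
      have LF: "Lp p F1" "Lp p F2" using cc p by (auto intro: Lp_continuous)
      let ?m = "\<lambda>z. complex_of_real (\<bar>u z\<bar>) + complex_of_real (2 * e)"
      have Lau: "Lp p (\<lambda>z. complex_of_real \<bar>u z\<bar>)" unfolding u_def using p by (auto intro!: Lp_continuous continuous_intros cF)
      have Lm: "Lp p ?m" using Lau p by (intro Lp_add Lp_const) auto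
      have nm: "normp p ?m \<le> normp p ?u + 2 * e * N1"
      proof -
        have "normp p ?m \<le> normp p (\<lambda>z. complex_of_real \<bar>u z\<bar>) + normp p (\<lambda>_. complex_of_real (2 * e) * 1)"
          using normp_triangle[OF Lau Lp_const[of p "complex_of_real (2 * e)"]] p by simp
        moreover have "normp p (\<lambda>z. complex_of_real \<bar>u z\<bar>) = normp p ?u" by (simp add: normp_cm)
        moreover have "normp p (\<lambda>_. complex_of_real (2 * e) * 1) = 2 * e * N1"
          using normp_cmult[OF Lp_const[of p 1], of "complex_of_real (2 * e)"] e p unfolding N1_def by (simp add: norm_mult)
        ultimately show ?thesis by simp
      qed
      have n1: "normp p (\<lambda>z. of_real (Re (F1 z))) \<le> normp p ?m"
      proof (rule normp_mono(2)[OF _ Lm])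
        show "meas (\<lambda>z. complex_of_real (Re (F1 z)))" using cc by (intro meas_continuous continuous_intros)
        show "AE \<theta> in cm. norm (complex_of_real (Re (F1 (cis \<theta>)))) \<le> norm (?m (cis \<theta>))"
        proof (rule AE_I2)
          fix \<theta>
          have "norm (complex_of_real (Re (F1 (cis \<theta>)))) = Re (F1 (cis \<theta>))" using pos1[of "cis \<theta>"] by simp
          also have "\<dots> \<le> \<bar>u (cis \<theta>)\<bar> + 2 * e" by (rule le1[OF norm_cis])
          also have "\<dots> \<le> norm (complex_of_real (\<bar>u (cis \<theta>)\<bar> + 2 * e))" unfolding norm_of_real by (rule abs_ge_self)
          finally show "norm (complex_of_real (Re (F1 (cis \<theta>)))) \<le> norm (?m (cis \<theta>))" by (simp only: of_real_add)
        qed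
      qed (use p in auto)
      have n2: "normp p (\<lambda>z. of_real (Re (F2 z))) \<le> normp p ?m"
      proof (rule normp_mono(2)[OF _ Lm])
        show "meas (\<lambda>z. complex_of_real (Re (F2 z)))" using cc by (intro meas_continuous continuous_intros)
        show "AE \<theta> in cm. norm (complex_of_real (Re (F2 (cis \<theta>)))) \<le> norm (?m (cis \<theta>))"
        proof (rule AE_I2)
          fix \<theta>
          have "norm (complex_of_real (Re (F2 (cis \<theta>)))) = Re (F2 (cis \<theta>))" using pos2[of "cis \<theta>"] by simp
          also have "\<dots> \<le> \<bar>u (cis \<theta>)\<bar> + 2 * e" by (rule le2[OF norm_cis])
          also have "\<dots> \<le> norm (complex_of_real (\<bar>u (cis \<theta>)\<bar> + 2 * e))" unfolding norm_of_real by (rule abs_ge_self)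
          finally show "norm (complex_of_real (Re (F2 (cis \<theta>)))) \<le> norm (?m (cis \<theta>))" by (simp only: of_real_add)
        qed
      qed (use p in auto)
      have "F = (\<lambda>z. F1 z - F2 z)" by (simp add: F2_def)
      then have "normp p F \<le> normp p F1 + normp p F2" using normp_triangle_diff[OF LF] p by simp
      also have "\<dots> \<le> K * normp p (\<lambda>z. of_real (Re (F1 z))) + K * normp p (\<lambda>z. of_real (Re (F2 z)))"
        using K(2)[OF h1 pos1] K(2)[OF h2 pos2] by (rule add_mono)
      also have "\<dots> \<le> K * (normp p ?u + 2 * e * N1) + K * (normp p ?u + 2 * e * N1)"
        using n1 n2 nm K(1) by (intro add_mono mult_left_mono) auto
      finally show ?thesis by (simp add: algebra_simps)
    qed
    have lim: "((\<lambda>e. 2 * K * normp p ?u + 4 * K * N1 * e) \<longlongrightarrow> 2 * K * normp p ?u + 4 * K * N1 * 0) (at_right 0)"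
      by (intro tendsto_intros)
    have "\<forall>\<^sub>F e in at_right 0. normp p F \<le> 2 * K * normp p ?u + 4 * K * N1 * e"
      unfolding eventually_at_right_field using key by (intro exI[of _ 1]) auto
    from tendsto_lowerbound[OF lim this] show "normp p F \<le> 2 * K * normp p (\<lambda>z. of_real (Re (F z)))"
      by (simp add: u_def)
  qed (use K in simp)
qed

section \<open>Bounded projection of trigonometric polynomials\<close>

definition trigproj :: "cfun \<Rightarrow> cfun \<Rightarrow> bool" where
  "trigproj \<phi> g \<longleftrightarrow> trig \<phi> \<and> trig g \<and> (\<forall>n. fc g n = (if 0 \<le> n then fc \<phi> n else 0))"

lemma trigproj_exists:
  assumes "trig \<phi>" obtains g N where "trigproj \<phi> g"
    "g = (\<lambda>z. \<Sum>k\<le>N. fc \<phi> (int k) * z ^ k)" "\<And>k. k \<notin> {- int N..int N} \<Longrightarrow> fc \<phi> k = 0"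
    "\<And>z. norm z = 1 \<Longrightarrow> \<phi> z = (\<Sum>k\<in>{- int N..int N}. fc \<phi> k * z powi k)"
proof -
  obtain N where N: "\<And>z. norm z = 1 \<Longrightarrow> \<phi> z = (\<Sum>k\<in>{- int N..int N}. fc \<phi> k * z powi k)"
    "\<And>k. k \<notin> {- int N..int N} \<Longrightarrow> fc \<phi> k = 0"
    using trig_fourier[OF assms] by blast
  define g where "g = (\<lambda>z::complex. \<Sum>k\<le>N. fc \<phi> (int k) * z ^ k)"
  have t: "trig g" unfolding g_def using trig_monom[of _ "int _"] by (intro trig_sum) auto
  have "fc g n = (if 0 \<le> n then fc \<phi> n else 0)" for n
  proof -
    have "fc g n = (\<Sum>k\<le>N. fc (\<lambda>z. fc \<phi> (int k) * z powi int k) n)"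
      unfolding g_def power_int_of_nat[symmetric] by (rule fc_sum) (auto intro!: trig_Lp trig_monom simp del: power_int_of_nat)
    also have "\<dots> = (\<Sum>k\<le>N. if n = int k then fc \<phi> n else 0)"
      by (intro sum.cong refl) (simp add: fc_cmult fc_powi del: power_int_of_nat)
    also have "\<dots> = (if 0 \<le> n then fc \<phi> n else 0)"
    proof (cases "0 \<le> n \<and> n \<le> int N")
      case True
      then have "(\<Sum>k\<le>N. if n = int k then fc \<phi> n else 0) = (\<Sum>k\<le>N. if k = nat n then fc \<phi> n else 0)"
        by (intro sum.cong) auto
      then show ?thesis using True by (simp add: nat_le_iff)
    next
      case False
      then have "(\<Sum>k\<le>N. if n = int k then fc \<phi> n else 0) = 0" by (intro sum.neutral) auto
      moreover have "0 \<le> n \<Longrightarrow> fc \<phi> n = 0" using False N(2)[of n] by auto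
      ultimately show ?thesis by simp
    qed
    finally show ?thesis .
  qed
  then show thesis using that[OF _ g_def N(2) N(1)] t assms by (auto simp: trigproj_def)
qed

text \<open>Twice the projection of \<open>\<phi>\<close> is
  \<open>F1 + \<i> * F2 + fc \<phi> 0\<close>, where \<open>F1\<close> and \<open>F2\<close>
  complete the real and the imaginary part of \<open>\<phi>\<close> analytically. The conjugate
  bound controls both, and the constant is a single Fourier coefficient.\<close>

lemma trigproj_bounded_le2:
  assumes p: "1 < p" "p \<le> 2"
  obtains C where "0 \<le> C" "\<And>\<phi> g. trigproj \<phi> g \<Longrightarrow> normp p g \<le> C * normp p \<phi>"
proof -
  obtain K where K: "0 \<le> K" "\<And>F. F holomorphic_on UNIV \<Longrightarrow> Im (F 0) = 0
    \<Longrightarrow> normp p F \<le> K * normp p (\<lambda>z. of_real (Re (F z)))"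
    using conjugate_bound[OF p] by blast
  define N1 where "N1 = normp p (\<lambda>_. 1)"
  show thesis
  proof (rule that[of "(2 * K + N1) / 2"])
    fix \<phi> g assume pr: "trigproj \<phi> g"
    then have \<phi>: "trig \<phi>" and g: "trig g" by (auto simp: trigproj_def)
    obtain G N where G: "trigproj \<phi> G" "G = (\<lambda>z. \<Sum>k\<le>N. fc \<phi> (int k) * z ^ k)"
      and "\<And>k. k \<notin> {- int N..int N} \<Longrightarrow> fc \<phi> k = 0"
      and N: "\<And>z. norm z = 1 \<Longrightarrow> \<phi> z = (\<Sum>k\<in>{- int N..int N}. fc \<phi> k * z powi k)"
      using trigproj_exists[OF \<phi>] by blast
    have tG: "trig G" using G(1) by (simp add: trigproj_def)
    have "aeq g G" using pr G(1) by (intro fourier_unique trig_Lp) (auto simp: trigproj_def)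
    then have gG: "normp p g = normp p G" using g tG by (intro normp_cong trig_meas)
    have L\<phi>: "Lp p \<phi>" using \<phi> p by (intro trig_Lp) auto
    define F1 where "F1 = acompl (fc \<phi>) N"
    define F2 where "F2 = acompl (\<lambda>k. - \<i> * fc \<phi> k) N"
    have h: "F1 holomorphic_on UNIV" "Im (F1 0) = 0" "F2 holomorphic_on UNIV" "Im (F2 0) = 0"
      by (auto simp: F1_def F2_def acompl_holomorphic acompl_0)
    have c: "continuous_on (sphere 0 1) F1" "continuous_on (sphere 0 1) F2"
      using h entire_continuous by blast+
    have LF: "Lp p F1" "Lp p F2" using c p by (auto intro: Lp_continuous)
    have re1: "Re (F1 z) = Re (\<phi> z)" if "norm z = 1" for z
      unfolding F1_def Re_acompl[OF that] N[OF that] ..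
    have re2: "Re (F2 z) = Im (\<phi> z)" if "norm z = 1" for z
    proof -
      have "Re (F2 z) = Re (- \<i> * (\<Sum>k\<in>{- int N..int N}. fc \<phi> k * z powi k))"
        unfolding F2_def Re_acompl[OF that] by (simp add: sum_distrib_left mult_ac)
      also have "\<dots> = Im (\<phi> z)" unfolding N[OF that, symmetric] by simp
      finally show ?thesis .
    qed
    have n1: "normp p F1 \<le> K * normp p \<phi>"
    proof -
      have "normp p (\<lambda>z. of_real (Re (F1 z))) \<le> normp p \<phi>"
        using p by (intro normp_mono(2)[OF _ L\<phi>] meas_continuous continuous_intros c) (auto simp: re1 abs_Re_le_cmod)
      then show ?thesis by (rule order_trans[OF K(2)[OF h(1,2)] mult_left_mono[OF _ K(1)]])
    qed
    have n2: "normp p F2 \<le> K * normp p \<phi>"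
    proof -
      have "normp p (\<lambda>z. of_real (Re (F2 z))) \<le> normp p \<phi>"
        using p by (intro normp_mono(2)[OF _ L\<phi>] meas_continuous continuous_intros c) (auto simp: re2 abs_Im_le_cmod)
      then show ?thesis by (rule order_trans[OF K(2)[OF h(3,4)] mult_left_mono[OF _ K(1)]])
    qed
    have G2: "2 * G z = (F1 z + \<i> * F2 z) + fc \<phi> 0" for z
    proof -
      have "G z = fc \<phi> 0 + (\<Sum>k=1..N. fc \<phi> (int k) * z ^ k)"
        unfolding G(2) by (subst sum.atMost_shift) (simp add: sum.atLeast1_atMost_eq lessThan_Suc_atMost)
      then show ?thesis unfolding F1_def F2_def acompl_combine by simp
    qed
    have "2 * normp p G = normp p (\<lambda>z. 2 * G z)" using normp_cmult[of p G 2] tG p trig_Lp[of G p] by simp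
    also have "\<dots> = normp p (\<lambda>z. (F1 z + \<i> * F2 z) + fc \<phi> 0)" by (simp only: G2)
    also have "\<dots> \<le> normp p (\<lambda>z. F1 z + \<i> * F2 z) + normp p (\<lambda>_. fc \<phi> 0)"
      using LF p by (intro normp_triangle Lp_add Lp_cmult Lp_const) auto
    also have "normp p (\<lambda>z. F1 z + \<i> * F2 z) \<le> normp p F1 + normp p (\<lambda>z. \<i> * F2 z)"
      using LF p by (intro normp_triangle Lp_cmult) auto
    also have "normp p (\<lambda>z. \<i> * F2 z) = normp p F2" using normp_cmult[OF LF(2), of \<i>] p by simp
    also have "normp p (\<lambda>_. fc \<phi> 0) = norm (fc \<phi> 0) * N1"
      using normp_cmult[OF Lp_const[of p 1], of "fc \<phi> 0"] p by (simp add: N1_def)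
    also have "normp p F1 + normp p F2 + norm (fc \<phi> 0) * N1 \<le> K * normp p \<phi> + K * normp p \<phi> + normp p \<phi> * N1"
      using n1 n2 norm_fc_le[OF L\<phi> p(1), of 0] by (intro add_mono mult_right_mono) (auto simp: N1_def)
    finally have "2 * normp p G \<le> K * normp p \<phi> + K * normp p \<phi> + normp p \<phi> * N1" by simp
    then show "normp p g \<le> (2 * K + N1) / 2 * normp p \<phi>" unfolding gG by (simp add: algebra_simps)
  qed (use K in \<open>auto simp: N1_def\<close>)
qed

text \<open>Only opposite indices pair. Any window outside which the coefficients of
  \<open>\<phi>\<close> vanish may be used, so that the pairings before and after moving the
  projection can share one window.\<close>

lemma trig_pairing:
  assumes "trig \<phi>" "trig \<psi>" and N: "\<And>k. k \<notin> {- int N..int N} \<Longrightarrow> fc \<phi> k = 0"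
  shows "(\<integral>\<theta>. \<phi> (cis \<theta>) * \<psi> (cis \<theta>) \<partial>cm) = 2 * pi * (\<Sum>k\<in>{- int N..int N}. fc \<phi> k * fc \<psi> (- k))"
proof -
  obtain M where M: "\<And>z. norm z = 1 \<Longrightarrow> \<phi> z = (\<Sum>k\<in>{- int M..int M}. fc \<phi> k * z powi k)"
    "\<And>k. k \<notin> {- int M..int M} \<Longrightarrow> fc \<phi> k = 0"
    using trig_fourier[OF assms(1)] by blast
  have eq: "(\<Sum>k\<in>{- int M..int M}. fc \<phi> k * z powi k) = (\<Sum>k\<in>{- int N..int N}. fc \<phi> k * z powi k)" for z
  proof -
    have "(\<Sum>k\<in>{- int M..int M}. fc \<phi> k * z powi k) = (\<Sum>k\<in>{- int M..int M} \<union> {- int N..int N}. fc \<phi> k * z powi k)"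
      using M(2) by (intro sum.mono_neutral_left) auto
    also have "\<dots> = (\<Sum>k\<in>{- int N..int N}. fc \<phi> k * z powi k)"
      using N by (intro sum.mono_neutral_right) auto
    finally show ?thesis .
  qed
  have L: "Lp 1 \<psi>" using assms by (intro trig_Lp) auto
  have int: "integrable cm (\<lambda>\<theta>. \<psi> (cis \<theta>) * cis (- (real_of_int (- k) * \<theta>)))" for k
    by (rule Lp1_cis_integrable[OF L])
  have "(\<integral>\<theta>. \<phi> (cis \<theta>) * \<psi> (cis \<theta>) \<partial>cm) = (\<integral>\<theta>. (\<Sum>k\<in>{- int N..int N}. fc \<phi> k * (\<psi> (cis \<theta>) * cis (- (real_of_int (- k) * \<theta>)))) \<partial>cm)"
    using M(1) by (simp add: eq cis_powi sum_distrib_left sum_distrib_right mult_ac)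
  also have "\<dots> = (\<Sum>k\<in>{- int N..int N}. fc \<phi> k * (\<integral>\<theta>. \<psi> (cis \<theta>) * cis (- (real_of_int (- k) * \<theta>)) \<partial>cm))"
    by (subst Bochner_Integration.integral_sum) (auto intro!: integrable_mult_right int simp del: of_int_minus)
  also have "\<dots> = (\<Sum>k\<in>{- int N..int N}. fc \<phi> k * (2 * pi * fc \<psi> (- k)))"
    by (intro sum.cong refl) (simp add: fc_cm)
  finally show ?thesis by (simp add: sum_distrib_left mult_ac)
qed

lemma trig_tld: assumes "trig f" shows "trig (tld f)"
proof -
  obtain A c where A: "finite A" "\<And>z. norm z = 1 \<Longrightarrow> f z = (\<Sum>k\<in>A. c k * z powi k)"
    using assms(1) by (auto simp: trig_def)
  have "trig (\<lambda>z. \<Sum>k\<in>A. c k * z powi (- k))" using A(1) by (intro trig_sum trig_monom)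
  then show ?thesis
    by (rule trig_cong) (simp add: tld_def A(2) norm_inverse power_int_minus power_int_inverse)
qed

text \<open>Duality: pair \<open>P \<phi>\<close> with polynomials approximating \<open>\<bar>P \<phi>\<bar>\<^bsup>p - 2\<^esup> cnj (P \<phi>)\<close> and move the
  projection to the other factor, where the bound for the conjugate exponent applies.\<close>
lemma trigproj_bounded_ge2:
  assumes p: "2 < p"
  obtains C where "0 \<le> C" "\<And>\<phi> g. trigproj \<phi> g \<Longrightarrow> normp p g \<le> C * normp p \<phi>"
proof -
  define q where "q = p / (p - 1)"
  have q: "1 < q" "q \<le> 2" "1/p + 1/q = 1" "(p - 1) * q = p" using p by (auto simp: q_def field_simps)
  obtain C where C: "0 \<le> C" "\<And>\<phi> g. trigproj \<phi> g \<Longrightarrow> normp q g \<le> C * normp q \<phi>"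
    using trigproj_bounded_le2[OF q(1,2)] by blast
  define N1 where "N1 = normp q (\<lambda>_. 1)"
  show thesis
  proof (rule that[OF C(1)])
    fix \<phi> g assume pr: "trigproj \<phi> g"
    then have \<phi>: "trig \<phi>" and g: "trig g" and fg: "\<And>n. fc g n = (if 0 \<le> n then fc \<phi> n else 0)"
      by (auto simp: trigproj_def)
    obtain N where N: "\<And>z. norm z = 1 \<Longrightarrow> \<phi> z = (\<Sum>k\<in>{- int N..int N}. fc \<phi> k * z powi k)"
      "\<And>k. k \<notin> {- int N..int N} \<Longrightarrow> fc \<phi> k = 0"
      using trig_fourier[OF \<phi>] by blast
    have L\<phi>: "Lp p \<phi>" using \<phi> p by (intro trig_Lp) auto
    have Lg: "Lp p g" "Lp 1 g" using g p by (auto intro: trig_Lp)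
    define X where "X = (\<integral>\<theta>. norm (g (cis \<theta>)) powr p \<partial>cm)"
    have X0: "0 \<le> X" unfolding X_def by (rule integral_powr_nonneg)
    define h where "h z = cnj (g z) * of_real (norm (g z) powr (p - 2))" for z
    have hc: "continuous_on (sphere 0 1) h"
      unfolding h_def using p by (intro continuous_intros trig_continuous[OF g] continuous_on_powr') auto
    have nh: "norm (h z) = norm (g z) powr (p - 1)" for z
    proof (cases "g z = 0")
      case False
      then have "norm (g z) powr 1 * norm (g z) powr (p - 2) = norm (g z) powr (p - 1)"
        by (subst powr_add[symmetric]) simp
      then show ?thesis using False by (simp add: h_def norm_mult)
    qed (simp add: h_def)
    have gh: "g z * h z = of_real (norm (g z) powr p)" for z
    proof (cases "g z = 0")
      case False
      have "g z * h z = of_real ((norm (g z))\<^sup>2) * of_real (norm (g z) powr (p - 2))"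
        unfolding h_def complex_norm_square by simp
      also have "\<dots> = of_real (norm (g z) powr 2 * norm (g z) powr (p - 2))" by simp
      also have "norm (g z) powr 2 * norm (g z) powr (p - 2) = norm (g z) powr p"
        by (subst powr_add[symmetric]) simp
      finally show ?thesis .
    qed (use p in simp)
    have Lh: "Lp q h" using hc q by (intro Lp_continuous) auto
    have normh: "normp q h = X powr (1/q)"
      unfolding normp_cm X_def nh powr_powr q(4) ..
    have est: "X \<le> C * normp p \<phi> * (normp q h + e * N1) + e * (\<integral>\<theta>. norm (g (cis \<theta>)) \<partial>cm)" if e: "0 < e" for e
    proof -
      obtain \<psi> where \<psi>: "trig \<psi>" "\<And>z. norm z = 1 \<Longrightarrow> norm (h z - \<psi> z) < e"
        using trig_uniform_approx[OF hc e] by blast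
      \<comment> \<open>The transposed projection keeps the indices \<open>n \<le> 0\<close>. It is
        the given one conjugated by the reflection, which preserves the norm.\<close>
      obtain g2 where g2: "trigproj (tld \<psi>) g2" by (rule trigproj_exists[OF trig_tld[OF \<psi>(1)]]) (rule that)
      have tg2: "trig g2" and fg2: "\<And>n. fc g2 n = (if 0 \<le> n then fc (tld \<psi>) n else 0)"
        using g2 by (auto simp: trigproj_def)
      define g' where "g' = tld g2"
      have tg': "trig g'" unfolding g'_def by (rule trig_tld[OF tg2])
      have fg': "fc g' n = (if n \<le> 0 then fc \<psi> n else 0)" for n
        unfolding g'_def using fc_tld[OF trig_meas[OF tg2]] fc_tld[OF trig_meas[OF \<psi>(1)]] by (simp add: fg2)
      have L\<psi>: "Lp q \<psi>" "Lp 1 \<psi>" and Lg': "Lp q g'" using \<psi>(1) tg' q by (auto intro: trig_Lp)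
      have ng': "normp q g' \<le> C * normp q \<psi>"
        using C(2)[OF g2] normp_tld[OF trig_meas[OF tg2]] normp_tld[OF trig_meas[OF \<psi>(1)]] by (simp add: g'_def)
      have "(\<integral>\<theta>. g (cis \<theta>) * \<psi> (cis \<theta>) \<partial>cm) = 2 * pi * (\<Sum>k\<in>{- int N..int N}. fc g k * fc \<psi> (- k))"
        using N(2) by (intro trig_pairing g \<psi>) (auto simp: fg)
      also have "\<dots> = 2 * pi * (\<Sum>k\<in>{- int N..int N}. fc \<phi> k * fc g' (- k))"
      proof -
        have "fc g k * fc \<psi> (- k) = fc \<phi> k * fc g' (- k)" for k by (simp add: fg fg')
        then show ?thesis by simp
      qed
      also have "\<dots> = (\<integral>\<theta>. \<phi> (cis \<theta>) * g' (cis \<theta>) \<partial>cm)"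
        by (rule trig_pairing[OF \<phi> tg' N(2), symmetric])
      finally have "norm (\<integral>\<theta>. g (cis \<theta>) * \<psi> (cis \<theta>) \<partial>cm) \<le> (\<integral>\<theta>. norm (\<phi> (cis \<theta>) * g' (cis \<theta>)) \<partial>cm)"
        using integral_norm_bound[of cm "\<lambda>\<theta>. \<phi> (cis \<theta>) * g' (cis \<theta>)"] by simp
      also have "\<dots> \<le> normp p \<phi> * normp q g'" using p by (intro holder_bound[OF L\<phi> Lg' _ q(3)]) auto
      also have "\<dots> \<le> normp p \<phi> * (C * normp q \<psi>)" using ng' by (intro mult_left_mono) auto
      also have "\<dots> \<le> normp p \<phi> * (C * (normp q h + e * N1))"
      proof (intro mult_left_mono)
        have Ld: "Lp q (\<lambda>z. h z - \<psi> z)" using Lh L\<psi> q by (intro Lp_diff) auto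
        have "normp q (\<lambda>z. h z - \<psi> z) \<le> normp q (\<lambda>_. of_real e * 1)"
          using q e \<psi>(2) Ld by (intro normp_mono(2) Lp_const Lp_cmult) (auto intro!: AE_I2 less_imp_le dest: Lp_meas)
        also have "\<dots> = e * N1" using normp_cmult[OF Lp_const[of q 1], of "of_real e"] q e by (simp add: N1_def)
        finally show "normp q \<psi> \<le> normp q h + e * N1" using normp_triangle_diff[OF Lh Ld] q by simp
      qed (use C(1) in auto)
      finally have 1: "norm (\<integral>\<theta>. g (cis \<theta>) * \<psi> (cis \<theta>) \<partial>cm) \<le> C * normp p \<phi> * (normp q h + e * N1)"
        by (simp only: mult_ac)
      have i1: "integrable cm (\<lambda>\<theta>. g (cis \<theta>) * \<psi> (cis \<theta>))"
        using trig_Lp[OF trig_mult[OF g \<psi>(1)], of 1] by (auto simp: Lp1_iff)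
      have i2: "integrable cm (\<lambda>\<theta>. g (cis \<theta>) * h (cis \<theta>))"
        using trig_continuous[OF g] hc by (intro integrable_cm_continuous continuous_intros)
      have "of_real X = (\<integral>\<theta>. g (cis \<theta>) * h (cis \<theta>) \<partial>cm)" unfolding gh X_def by simp
      also have "\<dots> = (\<integral>\<theta>. g (cis \<theta>) * \<psi> (cis \<theta>) \<partial>cm) + (\<integral>\<theta>. g (cis \<theta>) * (h (cis \<theta>) - \<psi> (cis \<theta>)) \<partial>cm)"
        using i1 i2 by (simp add: right_diff_distrib)
      finally have "X \<le> norm (\<integral>\<theta>. g (cis \<theta>) * \<psi> (cis \<theta>) \<partial>cm) + norm (\<integral>\<theta>. g (cis \<theta>) * (h (cis \<theta>) - \<psi> (cis \<theta>)) \<partial>cm)"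
        using norm_triangle_ineq X0 by (metis norm_of_real abs_of_nonneg)
      moreover have "norm (\<integral>\<theta>. g (cis \<theta>) * (h (cis \<theta>) - \<psi> (cis \<theta>)) \<partial>cm) \<le> e * (\<integral>\<theta>. norm (g (cis \<theta>)) \<partial>cm)"
      proof -
        have "norm (\<integral>\<theta>. g (cis \<theta>) * (h (cis \<theta>) - \<psi> (cis \<theta>)) \<partial>cm) \<le> (\<integral>\<theta>. norm (g (cis \<theta>) * (h (cis \<theta>) - \<psi> (cis \<theta>))) \<partial>cm)"
          by (rule integral_norm_bound)
        also have "\<dots> \<le> (\<integral>\<theta>. e * norm (g (cis \<theta>)) \<partial>cm)"
        proof (rule integral_mono)
          show "integrable cm (\<lambda>\<theta>. norm (g (cis \<theta>) * (h (cis \<theta>) - \<psi> (cis \<theta>))))"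
            using i1 i2 by (simp add: right_diff_distrib)
          show "integrable cm (\<lambda>\<theta>. e * norm (g (cis \<theta>)))" using Lg by (auto simp: Lp1_iff)
          show "norm (g (cis \<theta>) * (h (cis \<theta>) - \<psi> (cis \<theta>))) \<le> e * norm (g (cis \<theta>))" for \<theta>
            using mult_right_mono[OF less_imp_le[OF \<psi>(2)[of "cis \<theta>"]], of "norm (g (cis \<theta>))"]
            by (simp add: norm_mult mult.commute)
        qed
        finally show ?thesis by simp
      qed
      ultimately show ?thesis using 1 by linarith
    qed
    let ?I = "\<integral>\<theta>. norm (g (cis \<theta>)) \<partial>cm"
    have lim: "((\<lambda>e. C * normp p \<phi> * (normp q h + e * N1) + e * ?I) \<longlongrightarrow> C * normp p \<phi> * (normp q h + 0 * N1) + 0 * ?I) (at_right 0)"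
      by (intro tendsto_intros)
    have "\<forall>\<^sub>F e in at_right 0. X \<le> C * normp p \<phi> * (normp q h + e * N1) + e * ?I"
      unfolding eventually_at_right_field using est by (intro exI[of _ 1]) auto
    from tendsto_lowerbound[OF lim this] have fin: "X \<le> C * normp p \<phi> * X powr (1/q)"
      by (simp add: normh)
    show "normp p g \<le> C * normp p \<phi>"
    proof (cases "X = 0")
      case True
      then have "normp p g = 0" unfolding normp_cm X_def by simp
      then show ?thesis using C(1) by simp
    next
      case False
      then have Xp: "0 < X" using X0 by simp
      \<comment> \<open>\<open>X\<close> is the p-th power of the norm of \<open>g\<close>; dividing
        it by \<open>X powr (1/q)\<close>, the norm of \<open>h\<close>, leaves the norm
        itself.\<close>
      have pq: "1/p = 1 - 1/q" using q(3) by linarith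
      have "X powr (1/p) = X / X powr (1/q)" unfolding pq powr_diff using Xp by simp
      also have "\<dots> \<le> C * normp p \<phi>" using fin Xp by (simp add: pos_divide_le_eq)
      finally show ?thesis unfolding normp_cm X_def .
    qed
  qed
qed

lemma trigproj_bounded:
  assumes p: "1 < p"
  obtains C where "0 \<le> C" "\<And>\<phi> g. trigproj \<phi> g \<Longrightarrow> normp p g \<le> C * normp p \<phi>"
proof (cases "p \<le> 2")
  case True then show ?thesis using trigproj_bounded_le2[OF p] that by blast
next
  case False then show ?thesis using trigproj_bounded_ge2[of p] that by auto
qed

section \<open>Extension of the projection to all of L^p\<close>

lemma fc_tendsto:
  assumes "1 < p" "\<And>k. Lp p (f k)" "Lp p g" "(\<lambda>k. normp p (\<lambda>z. g z - f k z)) \<longlonglongrightarrow> 0"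
  shows "(\<lambda>k. fc (f k) n) \<longlonglongrightarrow> fc g n"
proof -
  have "(\<lambda>k. fc g n - fc (f k) n) \<longlonglongrightarrow> 0"
  proof (rule Lim_null_comparison[OF _ assms(4)])
    show "\<forall>\<^sub>F k in sequentially. norm (fc g n - fc (f k) n) \<le> normp p (\<lambda>z. g z - f k z)"
    proof (rule always_eventually, rule allI)
      fix k
      have "fc g n - fc (f k) n = fc (\<lambda>z. g z - f k z) n"
        using assms by (intro fc_diff[symmetric] Lp_imp_Lp1[of p]) auto
      also have "norm \<dots> \<le> normp p (\<lambda>z. g z - f k z)" using assms by (intro norm_fc_le Lp_diff) auto
      finally show "norm (fc g n - fc (f k) n) \<le> normp p (\<lambda>z. g z - f k z)" .
    qed
  qed
  from tendsto_diff[OF tendsto_const[of "fc g n"] this] show ?thesis by simp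
qed

text \<open>Polynomials approach \<open>f\<close> at a geometric rate; by the uniform bound so do
  their projections, and since Fourier coefficients are continuous in norm, the limit has the
  required ones.\<close>

theorem riesz_projection:
  assumes p: "1 < p"
  obtains C where "0 \<le> C" "\<And>f. Lp p f \<Longrightarrow>
    \<exists>g. Lp p g \<and> (\<forall>n. fc g n = (if 0 \<le> n then fc f n else 0)) \<and> normp p g \<le> C * normp p f"
proof -
  obtain C where C: "0 \<le> C" "\<And>\<phi> g. trigproj \<phi> g \<Longrightarrow> normp p g \<le> C * normp p \<phi>"
    using trigproj_bounded[OF p] by blast
  show thesis
  proof (rule that[OF C(1)])
    fix f assume f: "Lp p f"
    define r :: "nat \<Rightarrow> real" where "r k = (1/2)^k" for k
    have r_pos: "0 < r k" and r_Suc: "r (Suc k) = r k / 2" for k by (auto simp: r_def)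
    have "\<exists>\<psi>. trig \<psi> \<and> normp p (\<lambda>z. f z - \<psi> z) < r k" for k
      using trig_dense[OF f p, of "r k"] by (auto simp: r_def)
    then obtain \<psi> where \<psi>: "\<And>k. trig (\<psi> k)" "\<And>k. normp p (\<lambda>z. f z - \<psi> k z) < r k" by metis
    have L\<psi>: "Lp p (\<psi> k)" for k using \<psi>(1) p by (intro trig_Lp) auto
    have "\<exists>g. trigproj (\<psi> k) g" for k by (rule trigproj_exists[OF \<psi>(1)]) (rule exI)
    then obtain G where G: "\<And>k. trigproj (\<psi> k) (G k)" by metis
    have tG: "trig (G k)" and fG: "fc (G k) n = (if 0 \<le> n then fc (\<psi> k) n else 0)" for k n
      using G by (auto simp: trigproj_def)
    have LG: "Lp p (G k)" for k using tG p by (intro trig_Lp) auto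
    have L1: "Lp 1 (\<psi> k)" "Lp 1 (G k)" for k using \<psi>(1) tG by (auto intro: trig_Lp)
    have rsum: "summable (\<lambda>k. C * (2 * r k))" unfolding r_def by (intro summable_mult summable_geometric) simp
    have d: "normp p (\<lambda>z. G (Suc k) z - G k z) \<le> C * (2 * r k)" for k
    proof -
      have "trigproj (\<lambda>z. \<psi> (Suc k) z - \<psi> k z) (\<lambda>z. G (Suc k) z - G k z)"
        unfolding trigproj_def using \<psi>(1) tG L1 by (auto intro: trig_diff simp: fc_diff fG)
      then have "normp p (\<lambda>z. G (Suc k) z - G k z) \<le> C * normp p (\<lambda>z. \<psi> (Suc k) z - \<psi> k z)" by (rule C(2))
      also have "normp p (\<lambda>z. \<psi> (Suc k) z - \<psi> k z) = normp p (\<lambda>z. (f z - \<psi> k z) - (f z - \<psi> (Suc k) z))" by simp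
      also have "\<dots> \<le> normp p (\<lambda>z. f z - \<psi> k z) + normp p (\<lambda>z. f z - \<psi> (Suc k) z)"
        using f L\<psi> p by (intro normp_triangle_diff Lp_diff) auto
      also have "\<dots> \<le> 2 * r k" using \<psi>(2)[of k] \<psi>(2)[of "Suc k"] r_pos[of k] by (simp add: r_Suc)
      finally show ?thesis using C(1) by (simp add: mult_left_mono)
    qed
    \<comment> \<open>The limit of \<open>G k\<close> is obtained as \<open>G 0\<close> plus the sum
      of the successive differences, a series to which completeness applies.\<close>
    have "\<And>j. Lp p (\<lambda>z. G (Suc j) z - G j z)" using LG p by (intro Lp_diff) auto
    from Lp_series[OF p this d rsum] obtain g0 where g0: "Lp p g0"
      "\<And>k. normp p (\<lambda>z. g0 z - (\<Sum>j<k. G (Suc j) z - G j z)) \<le> (\<Sum>j. C * (2 * r (j + k)))" by blast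
    define g where "g z = g0 z + G 0 z" for z
    have Lg: "Lp p g" unfolding g_def using g0 LG p by (intro Lp_add) auto
    have "g0 z - (\<Sum>j<k. G (Suc j) z - G j z) = g z - G k z" for z k
      using sum_lessThan_telescope[of "\<lambda>j. G j z" k] by (simp add: g_def)
    then have le: "normp p (\<lambda>z. g z - G k z) \<le> (\<Sum>j. C * (2 * r (j + k)))" for k using g0(2)[of k] by simp
    have lim: "(\<lambda>k. normp p (\<lambda>z. g z - G k z)) \<longlonglongrightarrow> 0"
      by (rule tendsto_sandwich[OF _ _ tendsto_const suminf_tail_tendsto_0[OF rsum]]) (use le in auto)
    have r0: "r \<longlonglongrightarrow> 0" unfolding r_def by (intro LIMSEQ_power_zero) simp
    have lim\<psi>: "(\<lambda>k. normp p (\<lambda>z. f z - \<psi> k z)) \<longlonglongrightarrow> 0"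
      by (rule tendsto_sandwich[OF _ _ tendsto_const r0]) (use \<psi>(2) in \<open>auto intro!: always_eventually less_imp_le\<close>)
    have "fc g n = (if 0 \<le> n then fc f n else 0)" for n
    proof -
      have 1: "(\<lambda>k. fc (G k) n) \<longlonglongrightarrow> fc g n" by (rule fc_tendsto[OF p LG Lg lim])
      have 2: "(\<lambda>k. fc (\<psi> k) n) \<longlonglongrightarrow> fc f n" by (rule fc_tendsto[OF p L\<psi> f lim\<psi>])
      show ?thesis
      proof (cases "0 \<le> n")
        case True then show ?thesis using 1 2 by (simp add: fG) (metis LIMSEQ_unique)
      next
        case False then show ?thesis using 1 by (simp add: fG LIMSEQ_const_iff)
      qed
    qed
    moreover have "normp p g \<le> C * normp p f"
    proof -
      have "normp p g \<le> normp p (\<lambda>z. g z - G k z) + C * (normp p f + normp p (\<lambda>z. f z - \<psi> k z))" for k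
      proof -
        have "normp p g \<le> normp p (\<lambda>z. g z - G k z) + normp p (G k)"
          using normp_triangle[of p "\<lambda>z. g z - G k z" "G k"] Lg LG p Lp_diff[of p g "G k"] by simp
        moreover have "normp p (G k) \<le> C * normp p (\<psi> k)" by (rule C(2)[OF G])
        moreover have "normp p (\<psi> k) \<le> normp p f + normp p (\<lambda>z. f z - \<psi> k z)"
          using normp_triangle_diff[of p f "\<lambda>z. f z - \<psi> k z"] f L\<psi> p Lp_diff[of p f "\<psi> k"] by simp
        then have "C * normp p (\<psi> k) \<le> C * (normp p f + normp p (\<lambda>z. f z - \<psi> k z))" using C(1) by (rule mult_left_mono)
        ultimately show ?thesis by linarith
      qed
      moreover have "(\<lambda>k. normp p (\<lambda>z. g z - G k z) + C * (normp p f + normp p (\<lambda>z. f z - \<psi> k z))) \<longlonglongrightarrow> 0 + C * (normp p f + 0)"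
        by (intro tendsto_intros lim lim\<psi>)
      ultimately show ?thesis using LIMSEQ_le_const[of _ "0 + C * (normp p f + 0)" "normp p g"] by auto
    qed
    ultimately show "\<exists>g. Lp p g \<and> (\<forall>n. fc g n = (if 0 \<le> n then fc f n else 0)) \<and> normp p g \<le> C * normp p f"
      using Lg by blast
  qed
qed

section \<open>The Riesz projection and Hardy spaces\<close>

lemma HpD: "f \<in> Hp p \<Longrightarrow> Lp p f" "f \<in> Hp p \<Longrightarrow> n < 0 \<Longrightarrow> fc f n = 0" by (auto simp: Hp_def)
lemma HpI: "Lp p f \<Longrightarrow> (\<And>n. n < 0 \<Longrightarrow> fc f n = 0) \<Longrightarrow> f \<in> Hp p" by (auto simp: Hp_def)
lemma Hp_meas: "f \<in> Hp p \<Longrightarrow> meas f" by (auto dest: HpD Lp_meas)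

lemma Pr_cong: "fc f = fc g \<Longrightarrow> Pr f = Pr g" by (simp add: Pr_def)

lemma Pr_aeq_cong: "aeq f g \<Longrightarrow> meas f \<Longrightarrow> meas g \<Longrightarrow> Pr f = Pr g"
  by (intro Pr_cong fc_cong)

locale hardy =
  fixes p :: real
  assumes p: "1 < p"
begin

lemma Lp_Lp1: "Lp p f \<Longrightarrow> Lp 1 f" using p by (intro Lp_imp_Lp1[of p]) auto

lemma Pr_spec:
  assumes "Lp p f"
  shows "Lp 1 (Pr f)" "fc (Pr f) n = (if 0 \<le> n then fc f n else 0)"
proof -
  obtain g where "Lp p g" "\<forall>n. fc g n = (if 0 \<le> n then fc f n else 0)"
    using riesz_projection[OF p] assms by metis
  then have "\<exists>g. Lp 1 g \<and> (\<forall>n. fc g n = (if 0 \<le> n then fc f n else 0))" using Lp_Lp1 by blast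
  from someI_ex[OF this] show "Lp 1 (Pr f)" "fc (Pr f) n = (if 0 \<le> n then fc f n else 0)"
    unfolding Pr_def by auto
qed

lemma Pr_unique:
  assumes "Lp p f" "Lp 1 g" "\<And>n. 0 \<le> n \<Longrightarrow> fc g n = fc f n" "\<And>n. n < 0 \<Longrightarrow> fc g n = 0"
  shows "aeq (Pr f) g"
  using assms Pr_spec[OF assms(1)] by (intro fourier_unique) auto

text \<open>By its definition \<open>Pr f\<close> is merely some integrable function with the right
  coefficients. Uniqueness identifies it almost everywhere with the L^p function found by Riesz's
  theorem. Adding 1 to the constant makes it positive.\<close>

lemma Pr_bounded:
  obtains C where "0 < C" "\<And>f. Lp p f \<Longrightarrow> Lp p (Pr f) \<and> normp p (Pr f) \<le> C * normp p f"
proof -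
  obtain C where C: "0 \<le> C" "\<And>f. Lp p f \<Longrightarrow>
    \<exists>g. Lp p g \<and> (\<forall>n. fc g n = (if 0 \<le> n then fc f n else 0)) \<and> normp p g \<le> C * normp p f"
    using riesz_projection[OF p] by blast
  show thesis
  proof (rule that[of "C + 1"])
    fix f assume f: "Lp p f"
    then obtain g where g: "Lp p g" "\<forall>n. fc g n = (if 0 \<le> n then fc f n else 0)" "normp p g \<le> C * normp p f"
      using C(2) by blast
    have a: "aeq (Pr f) g" using f g Lp_Lp1 by (intro Pr_unique) auto
    have m: "meas (Pr f)" using Pr_spec[OF f] by (auto dest: Lp_meas)
    have "normp p (Pr f) = normp p g" using a m g by (intro normp_cong) (auto dest: Lp_meas)
    also have "\<dots> \<le> (C + 1) * normp p f" using g(3) normp_nonneg[of p f] unfolding distrib_right by linarith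
    finally show "Lp p (Pr f) \<and> normp p (Pr f) \<le> (C + 1) * normp p f"
      using Lp_cong[OF g(1) aeq_sym[OF a] m] by simp
  qed (use C in simp)
qed

lemma Pr_Hp: assumes "Lp p f" shows "Pr f \<in> Hp p"
proof -
  have "Lp p (Pr f)" using Pr_bounded assms by blast
  then show ?thesis using Pr_spec[OF assms] by (intro HpI) auto
qed

lemma Hp_Lp1: "f \<in> Hp p \<Longrightarrow> Lp 1 f" by (intro Lp_Lp1 HpD)

lemma Pr_Hp_id: "f \<in> Hp p \<Longrightarrow> aeq (Pr f) f"
  by (intro Pr_unique Hp_Lp1) (auto dest: HpD)

lemma Pr_eq_0_iff: "Lp p f \<Longrightarrow> aeq (Pr f) (\<lambda>_. 0) \<longleftrightarrow> (\<forall>n\<ge>0. fc f n = 0)"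
proof
  assume f: "Lp p f" and a: "aeq (Pr f) (\<lambda>_. 0)"
  have "fc (Pr f) = fc (\<lambda>_. 0)" using a Pr_spec[OF f] by (intro fc_cong) (auto dest: Lp_meas)
  then show "\<forall>n\<ge>0. fc f n = 0" using Pr_spec(2)[OF f] by (metis fc_zero)
qed (use Pr_unique Lp_const in auto)

lemma Pr_add: assumes "Lp p f" "Lp p g" shows "aeq (Pr (\<lambda>z. f z + g z)) (\<lambda>z. Pr f z + Pr g z)"
  using assms p by (intro Pr_unique Lp_add Pr_spec(1)) (auto simp: fc_add Pr_spec Lp_Lp1)

lemma Pr_diff: assumes "Lp p f" "Lp p g" shows "aeq (Pr (\<lambda>z. f z - g z)) (\<lambda>z. Pr f z - Pr g z)"
  using assms p by (intro Pr_unique Lp_diff Pr_spec(1)) (auto simp: fc_diff Pr_spec Lp_Lp1)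

lemma Pr_cmult: assumes "Lp p f" shows "aeq (Pr (\<lambda>z. k * f z)) (\<lambda>z. k * Pr f z)"
  using assms p by (intro Pr_unique Lp_cmult Pr_spec(1)) (auto simp: fc_cmult Pr_spec)

lemma Hp_add: "f \<in> Hp p \<Longrightarrow> g \<in> Hp p \<Longrightarrow> (\<lambda>z. f z + g z) \<in> Hp p"
  using p by (intro HpI Lp_add) (auto simp: fc_add Hp_Lp1 HpD)

lemma Hp_diff: "f \<in> Hp p \<Longrightarrow> g \<in> Hp p \<Longrightarrow> (\<lambda>z. f z - g z) \<in> Hp p"
  using p by (intro HpI Lp_diff) (auto simp: fc_diff Hp_Lp1 HpD)

lemma Hp_cmult: "f \<in> Hp p \<Longrightarrow> (\<lambda>z. k * f z) \<in> Hp p"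
  using p by (intro HpI Lp_cmult) (auto simp: fc_cmult HpD)

lemma Hp_const: "(\<lambda>_. k) \<in> Hp p"
  using p by (intro HpI Lp_const) (auto simp: fc_const)

lemma Hp_sum: "finite I \<Longrightarrow> (\<And>i. i \<in> I \<Longrightarrow> f i \<in> Hp p) \<Longrightarrow> (\<lambda>z. \<Sum>i\<in>I. f i z) \<in> Hp p"
  by (induction I rule: finite_induct) (auto intro: Hp_add Hp_const)

lemma Hp_cong: "f \<in> Hp p \<Longrightarrow> aeq f g \<Longrightarrow> meas g \<Longrightarrow> g \<in> Hp p"
  using fc_cong[of f g, OF _ Hp_meas] HpD(2)[of f p] by (intro HpI) (auto intro: Lp_cong dest: HpD(1))

lemma Hp_ident_mult: "f \<in> Hp p \<Longrightarrow> (\<lambda>z. z * f z) \<in> Hp p"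
  using p by (intro HpI Lp_mult_Linf) (auto simp: fc_ident_mult HpD)

lemma Hp_power_mult: "f \<in> Hp p \<Longrightarrow> (\<lambda>z. z ^ k * f z) \<in> Hp p"
proof (induction k)
  case (Suc k)
  from Hp_ident_mult[OF Suc.IH[OF Suc.prems]] show ?case by (simp add: mult.assoc)
qed simp

lemma Hp_power: "(\<lambda>z. z ^ k) \<in> Hp p"
  using Hp_power_mult[OF Hp_const[of 1], of k] by simp

lemma Hp_closed:
  assumes "\<And>k. f k \<in> Hp p" "Lp p g" "(\<lambda>k. normp p (\<lambda>z. g z - f k z)) \<longlonglongrightarrow> 0"
  shows "g \<in> Hp p"
proof (rule HpI)
  fix n :: int assume n: "n < 0"
  have "(\<lambda>k. fc (f k) n) \<longlonglongrightarrow> fc g n"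
    using assms p by (intro fc_tendsto[of p]) (auto dest: HpD)
  then show "fc g n = 0" using HpD(2)[OF assms(1) n] by (simp add: LIMSEQ_const_iff)
qed fact

lemma Hp_series:
  assumes f: "\<And>j. f j \<in> Hp p" and r: "\<And>j. normp p (f j) \<le> r j" "summable r"
  obtains g where "g \<in> Hp p" "\<And>k. normp p (\<lambda>z. g z - (\<Sum>j<k. f j z)) \<le> (\<Sum>j. r (j + k))"
proof -
  obtain g where g: "Lp p g" "\<And>k. normp p (\<lambda>z. g z - (\<Sum>j<k. f j z)) \<le> (\<Sum>j. r (j + k))"
    using Lp_series[OF p HpD(1)[OF f] r] by blast
  have s: "(\<lambda>z. \<Sum>j<k. f j z) \<in> Hp p" for k using f by (intro Hp_sum) auto
  have "(\<lambda>k. normp p (\<lambda>z. g z - (\<Sum>j<k. f j z))) \<longlonglongrightarrow> 0"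
    by (rule tendsto_sandwich[OF _ _ tendsto_const suminf_tail_tendsto_0[OF r(2)]]) (use g(2) in auto)
  then have "g \<in> Hp p" by (rule Hp_closed[OF s g(1)])
  then show thesis using g(2) that by blast
qed

text \<open>A trigonometric polynomial close to \<open>f\<close> need not be analytic. Its
  projection is, and because \<open>f\<close> is fixed by the projection, the error grows at most by
  the factor \<open>C\<close>.\<close>

lemma polynomials_dense_Hp:
  assumes f: "f \<in> Hp p" and e: "0 < e"
  obtains N :: nat and c where "normp p (\<lambda>z. f z - (\<Sum>k\<le>N. c k * z ^ k)) < e"
proof -
  obtain C where C: "0 < C" "\<And>f. Lp p f \<Longrightarrow> Lp p (Pr f) \<and> normp p (Pr f) \<le> C * normp p f"
    using Pr_bounded by blast
  obtain \<phi> where \<phi>: "trig \<phi>" "normp p (\<lambda>z. f z - \<phi> z) < e / C"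
    using trig_dense[OF HpD(1)[OF f] p, of "e / C"] e C(1) by auto
  obtain g N where g: "trigproj \<phi> g" "g = (\<lambda>z. \<Sum>k\<le>N. fc \<phi> (int k) * z ^ k)"
    by (rule trigproj_exists[OF \<phi>(1)]) (rule that)
  have tg: "trig g" "\<And>n. fc g n = (if 0 \<le> n then fc \<phi> n else 0)" using g(1) by (auto simp: trigproj_def)
  have L: "Lp p \<phi>" "Lp p g" using \<phi>(1) tg(1) p by (auto intro: trig_Lp)
  have Ld: "Lp p (\<lambda>z. f z - \<phi> z)" using L f p by (intro Lp_diff) (auto dest: HpD)
  have Lg: "Lp p (\<lambda>z. f z - g z)" using L f p by (intro Lp_diff) (auto dest: HpD)
  have "aeq (Pr (\<lambda>z. f z - \<phi> z)) (\<lambda>z. f z - g z)"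
    using fc_diff[OF Hp_Lp1[OF f] Lp_Lp1[OF L(1)]] fc_diff[OF Hp_Lp1[OF f] Lp_Lp1[OF L(2)]] HpD(2)[OF f] tg(2)
    by (intro Pr_unique Ld Lp_Lp1[OF Lg]) auto
  then have "normp p (\<lambda>z. f z - g z) = normp p (Pr (\<lambda>z. f z - \<phi> z))"
    using Lp_meas[OF Lg] Lp_meas[of p "Pr (\<lambda>z. f z - \<phi> z)"] C(2)[OF Ld] by (metis normp_cong)
  also have "\<dots> \<le> C * normp p (\<lambda>z. f z - \<phi> z)" using C(2)[OF Ld] by simp
  also have "\<dots> < C * (e / C)" using \<phi>(2) C(1) by (intro mult_strict_left_mono) auto
  finally show thesis using C(1) that[of "\<lambda>k. fc \<phi> (int k)" N] by (simp add: g(2))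
qed

text \<open>For a polynomial in place of \<open>f\<close> both claims are finite computations;
  density and Hoelder's inequality carry them over. Products of factors are thus handled through
  coefficients, without extension into the disk.\<close>

lemma fc_Hp_mult:
  assumes f: "f \<in> Hp p" and g: "g \<in> Hp q" and pq: "1/p + 1/q = 1"
  shows "n < 0 \<Longrightarrow> fc (\<lambda>z. f z * g z) n = 0" "fc (\<lambda>z. f z * g z) 0 = fc f 0 * fc g 0"
proof -
  have L: "Lp p f" "Lp q g" using f g by (auto dest: HpD)
  have q: "1 < q"
  proof -
    have "1/q = 1 - 1/p" using pq by linarith
    moreover have "0 < 1 - 1/p" "1 - 1/p < 1" using p by auto
    ultimately have "0 < 1/q" "1/q < 1" by linarith+
    then show ?thesis by (simp add: divide_less_eq split: if_splits)
  qed
  have Lg1: "Lp 1 g" using L q by (intro Lp_imp_Lp1[of q]) auto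
  have key: "norm (fc (\<lambda>z. f z * g z) n - (if n = 0 then fc f 0 * fc g 0 else 0)) \<le> e * (normp q g + norm (fc g 0))"
    if n: "n \<le> 0" and e: "0 < e" for n :: int and e :: real
  proof -
    obtain N :: nat and c where c: "normp p (\<lambda>z. f z - (\<Sum>k\<le>N. c k * z ^ k)) < e"
      using polynomials_dense_Hp[OF f e] by blast
    define h where "h z = (\<Sum>k\<le>N. c k * z ^ k)" for z :: complex
    have hH: "h \<in> Hp p" unfolding h_def by (intro Hp_sum Hp_cmult Hp_power) auto
    have Lh: "Lp p h" using hH by (rule HpD)
    have fch: "fc h 0 = c 0"
    proof -
      have "fc h 0 = (\<Sum>k\<le>N. fc (\<lambda>z. c k * z ^ k) 0)"
        unfolding h_def by (rule fc_sum) (auto intro!: Hp_Lp1 Hp_cmult Hp_power)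
      also have "\<dots> = (\<Sum>k\<le>N. if k = 0 then c 0 else 0)"
        by (intro sum.cong refl) (use fc_powi[of "int _" 0] in \<open>auto simp: fc_cmult\<close>)
      finally show ?thesis by simp
    qed
    have hg: "fc (\<lambda>z. h z * g z) n = (if n = 0 then fc h 0 * fc g 0 else 0)"
    proof -
      have "fc (\<lambda>z. h z * g z) n = fc (\<lambda>z. \<Sum>k\<le>N. c k * (z powi int k * g z)) n"
        unfolding h_def by (simp add: sum_distrib_right mult.assoc)
      also have "\<dots> = (\<Sum>k\<le>N. fc (\<lambda>z. c k * (z powi int k * g z)) n)"
        by (rule fc_sum) (auto intro!: Lp_cmult Lp_mult_Linf Lg1 simp del: power_int_of_nat)
      also have "\<dots> = (\<Sum>k\<le>N. c k * fc g (n - int k))" by (simp only: fc_cmult fc_powi_mult)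
      also have "\<dots> = (\<Sum>k\<le>N. if k = 0 then c 0 * fc g n else 0)"
        by (intro sum.cong refl) (use n HpD(2)[OF g] in auto)
      also have "\<dots> = c 0 * fc g n" by simp
      finally show ?thesis using n HpD(2)[OF g, of n] fch by auto
    qed
    have L1: "Lp 1 (\<lambda>z. f z * g z)" "Lp 1 (\<lambda>z. h z * g z)"
      using Lp_mult[OF L p pq] Lp_mult[OF Lh L(2) p pq] by auto
    have Ld: "Lp p (\<lambda>z. f z - h z)" using L Lh p by (intro Lp_diff) auto
    have "fc (\<lambda>z. f z * g z) n - fc (\<lambda>z. h z * g z) n = fc (\<lambda>z. (f z - h z) * g z) n"
      using fc_diff[OF L1, of n] by (simp add: left_diff_distrib)
    also have "norm \<dots> \<le> (1 / (2*pi)) * (\<integral>\<theta>. norm ((f (cis \<theta>) - h (cis \<theta>)) * g (cis \<theta>)) \<partial>cm)"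
    proof -
      have "norm (\<integral>\<theta>. (f (cis \<theta>) - h (cis \<theta>)) * g (cis \<theta>) * cis (- (real_of_int n * \<theta>)) \<partial>cm)
          \<le> (\<integral>\<theta>. norm ((f (cis \<theta>) - h (cis \<theta>)) * g (cis \<theta>)) \<partial>cm)"
        by (rule order_trans[OF integral_norm_bound]) (simp add: norm_mult)
      from mult_left_mono[OF this, of "1 / (2*pi)"] show ?thesis unfolding fc_cm
        by (simp add: norm_mult norm_divide)
    qed
    also have "\<dots> \<le> 1 * (\<integral>\<theta>. norm ((f (cis \<theta>) - h (cis \<theta>)) * g (cis \<theta>)) \<partial>cm)"
      using pi_ge_two by (intro mult_right_mono integral_nonneg_AE) auto
    also have "\<dots> \<le> normp p (\<lambda>z. f z - h z) * normp q g"
      using holder_bound[OF Ld L(2) p pq] by simp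
    also have "\<dots> \<le> e * normp q g" using c by (intro mult_right_mono) (auto simp: h_def)
    finally have 1: "norm (fc (\<lambda>z. f z * g z) n - fc (\<lambda>z. h z * g z) n) \<le> e * normp q g" .
    have "fc f 0 - fc h 0 = fc (\<lambda>z. f z - h z) 0" using L Lh by (simp add: fc_diff Lp_Lp1)
    then have "norm (fc f 0 - fc h 0) \<le> e" using norm_fc_le[OF Ld p, of 0] c by (simp add: h_def)
    then have "norm (fc f 0 - fc h 0) * norm (fc g 0) \<le> e * norm (fc g 0)" by (rule mult_right_mono) simp
    then have 2: "norm (fc f 0 * fc g 0 - fc h 0 * fc g 0) \<le> e * norm (fc g 0)"
      by (simp add: norm_mult[symmetric] left_diff_distrib)
    show ?thesis
    proof (cases "n = 0")
      case True
      have "norm (fc (\<lambda>z. f z * g z) n - fc f 0 * fc g 0)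
         \<le> norm (fc (\<lambda>z. f z * g z) n - fc h 0 * fc g 0) + norm (fc h 0 * fc g 0 - fc f 0 * fc g 0)"
        by (rule order_trans[OF _ norm_triangle_ineq]) simp
      moreover have "fc (\<lambda>z. h z * g z) n = fc h 0 * fc g 0" using hg True by simp
      ultimately show ?thesis using 1 2 True unfolding distrib_left by (simp add: norm_minus_commute)
    next
      case False
      have "0 \<le> e * norm (fc g 0)" using e by simp
      then show ?thesis using 1 False unfolding hg distrib_left by simp
    qed
  qed
  have zero: "fc (\<lambda>z. f z * g z) n = (if n = 0 then fc f 0 * fc g 0 else 0)" if n: "n \<le> 0" for n
  proof -
    define K where "K = normp q g + norm (fc g 0) + 1"
    have K: "0 < K" unfolding K_def using normp_nonneg[of q g] by (simp add: add_nonneg_pos)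
    have "norm (fc (\<lambda>z. f z * g z) n - (if n = 0 then fc f 0 * fc g 0 else 0)) \<le> 0 + e" if e: "0 < e" for e
    proof -
      have "norm (fc (\<lambda>z. f z * g z) n - (if n = 0 then fc f 0 * fc g 0 else 0)) \<le> e / K * (normp q g + norm (fc g 0))"
        using K e by (intro key n) auto
      also have "\<dots> \<le> e / K * K" using K e by (intro mult_left_mono) (auto simp: K_def)
      finally show ?thesis using K by simp
    qed
    then have "norm (fc (\<lambda>z. f z * g z) n - (if n = 0 then fc f 0 * fc g 0 else 0)) \<le> 0" by (rule field_le_epsilon)
    then show ?thesis by simp
  qed
  show "n < 0 \<Longrightarrow> fc (\<lambda>z. f z * g z) n = 0" using zero[of n] by simp
  show "fc (\<lambda>z. f z * g z) 0 = fc f 0 * fc g 0" using zero[of 0] by simp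
qed

section \<open>Toeplitz and Hankel operators\<close>

lemma Jop_Jop: "aeq (Jop (Jop f)) f"
proof (rule aeq_pointwise)
  fix z :: complex assume "norm z = 1"
  then have "z \<noteq> 0" by auto
  then show "Jop (Jop f) z = f z" by (simp add: Jop_def)
qed

lemma Jop_Hp: "Lp p k \<Longrightarrow> (\<And>n. 0 \<le> n \<Longrightarrow> fc k n = 0) \<Longrightarrow> Jop k \<in> Hp p"
  using p by (intro HpI Lp_Jop) (auto simp: fc_Jop Lp_meas)

lemma fc_Jop_Hp: "f \<in> Hp p \<Longrightarrow> 0 \<le> n \<Longrightarrow> fc (Jop f) n = 0"
  by (simp add: fc_Jop Hp_meas HpD(2))

lemma Lp_Jop_Hp: "f \<in> Hp p \<Longrightarrow> Lp p (Jop f)" using p by (intro Lp_Jop HpD) auto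

lemma Pr_Jop: "f \<in> Hp p \<Longrightarrow> aeq (Pr (Jop f)) (\<lambda>_. 0)"
  by (simp add: Pr_eq_0_iff Lp_Jop_Hp fc_Jop_Hp)

lemma Qr_Jop: assumes "f \<in> Hp p" shows "aeq (Qr (Jop f)) (Jop f)"
  using Pr_Jop[OF assms] unfolding aeq_cm Qr_def by eventually_elim simp

lemma meas_Pr: "Lp p f \<Longrightarrow> meas (Pr f)" using Pr_Hp Hp_meas by blast

text \<open>The flip of a function in \<open>Hp p\<close> has only negative indices, so
  \<open>Q\<close> acts on it as the identity.\<close>

lemma Hank_eq: assumes "f \<in> Hp p" "meas a" shows "Hank a f = Pr (\<lambda>z. a z * Jop f z)"
proof -
  have "meas (Qr (Jop f))" unfolding Qr_def
    using assms Lp_Jop_Hp by (intro meas_diff meas_Jop meas_Pr) (auto dest: Hp_meas)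
  then show ?thesis unfolding Hank_def using assms Qr_Jop
    by (intro Pr_aeq_cong aeq_cmult meas_mult meas_Jop) (auto dest: Hp_meas)
qed

lemma Lp_symbol: "Linf a \<Longrightarrow> f \<in> Hp p \<Longrightarrow> Lp p (\<lambda>z. a z * f z)"
  using p by (intro Lp_mult_Linf HpD) auto

lemma Lp_symbol_J: "Linf a \<Longrightarrow> f \<in> Hp p \<Longrightarrow> Lp p (\<lambda>z. a z * Jop f z)"
  using p by (intro Lp_mult_Linf Lp_Jop_Hp) auto

lemma Toep_Hp: "Linf a \<Longrightarrow> f \<in> Hp p \<Longrightarrow> Toep a f \<in> Hp p"
  unfolding Toep_def by (intro Pr_Hp Lp_symbol)

lemma Hank_Hp: "Linf a \<Longrightarrow> f \<in> Hp p \<Longrightarrow> Hank a f \<in> Hp p"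
  by (simp add: Hank_eq Linf_meas Pr_Hp Lp_symbol_J)

lemma Toep_cong: "aeq f g \<Longrightarrow> meas f \<Longrightarrow> meas g \<Longrightarrow> meas a \<Longrightarrow> Toep a f = Toep a g"
  unfolding Toep_def by (intro Pr_aeq_cong aeq_cmult meas_mult)

lemma Toep_add: "Linf a \<Longrightarrow> f \<in> Hp p \<Longrightarrow> g \<in> Hp p \<Longrightarrow> aeq (Toep a (\<lambda>z. f z + g z)) (\<lambda>z. Toep a f z + Toep a g z)"
  using Pr_add[OF Lp_symbol Lp_symbol] by (simp add: Toep_def distrib_left)

lemma Toep_diff: "Linf a \<Longrightarrow> f \<in> Hp p \<Longrightarrow> g \<in> Hp p \<Longrightarrow> aeq (Toep a (\<lambda>z. f z - g z)) (\<lambda>z. Toep a f z - Toep a g z)"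
  using Pr_diff[OF Lp_symbol Lp_symbol] by (simp add: Toep_def right_diff_distrib)

lemma Toep_cmult: "Linf a \<Longrightarrow> f \<in> Hp p \<Longrightarrow> aeq (Toep a (\<lambda>z. k * f z)) (\<lambda>z. k * Toep a f z)"
  using Pr_cmult[OF Lp_symbol, of a f k] by (simp add: Toep_def mult.left_commute)

lemma fc_Toep: "Linf a \<Longrightarrow> f \<in> Hp p \<Longrightarrow> fc (Toep a f) n = (if 0 \<le> n then fc (\<lambda>z. a z * f z) n else 0)"
  unfolding Toep_def by (rule Pr_spec(2)[OF Lp_symbol])

lemma Toep_bounded:
  assumes "Linf a"
  obtains C where "0 < C" "\<And>f. f \<in> Hp p \<Longrightarrow> normp p (Toep a f) \<le> C * normp p f"
proof -
  obtain C where C: "0 < C" "\<And>f. Lp p f \<Longrightarrow> Lp p (Pr f) \<and> normp p (Pr f) \<le> C * normp p f"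
    using Pr_bounded by blast
  obtain D where D: "0 < D" "AE \<theta> in cm. norm (a (cis \<theta>)) \<le> D" using assms by (rule Linf_E)
  show thesis
  proof (rule that[of "C * D"])
    fix f assume f: "f \<in> Hp p"
    have "normp p (Toep a f) \<le> C * normp p (\<lambda>z. a z * f z)"
      unfolding Toep_def using C(2)[OF Lp_symbol[OF assms f]] by simp
    also have "\<dots> \<le> C * (D * normp p f)"
      using C D assms f p by (intro mult_left_mono normp_Linf_mult) (auto dest: HpD Linf_meas)
    finally show "normp p (Toep a f) \<le> C * D * normp p f" by (simp add: mult.assoc)
  qed (use C D in simp)
qed

end

section \<open>Coburn's lemma\<close>

context hardy
begin

text \<open>Baire's theorem with closures spelled out: some \<open>S k\<close> is dense in a ball.
  It is proved directly for the seminorm \<open>normp p\<close>, as functions that agree almost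
  everywhere are not identified.\<close>

lemma Hp_baire:
  assumes cover: "\<And>x. x \<in> Hp p \<Longrightarrow> \<exists>k::nat. S k x"
  obtains k x0 r where "x0 \<in> Hp p" "0 < r"
    "\<And>x e. x \<in> Hp p \<Longrightarrow> normp p (\<lambda>z. x z - x0 z) < r \<Longrightarrow> 0 < e \<Longrightarrow> \<exists>y\<in>Hp p. S k y \<and> normp p (\<lambda>z. x z - y z) < e"
proof (rule ccontr)
  assume neg: "\<not> thesis"
  note conclude = that
  have step: "\<exists>x'\<in>Hp p. normp p (\<lambda>z. x' z - x z) < r \<and> (\<exists>e>0. \<forall>y\<in>Hp p. S k y \<longrightarrow> e \<le> normp p (\<lambda>z. x' z - y z))"
    if "x \<in> Hp p" "0 < r" for x r k
  proof (rule ccontr)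
    assume n: "\<not> ?thesis"
    have "thesis"
    proof (rule conclude[OF \<open>x \<in> Hp p\<close> \<open>0 < r\<close>])
      fix x' e assume "x' \<in> Hp p" "normp p (\<lambda>z. x' z - x z) < r" "(0::real) < e"
      then show "\<exists>y\<in>Hp p. S k y \<and> normp p (\<lambda>z. x' z - y z) < e" using n by (meson not_le)
    qed
    with neg show False by simp
  qed
  define P where "P n s \<longleftrightarrow> fst s \<in> Hp p \<and> 0 < snd s" for n :: nat and s :: "cfun \<times> real"
  \<comment> \<open>Each move is at most half of the current radius, and the radius at least halves;
    hence all moves after stage \<open>k\<close> together amount to at most the radius at stage
    \<open>k\<close>. The stage after \<open>n\<close> stays farther than its radius from every
    point of \<open>S n\<close>, so the limit lies in no \<open>S n\<close>.\<close>
  define T where "T n s s' \<longleftrightarrow> normp p (\<lambda>z. fst s' z - fst s z) \<le> snd s / 2 \<and> snd s' \<le> snd s / 2 \<and>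
     (\<forall>y\<in>Hp p. S n y \<longrightarrow> snd s' < normp p (\<lambda>z. fst s' z - y z))" for n and s s' :: "cfun \<times> real"
  have "\<exists>f. \<forall>n. P n (f n) \<and> T n (f n) (f (Suc n))"
  proof (rule dependent_nat_choice)
    show "\<exists>s. P 0 s" by (intro exI[of _ "(\<lambda>_. 0, 1)"]) (simp add: P_def Hp_const)
    fix s n assume "P n s"
    then have s: "fst s \<in> Hp p" "0 < snd s / 2" by (auto simp: P_def)
    from step[OF s, of n] obtain x' e where x': "x' \<in> Hp p" "normp p (\<lambda>z. x' z - fst s z) < snd s / 2" "0 < e"
      "\<And>y. y \<in> Hp p \<Longrightarrow> S n y \<Longrightarrow> e \<le> normp p (\<lambda>z. x' z - y z)" by blast
    have "min (snd s / 2) (e / 2) < e" using x'(3) by (simp add: min_def)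
    then have "T n s (x', min (snd s / 2) (e / 2))" unfolding T_def using x' by fastforce
    moreover have "P (Suc n) (x', min (snd s / 2) (e / 2))" using x' s by (simp add: P_def)
    ultimately show "\<exists>s'. P (Suc n) s' \<and> T n s s'" by blast
  qed
  then obtain f where f: "\<And>n. P n (f n)" "\<And>n. T n (f n) (f (Suc n))" by blast
  define x where "x n = fst (f n)" for n
  define r where "r n = snd (f n)" for n
  have xH: "x n \<in> Hp p" and r0: "0 < r n" for n using f(1)[of n] by (auto simp: P_def x_def r_def)
  have d: "normp p (\<lambda>z. x (Suc n) z - x n z) \<le> r n / 2" and rs: "r (Suc n) \<le> r n / 2"
    and far: "y \<in> Hp p \<Longrightarrow> S n y \<Longrightarrow> r (Suc n) < normp p (\<lambda>z. x (Suc n) z - y z)" for n y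
    using f(2)[of n] by (auto simp: T_def x_def r_def)
  have rk: "r (j + k) \<le> r k * (1/2)^j" for j k
  proof (induction j)
    case (Suc j) then show ?case using rs[of "j + k"] by simp
  qed simp
  have geo: "summable (\<lambda>j. r k / 2 * (1/2)^j)" "(\<Sum>j. r k / 2 * (1/2)^j) = r k" for k
  proof -
    have "(\<lambda>j. r k / 2 * (1/2)^j) sums (r k / 2 * (1 / (1 - 1/2)))"
      by (intro sums_mult geometric_sums) simp
    then show "summable (\<lambda>j. r k / 2 * (1/2)^j)" "(\<Sum>j. r k / 2 * (1/2)^j) = r k"
      by (auto simp: sums_iff)
  qed
  have tailb: "r (j + k) / 2 \<le> r k / 2 * (1/2)^j" for j k using rk[of j k] by simp
  have sm: "summable (\<lambda>j. r (j + k) / 2)" for k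
    by (rule summable_comparison_test[OF _ geo(1)[of k]]) (use tailb[of _ k] r0 in \<open>auto simp: less_imp_le\<close>)
  then have sm0: "summable (\<lambda>j. r j / 2)" using sm[of 0] by simp
  have "\<And>j. (\<lambda>z. x (Suc j) z - x j z) \<in> Hp p" using xH by (intro Hp_diff) auto
  from Hp_series[OF this d sm0] obtain g where g: "g \<in> Hp p"
    "\<And>k. normp p (\<lambda>z. g z - (\<Sum>j<k. x (Suc j) z - x j z)) \<le> (\<Sum>j. r (j + k) / 2)" by blast
  define y where "y z = g z + x 0 z" for z
  have yH: "y \<in> Hp p" unfolding y_def using g(1) xH by (intro Hp_add)
  have near: "normp p (\<lambda>z. x k z - y z) \<le> r k" for k
  proof -
    have "g z - (\<Sum>j<k. x (Suc j) z - x j z) = y z - x k z" for z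
      using sum_lessThan_telescope[of "\<lambda>j. x j z" k] by (simp add: y_def)
    then have "normp p (\<lambda>z. y z - x k z) \<le> (\<Sum>j. r (j + k) / 2)" using g(2)[of k] by simp
    also have "\<dots> \<le> (\<Sum>j. r k / 2 * (1/2)^j)" by (rule suminf_le[OF tailb sm geo(1)])
    finally show ?thesis unfolding geo(2) by (simp add: normp_minus_commute)
  qed
  obtain k where "S k y" using cover[OF yH] by blast
  from far[OF yH this] near[of "Suc k"] show False by simp
qed

section \<open>Representations modulo finitely many vectors\<close>

lemma Toep_sum:
  assumes "Linf a" "finite I" "\<And>i. i \<in> I \<Longrightarrow> f i \<in> Hp p"
  shows "aeq (Toep a (\<lambda>z. \<Sum>i\<in>I. f i z)) (\<lambda>z. \<Sum>i\<in>I. Toep a (f i) z)"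
  using assms(2,3)
proof (induction I rule: finite_induct)
  case empty
  have "aeq (Toep a (\<lambda>z. 0 * (0::complex))) (\<lambda>z. 0 * Toep a (\<lambda>_. 0) z)"
    by (rule Toep_cmult[OF assms(1) Hp_const])
  then show ?case by simp
next
  case (insert i I)
  have "aeq (Toep a (\<lambda>z. f i z + (\<Sum>i\<in>I. f i z))) (\<lambda>z. Toep a (f i) z + Toep a (\<lambda>z. \<Sum>i\<in>I. f i z) z)"
    using insert by (intro Toep_add assms(1) Hp_sum) auto
  also have "aeq \<dots> (\<lambda>z. Toep a (f i) z + (\<Sum>i\<in>I. Toep a (f i) z))"
    using insert by (intro aeq_add aeq_refl) auto
  finally show ?case using insert.hyps by simp
qed

text \<open>\<open>x\<close> is the value at \<open>(f, d)\<close> of the linear map that extends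
  \<open>Toep c\<close> from \<open>Hp p\<close> to the product with a finite-dimensional coordinate
  space. The open mapping theorem is proved for this map; \<open>rep_bound\<close> below describes
  its images of balls.\<close>

definition represented :: "cfun \<Rightarrow> cfun list \<Rightarrow> cfun \<Rightarrow> (nat \<Rightarrow> complex) \<Rightarrow> cfun \<Rightarrow> bool" where
  "represented c gs f d x \<longleftrightarrow> f \<in> Hp p \<and> aeq x (\<lambda>z. Toep c f z + (\<Sum>i<length gs. d i * (gs ! i) z))"

definition spanning :: "cfun \<Rightarrow> cfun list \<Rightarrow> bool" where
  "spanning c gs \<longleftrightarrow> (\<forall>x\<in>Hp p. \<exists>f d. represented c gs f d x)"

definition rep_bound :: "cfun \<Rightarrow> cfun list \<Rightarrow> real \<Rightarrow> cfun \<Rightarrow> bool" where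
  "rep_bound c gs r x \<longleftrightarrow> (\<exists>f d. represented c gs f d x \<and> normp p f \<le> r \<and> (\<forall>i<length gs. norm (d i) \<le> r))"

lemma represented_diff:
  assumes "Linf c" "represented c gs f d x" "represented c gs f' d' x'"
  shows "represented c gs (\<lambda>z. f z - f' z) (\<lambda>i. d i - d' i) (\<lambda>z. x z - x' z)"
proof -
  have H: "f \<in> Hp p" "f' \<in> Hp p" using assms by (auto simp: represented_def)
  have "aeq (\<lambda>z. x z - x' z) (\<lambda>z. (Toep c f z + (\<Sum>i<length gs. d i * (gs ! i) z)) - (Toep c f' z + (\<Sum>i<length gs. d' i * (gs ! i) z)))"
    using assms by (intro aeq_diff) (auto simp: represented_def)
  also have "(\<lambda>z. (Toep c f z + (\<Sum>i<length gs. d i * (gs ! i) z)) - (Toep c f' z + (\<Sum>i<length gs. d' i * (gs ! i) z)))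
     = (\<lambda>z. (Toep c f z - Toep c f' z) + (\<Sum>i<length gs. (d i - d' i) * (gs ! i) z))"
    by (simp add: fun_eq_iff sum_subtractf left_diff_distrib)
  also have "aeq \<dots> (\<lambda>z. Toep c (\<lambda>z. f z - f' z) z + (\<Sum>i<length gs. (d i - d' i) * (gs ! i) z))"
    by (intro aeq_add aeq_refl aeq_sym[OF Toep_diff] assms(1) H)
  finally show ?thesis using H by (simp add: represented_def Hp_diff)
qed

lemma represented_cmult:
  assumes "Linf c" "represented c gs f d x"
  shows "represented c gs (\<lambda>z. k * f z) (\<lambda>i. k * d i) (\<lambda>z. k * x z)"
proof -
  have H: "f \<in> Hp p" using assms by (auto simp: represented_def)
  have "aeq (\<lambda>z. k * x z) (\<lambda>z. k * (Toep c f z + (\<Sum>i<length gs. d i * (gs ! i) z)))"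
    using assms by (intro aeq_cmult) (auto simp: represented_def)
  also have "(\<lambda>z. k * (Toep c f z + (\<Sum>i<length gs. d i * (gs ! i) z)))
     = (\<lambda>z. k * Toep c f z + (\<Sum>i<length gs. (k * d i) * (gs ! i) z))"
    by (simp add: fun_eq_iff sum_distrib_left distrib_left mult.assoc)
  also have "aeq \<dots> (\<lambda>z. Toep c (\<lambda>z. k * f z) z + (\<Sum>i<length gs. (k * d i) * (gs ! i) z))"
    by (intro aeq_add aeq_refl aeq_sym[OF Toep_cmult] assms(1) H)
  finally show ?thesis using H by (simp add: represented_def Hp_cmult)
qed

lemma rep_bound_diff:
  assumes "Linf c" "rep_bound c gs r x" "rep_bound c gs s y" shows "rep_bound c gs (r + s) (\<lambda>z. x z - y z)"
proof -
  obtain f d where f: "represented c gs f d x" "normp p f \<le> r" "\<And>i. i < length gs \<Longrightarrow> norm (d i) \<le> r"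
    using assms(2) by (auto simp: rep_bound_def)
  obtain f' d' where f': "represented c gs f' d' y" "normp p f' \<le> s" "\<And>i. i < length gs \<Longrightarrow> norm (d' i) \<le> s"
    using assms(3) by (auto simp: rep_bound_def)
  have "normp p (\<lambda>z. f z - f' z) \<le> r + s"
    using normp_triangle_diff[of p f f'] f f' p HpD(1) by (force simp: represented_def)
  moreover have "norm (d i - d' i) \<le> r + s" if "i < length gs" for i
    using f(3)[OF that] f'(3)[OF that] norm_triangle_ineq4[of "d i" "d' i"] by linarith
  ultimately show ?thesis unfolding rep_bound_def using represented_diff[OF assms(1) f(1) f'(1)] by blast
qed

lemma rep_bound_cmult:
  assumes "Linf c" "rep_bound c gs r x" shows "rep_bound c gs (norm k * r) (\<lambda>z. k * x z)"
proof -
  obtain f d where f: "represented c gs f d x" "normp p f \<le> r" "\<And>i. i < length gs \<Longrightarrow> norm (d i) \<le> r"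
    using assms(2) by (auto simp: rep_bound_def)
  have "f \<in> Hp p" using f(1) by (simp add: represented_def)
  then have "normp p (\<lambda>z. k * f z) \<le> norm k * r"
    using f(2) p normp_cmult[OF HpD(1), of f p k] by (simp add: mult_left_mono)
  then show ?thesis unfolding rep_bound_def using represented_cmult[OF assms(1) f(1)] f(3)
    by (auto simp: norm_mult mult_left_mono intro!: exI)
qed

lemma aeq_from_tendsto:
  assumes "Lp p x" "Lp p y" "\<And>k. Lp p (s k)"
    "(\<lambda>k. normp p (\<lambda>z. x z - s k z)) \<longlonglongrightarrow> 0" "(\<lambda>k. normp p (\<lambda>z. y z - s k z)) \<longlonglongrightarrow> 0"
  shows "aeq x y"
proof (rule fourier_unique)
  fix n
  show "fc x n = fc y n"
    using fc_tendsto[OF p assms(3,1,4)] fc_tendsto[OF p assms(3,2,5)] by (rule LIMSEQ_unique)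
qed (use assms Lp_Lp1 in auto)

text \<open>Representations of the summands add up: their \<open>f\<close> and their coefficients
  form convergent series, and boundedness of \<open>Toep c\<close> identifies the image of the limit
  with \<open>x\<close>.\<close>

lemma rep_bound_series:
  assumes c: "Linf c" and gs: "set gs \<subseteq> Hp p" and y: "\<And>j. rep_bound c gs (r j) (y j)" "\<And>j. y j \<in> Hp p"
    and r: "summable r" and x: "x \<in> Hp p"
    and lim: "(\<lambda>k. normp p (\<lambda>z. x z - (\<Sum>j<k. y j z))) \<longlonglongrightarrow> 0"
  shows "rep_bound c gs (suminf r) x"
proof -
  have "\<forall>j. \<exists>f d. represented c gs f d (y j) \<and> normp p f \<le> r j \<and> (\<forall>i<length gs. norm (d i) \<le> r j)"
    using y(1) by (simp add: rep_bound_def)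
  then obtain f d where f: "\<And>j. represented c gs (f j) (d j) (y j)" "\<And>j. normp p (f j) \<le> r j"
     "\<And>j i. i < length gs \<Longrightarrow> norm (d j i) \<le> r j" by metis
  have fH: "f j \<in> Hp p" for j using f(1) by (simp add: represented_def)
  have r0: "0 \<le> r j" for j using f(2)[of j] normp_nonneg[of p "f j"] by linarith
  obtain F where F: "F \<in> Hp p" "\<And>k. normp p (\<lambda>z. F z - (\<Sum>j<k. f j z)) \<le> (\<Sum>j. r (j + k))"
    using Hp_series[OF fH f(2) r] by blast
  define D where "D i = (\<Sum>j. d j i)" for i
  have sd: "summable (\<lambda>j. norm (d j i))" if "i < length gs" for i
    by (rule summable_comparison_test[OF _ r]) (use f(3)[OF that] in auto)
  have Dlim: "(\<lambda>k. \<Sum>j<k. d j i) \<longlonglongrightarrow> D i" if "i < length gs" for i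
    unfolding D_def by (rule summable_LIMSEQ[OF summable_norm_cancel[OF sd[OF that]]])
  have Db: "norm (D i) \<le> suminf r" if "i < length gs" for i
    unfolding D_def using summable_norm[OF sd[OF that]] suminf_le[OF f(3)[OF that] sd[OF that] r] by linarith
  have Fb: "normp p F \<le> suminf r" using F(2)[of 0] by simp
  have gH: "gs ! i \<in> Hp p" if "i < length gs" for i using gs that by auto
  obtain C where C: "0 < C" "\<And>f. f \<in> Hp p \<Longrightarrow> normp p (Toep c f) \<le> C * normp p f" using Toep_bounded[OF c] by blast
  define s where "s k z = (\<Sum>j<k. y j z)" for k z
  define X where "X z = Toep c F z + (\<Sum>i<length gs. D i * (gs ! i) z)" for z
  have sH: "s k \<in> Hp p" for k unfolding s_def using y(2) by (intro Hp_sum) auto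
  have XH: "X \<in> Hp p" unfolding X_def using c F gH by (intro Hp_add Toep_Hp Hp_sum Hp_cmult) auto
  have est: "normp p (\<lambda>z. X z - s k z) \<le> C * (\<Sum>j. r (j + k)) + (\<Sum>i<length gs. norm (D i - (\<Sum>j<k. d j i)) * normp p (gs ! i))" for k
  proof -
    let ?f = "\<lambda>z. F z - (\<Sum>j<k. f j z)"
    have fs: "(\<lambda>z. \<Sum>j<k. f j z) \<in> Hp p" using fH by (intro Hp_sum) auto
    have fd: "?f \<in> Hp p" using F(1) fs by (intro Hp_diff)
    have "aeq (s k) (\<lambda>z. \<Sum>j<k. (Toep c (f j) z + (\<Sum>i<length gs. d j i * (gs ! i) z)))"
      unfolding s_def using f(1) by (intro aeq_sum) (auto simp: represented_def)
    also have "(\<lambda>z. \<Sum>j<k. (Toep c (f j) z + (\<Sum>i<length gs. d j i * (gs ! i) z)))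
       = (\<lambda>z. (\<Sum>j<k. Toep c (f j) z) + (\<Sum>i<length gs. (\<Sum>j<k. d j i) * (gs ! i) z))"
    proof
      fix z
      have "(\<Sum>j<k. \<Sum>i<length gs. d j i * (gs ! i) z) = (\<Sum>i<length gs. (\<Sum>j<k. d j i) * (gs ! i) z)"
        by (subst sum.swap) (simp add: sum_distrib_right)
      then show "(\<Sum>j<k. (Toep c (f j) z + (\<Sum>i<length gs. d j i * (gs ! i) z)))
        = (\<Sum>j<k. Toep c (f j) z) + (\<Sum>i<length gs. (\<Sum>j<k. d j i) * (gs ! i) z)" by (simp add: sum.distrib)
    qed
    also have "aeq \<dots> (\<lambda>z. Toep c (\<lambda>z. \<Sum>j<k. f j z) z + (\<Sum>i<length gs. (\<Sum>j<k. d j i) * (gs ! i) z))"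
      using fH by (intro aeq_add aeq_refl aeq_sym[OF Toep_sum] c) auto
    finally have "aeq (\<lambda>z. X z - s k z) (\<lambda>z. X z - (Toep c (\<lambda>z. \<Sum>j<k. f j z) z + (\<Sum>i<length gs. (\<Sum>j<k. d j i) * (gs ! i) z)))"
      by (intro aeq_diff aeq_refl)
    also have "(\<lambda>z. X z - (Toep c (\<lambda>z. \<Sum>j<k. f j z) z + (\<Sum>i<length gs. (\<Sum>j<k. d j i) * (gs ! i) z)))
      = (\<lambda>z. (Toep c F z - Toep c (\<lambda>z. \<Sum>j<k. f j z) z) + (\<Sum>i<length gs. (D i - (\<Sum>j<k. d j i)) * (gs ! i) z))"
      unfolding X_def by (simp add: fun_eq_iff sum_subtractf left_diff_distrib)
    also have "aeq \<dots> (\<lambda>z. Toep c ?f z + (\<Sum>i<length gs. (D i - (\<Sum>j<k. d j i)) * (gs ! i) z))"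
      using F(1) fs by (intro aeq_add aeq_refl aeq_sym[OF Toep_diff] c)
    finally have a: "aeq (\<lambda>z. X z - s k z) (\<lambda>z. Toep c ?f z + (\<Sum>i<length gs. (D i - (\<Sum>j<k. d j i)) * (gs ! i) z))" .
    have h1: "Toep c ?f \<in> Hp p" by (rule Toep_Hp[OF c fd])
    have h2: "(\<lambda>z. \<Sum>i<length gs. (D i - (\<Sum>j<k. d j i)) * (gs ! i) z) \<in> Hp p"
      using gH by (intro Hp_sum Hp_cmult) auto
    have "normp p (\<lambda>z. X z - s k z) = normp p (\<lambda>z. Toep c ?f z + (\<Sum>i<length gs. (D i - (\<Sum>j<k. d j i)) * (gs ! i) z))"
      by (rule normp_cong[OF a Hp_meas[OF Hp_diff[OF XH sH]] Hp_meas[OF Hp_add[OF h1 h2]]])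
    also have "\<dots> \<le> normp p (Toep c ?f) + normp p (\<lambda>z. \<Sum>i<length gs. (D i - (\<Sum>j<k. d j i)) * (gs ! i) z)"
      using p by (intro normp_triangle HpD(1)[OF h1] HpD(1)[OF h2]) auto
    also have "normp p (Toep c ?f) \<le> C * (\<Sum>j. r (j + k))"
      using C(2)[OF fd] mult_left_mono[OF F(2)[of k], of C] C(1) by linarith
    also have "normp p (\<lambda>z. \<Sum>i<length gs. (D i - (\<Sum>j<k. d j i)) * (gs ! i) z)
        \<le> (\<Sum>i<length gs. normp p (\<lambda>z. (D i - (\<Sum>j<k. d j i)) * (gs ! i) z))"
      using p gH Hp_cmult by (intro normp_sum) (auto intro: HpD(1))
    also have "\<dots> = (\<Sum>i<length gs. norm (D i - (\<Sum>j<k. d j i)) * normp p (gs ! i))"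
      using p gH by (intro sum.cong refl normp_cmult) (auto intro: HpD(1))
    finally show ?thesis by simp
  qed
  have z1: "(\<lambda>k. C * (\<Sum>j. r (j + k))) \<longlonglongrightarrow> C * 0" by (intro tendsto_mult tendsto_const suminf_tail_tendsto_0 r)
  have z2: "(\<lambda>k. \<Sum>i<length gs. norm (D i - (\<Sum>j<k. d j i)) * normp p (gs ! i)) \<longlonglongrightarrow> (\<Sum>i<length gs. norm (D i - D i) * normp p (gs ! i))"
    by (intro tendsto_intros Dlim) auto
  have "(\<lambda>k. C * (\<Sum>j. r (j + k)) + (\<Sum>i<length gs. norm (D i - (\<Sum>j<k. d j i)) * normp p (gs ! i))) \<longlonglongrightarrow> 0"
    using tendsto_add[OF z1 z2] by simp
  then have limX: "(\<lambda>k. normp p (\<lambda>z. X z - s k z)) \<longlonglongrightarrow> 0"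
    by (rule tendsto_sandwich[OF _ _ tendsto_const, rotated 2]) (use est in auto)
  have "aeq x X"
    by (rule aeq_from_tendsto[OF HpD(1)[OF x] HpD(1)[OF XH] HpD(1)[OF sH] _ limX]) (use lim in \<open>simp add: s_def\<close>)
  then have "represented c gs F D x" using F(1) by (simp add: represented_def X_def[abs_def])
  then show ?thesis unfolding rep_bound_def using Fb Db by blast
qed

end

section \<open>Open mapping theorem and removal of complement vectors\<close>

context hardy
begin

text \<open>Spanning says only that representations exist. Baire's theorem makes small vectors
  approximately representable with small data, and successive approximation turns this into exact
  representations with a linear bound.\<close>

lemma Toep_open_mapping:
  assumes c: "Linf c" and gs: "set gs \<subseteq> Hp p" and span: "spanning c gs"
  obtains K where "0 \<le> K" "\<And>x \<delta>. x \<in> Hp p \<Longrightarrow> 0 < \<delta> \<Longrightarrow> normp p x < \<delta> \<Longrightarrow> rep_bound c gs (K * \<delta>) x"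
proof -
  have cover: "\<exists>k::nat. rep_bound c gs (real k) x" if x: "x \<in> Hp p" for x
  proof -
    obtain f d where fd: "represented c gs f d x" using span x by (auto simp: spanning_def)
    obtain k :: nat where k: "normp p f + (\<Sum>i<length gs. norm (d i)) \<le> real k" using real_arch_simple by blast
    have s0: "0 \<le> (\<Sum>i<length gs. norm (d i))" by (intro sum_nonneg) auto
    have "norm (d i) \<le> real k" if "i < length gs" for i
    proof -
      have "norm (d i) \<le> (\<Sum>i<length gs. norm (d i))" using that by (intro member_le_sum) auto
      then show ?thesis using k normp_nonneg[of p f] by linarith
    qed
    moreover have "normp p f \<le> real k" using k s0 by linarith
    ultimately show ?thesis unfolding rep_bound_def using fd by blast
  qed
  obtain k x0 r where B: "x0 \<in> Hp p" "0 < r"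
    "\<And>x e. x \<in> Hp p \<Longrightarrow> normp p (\<lambda>z. x z - x0 z) < r \<Longrightarrow> 0 < e
       \<Longrightarrow> \<exists>y\<in>Hp p. rep_bound c gs (real k) y \<and> normp p (\<lambda>z. x z - y z) < e"
    by (rule Hp_baire[of "\<lambda>k. rep_bound c gs (real k)", OF cover]) (assumption, rule that)
  \<comment> \<open>Approximating both \<open>x + x0\<close> and \<open>x0\<close> and subtracting
    moves the ball to the origin, at the price of doubling the bound.\<close>
  have approx0: "\<exists>y\<in>Hp p. rep_bound c gs (2 * real k) y \<and> normp p (\<lambda>z. x z - y z) < e"
    if x: "x \<in> Hp p" "normp p x < r" and e: "0 < e" for x e
  proof -
    have xx: "(\<lambda>z. x z + x0 z) \<in> Hp p" using x(1) B(1) by (rule Hp_add)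
    obtain y1 where y1: "y1 \<in> Hp p" "rep_bound c gs (real k) y1" "normp p (\<lambda>z. x z + x0 z - y1 z) < e / 2"
      using B(3)[OF xx, of "e / 2"] x e by auto
    have "normp p (\<lambda>z. x0 z - x0 z) < r" using B(2) p by (subst normp_zero) auto
    then obtain y2 where y2: "y2 \<in> Hp p" "rep_bound c gs (real k) y2" "normp p (\<lambda>z. x0 z - y2 z) < e / 2"
      using B(3)[OF B(1), of "e / 2"] e by auto
    have "normp p (\<lambda>z. (x z + x0 z - y1 z) - (x0 z - y2 z)) \<le> normp p (\<lambda>z. x z + x0 z - y1 z) + normp p (\<lambda>z. x0 z - y2 z)"
      using p by (intro normp_triangle_diff HpD(1) Hp_diff xx y1(1) y2(1) B(1)) auto
    moreover have "(\<lambda>z. (x z + x0 z - y1 z) - (x0 z - y2 z)) = (\<lambda>z. x z - (y1 z - y2 z))" by (simp add: fun_eq_iff)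
    ultimately have "normp p (\<lambda>z. x z - (y1 z - y2 z)) < e" using y1 y2 by simp
    moreover have "rep_bound c gs (2 * real k) (\<lambda>z. y1 z - y2 z)" using rep_bound_diff[OF c y1(2) y2(2)] by simp
    ultimately show ?thesis using Hp_diff[OF y1(1) y2(1)] by blast
  qed
  define M where "M = 2 * real k / r"
  have M: "0 \<le> M" using B(2) by (simp add: M_def)
  have approx1: "\<exists>y\<in>Hp p. rep_bound c gs (M * \<delta>) y \<and> normp p (\<lambda>z. x z - y z) < e"
    if x: "x \<in> Hp p" "normp p x < \<delta>" and \<delta>: "0 < \<delta>" and e: "0 < e" for x e \<delta>
  proof -
    define t where "t = r / \<delta>"
    have t: "0 < t" using B(2) \<delta> by (simp add: t_def)
    have "normp p (\<lambda>z. of_real t * x z) = t * normp p x" using normp_cmult[OF HpD(1)[OF x(1)], of "of_real t"] t p by simp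
    also have "\<dots> < t * \<delta>" using x t by (intro mult_strict_left_mono) auto
    finally have "normp p (\<lambda>z. of_real t * x z) < r" using \<delta> by (simp add: t_def)
    then obtain y where y: "y \<in> Hp p" "rep_bound c gs (2 * real k) y" "normp p (\<lambda>z. of_real t * x z - y z) < e * t"
      using approx0[OF Hp_cmult[OF x(1)], of "of_real t" "e * t"] e t by auto
    let ?y = "\<lambda>z. of_real (1/t) * y z"
    have "rep_bound c gs (norm (complex_of_real (1/t)) * (2 * real k)) ?y" by (rule rep_bound_cmult[OF c y(2)])
    moreover have "norm (complex_of_real (1/t)) * (2 * real k) = M * \<delta>"
      using t \<delta> B(2) unfolding norm_of_real by (simp add: M_def t_def)
    moreover have "(\<lambda>z. x z - ?y z) = (\<lambda>z. of_real (1/t) * (of_real t * x z - y z))"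
      using t by (simp add: fun_eq_iff field_simps)
    moreover have "normp p (\<lambda>z. of_real (1/t) * (of_real t * x z - y z)) = (1/t) * normp p (\<lambda>z. of_real t * x z - y z)"
      using normp_cmult[OF HpD(1)[OF Hp_diff[OF Hp_cmult[OF x(1)] y(1)]], of "of_real (1/t)"] t p by (simp add: norm_divide)
    moreover have "(1/t) * normp p (\<lambda>z. of_real t * x z - y z) < e" using y(3) t by (simp add: pos_divide_less_eq)
    ultimately have "rep_bound c gs (M * \<delta>) ?y" "normp p (\<lambda>z. x z - ?y z) < e" by simp_all
    then show ?thesis using Hp_cmult[OF y(1)] by blast
  qed
  show thesis
  proof (rule that[of "2 * M"])
    fix x \<delta> assume x: "x \<in> Hp p" "0 < \<delta>" "normp p x < \<delta>"
    \<comment> \<open>Stage \<open>n\<close> holds the remainder after \<open>n\<close> corrections.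
      Its bound is halved each time, so the bounds of the corrections sum to
      \<open>2 * M * \<delta>\<close>.\<close>
    define P where "P n u \<longleftrightarrow> u \<in> Hp p \<and> normp p u < \<delta> * (1/2)^n \<and> (n = 0 \<longrightarrow> u = x)" for n :: nat and u
    define T where "T n u v \<longleftrightarrow> rep_bound c gs (M * (\<delta> * (1/2)^n)) (\<lambda>z. u z - v z)" for n :: nat and u v :: cfun
    have "\<exists>f. \<forall>n. P n (f n) \<and> T n (f n) (f (Suc n))"
    proof (rule dependent_nat_choice)
      show "\<exists>u. P 0 u" using x by (auto simp: P_def)
      fix u n assume "P n u"
      then have u: "u \<in> Hp p" "normp p u < \<delta> * (1/2)^n" by (auto simp: P_def)
      obtain y where y: "y \<in> Hp p" "rep_bound c gs (M * (\<delta> * (1/2)^n)) y" "normp p (\<lambda>z. u z - y z) < \<delta> * (1/2)^Suc n"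
        using approx1[OF u, of "\<delta> * (1/2)^Suc n"] x(2) by auto
      have "P (Suc n) (\<lambda>z. u z - y z)" using y u Hp_diff by (simp add: P_def)
      moreover have "T n u (\<lambda>z. u z - y z)" using y(2) by (simp add: T_def)
      ultimately show "\<exists>v. P (Suc n) v \<and> T n u v" by blast
    qed
    then obtain f where f: "\<And>n. P n (f n)" "\<And>n. T n (f n) (f (Suc n))" by blast
    have fH: "f n \<in> Hp p" "normp p (f n) < \<delta> * (1/2)^n" "f 0 = x" for n
      using f(1)[of n] f(1)[of 0] by (auto simp: P_def)
    have geo: "(\<lambda>n. M * (\<delta> * (1/2)^n)) sums (M * (\<delta> * (1 / (1 - 1/2))))"
      by (intro sums_mult geometric_sums) simp
    have "rep_bound c gs (\<Sum>n. M * (\<delta> * (1/2)^n)) x"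
    proof (rule rep_bound_series[OF c gs])
      show "rep_bound c gs (M * (\<delta> * (1/2)^j)) (\<lambda>z. f j z - f (Suc j) z)" for j using f(2)[of j] by (simp add: T_def)
      show "(\<lambda>z. f j z - f (Suc j) z) \<in> Hp p" for j using fH by (intro Hp_diff)
      show "summable (\<lambda>n. M * (\<delta> * (1/2)^n))" using geo by (rule sums_summable)
      have tele: "x z - (\<Sum>j<k. f j z - f (Suc j) z) = f k z" for k z
        using sum_lessThan_telescope'[of "\<lambda>j. f j z" k] fH(3) by simp
      have z: "(\<lambda>n. \<delta> * (1/2)^n) \<longlonglongrightarrow> 0" by (intro tendsto_mult_right_zero LIMSEQ_power_zero) simp
      have "(\<lambda>k. normp p (f k)) \<longlonglongrightarrow> 0"
        by (rule tendsto_sandwich[OF _ _ tendsto_const z]) (use fH(2) in \<open>auto intro!: always_eventually less_imp_le\<close>)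
      then show "(\<lambda>k. normp p (\<lambda>z. x z - (\<Sum>j<k. f j z - f (Suc j) z))) \<longlonglongrightarrow> 0" by (simp add: tele)
    qed fact
    moreover have "(\<Sum>n. M * (\<delta> * (1/2)^n)) = 2 * M * \<delta>" using geo by (simp add: sums_iff)
    ultimately show "rep_bound c gs (2 * M * \<delta>) x" by simp
  qed (use M in simp)
qed

lemma fc_power_symbol: "fc (\<lambda>z. c z * (z ^ m * s z)) i = fc (\<lambda>z. c z * s z) (i - int m)"
  using fc_powi_mult[of "int m" "\<lambda>z. c z * s z" i] by (simp add: mult_ac)

text \<open>If \<open>- j\<close> is the largest index with a nonzero coefficient of \<open>c s\<close>, then \<open>T(c) (z\<^sup>m s)\<close> is a polynomial of
  degree exactly \<open>m - j\<close>.\<close>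
lemma Toep_range_powers:
  assumes c: "Linf c" and c0: "AE \<theta> in cm. c (cis \<theta>) \<noteq> 0"
    and s: "s \<in> Hp p" "\<not> aeq s (\<lambda>_. 0)" "aeq (Toep c s) (\<lambda>_. 0)"
  shows "\<exists>f\<in>Hp p. aeq (Toep c f) (\<lambda>z. z ^ n)"
proof -
  define u where "u z = c z * s z" for z
  have Lu: "Lp p u" unfolding u_def by (rule Lp_symbol[OF c s(1)])
  have u0: "fc u n = 0" if "0 \<le> n" for n
    using s(3) that Pr_eq_0_iff[OF Lu] unfolding Toep_def u_def by blast
  have "\<exists>j. fc u (- int j) \<noteq> 0"
  proof (rule ccontr)
    assume "\<not> ?thesis"
    then have "fc u n = 0" for n using u0[of n] by (cases n rule: int_cases2) auto
    then have "aeq u (\<lambda>_. 0)" by (intro fourier_unique_zero Lp_Lp1[OF Lu])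
    then have "aeq s (\<lambda>_. 0)" using c0 unfolding aeq_cm u_def by eventually_elim simp
    with s(2) show False by simp
  qed
  define j where "j = (LEAST j. fc u (- int j) \<noteq> 0)"
  have l: "fc u (- int j) \<noteq> 0" unfolding j_def using \<open>\<exists>j. _\<close> by (rule LeastI_ex)
  have small: "fc u i = 0" if "- int j < i" for i
  proof (cases "0 \<le> i")
    case False
    then have "nat (- i) < j" using that by simp
    then have "fc u (- int (nat (- i))) = 0" using not_less_Least unfolding j_def by blast
    then show ?thesis using False by simp
  qed (rule u0)
  show ?thesis
  proof (induction n rule: less_induct)
    case (less n)
    then obtain F where F: "\<And>i. i < n \<Longrightarrow> F i \<in> Hp p" "\<And>i. i < n \<Longrightarrow> aeq (Toep c (F i)) (\<lambda>z. z ^ i)" by metis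
    \<comment> \<open>The coefficients of the polynomial \<open>Toep c ?v\<close>. The leading one
      is \<open>fc u (- int j)\<close>, nonzero by the choice of \<open>j\<close>; the lower powers
      are in the range by induction and get subtracted.\<close>
    define \<alpha> where "\<alpha> i = fc u (int i - int n - int j)" for i
    let ?v = "\<lambda>z. z ^ (n + j) * s z"
    have vH: "?v \<in> Hp p" by (rule Hp_power_mult[OF s(1)])
    have w: "aeq (Toep c ?v) (\<lambda>z. \<Sum>i\<le>n. \<alpha> i * z ^ i)"
    proof (rule fourier_unique)
      show "Lp 1 (Toep c ?v)" by (rule Hp_Lp1[OF Toep_Hp[OF c vH]])
      show "Lp 1 (\<lambda>z. \<Sum>i\<le>n. \<alpha> i * z ^ i)" by (intro Hp_Lp1 Hp_sum Hp_cmult Hp_power) auto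
      fix k
      have "fc (\<lambda>z. \<Sum>i\<le>n. \<alpha> i * z ^ i) k = (\<Sum>i\<le>n. fc (\<lambda>z. \<alpha> i * z ^ i) k)"
        by (rule fc_sum) (auto intro!: Hp_Lp1 Hp_cmult Hp_power)
      also have "\<dots> = (\<Sum>i\<le>n. if k = int i then \<alpha> i else 0)"
        by (intro sum.cong refl) (use fc_powi[of "int _" k] in \<open>auto simp: fc_cmult\<close>)
      also have "\<dots> = (if 0 \<le> k then fc u (k - int (n + j)) else 0)"
      proof (cases "0 \<le> k \<and> k \<le> int n")
        case True
        then have "(\<Sum>i\<le>n. if k = int i then \<alpha> i else 0) = (\<Sum>i\<le>n. if i = nat k then \<alpha> (nat k) else 0)"
          by (intro sum.cong) auto
        then show ?thesis using True by (simp add: nat_le_iff \<alpha>_def algebra_simps)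
      next
        case False
        then have "(\<Sum>i\<le>n. if k = int i then \<alpha> i else 0) = 0" by (intro sum.neutral) auto
        moreover have "0 \<le> k \<Longrightarrow> fc u (k - int (n + j)) = 0" using False by (intro small) auto
        ultimately show ?thesis by simp
      qed
      finally show "fc (Toep c ?v) k = fc (\<lambda>z. \<Sum>i\<le>n. \<alpha> i * z ^ i) k"
        unfolding fc_Toep[OF c vH] fc_power_symbol u_def[symmetric] by simp
    qed
    let ?g = "\<lambda>z. \<Sum>i<n. \<alpha> i * F i z"
    have gH: "?g \<in> Hp p" using F(1) by (intro Hp_sum Hp_cmult) auto
    have g: "aeq (Toep c ?g) (\<lambda>z. \<Sum>i<n. \<alpha> i * z ^ i)"
    proof -
      have "aeq (Toep c ?g) (\<lambda>z. \<Sum>i<n. Toep c (\<lambda>z. \<alpha> i * F i z) z)"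
        using F(1) by (intro Toep_sum c Hp_cmult) auto
      also have "aeq \<dots> (\<lambda>z. \<Sum>i<n. \<alpha> i * Toep c (F i) z)"
        using F(1) by (intro aeq_sum Toep_cmult c) auto
      also have "aeq \<dots> (\<lambda>z. \<Sum>i<n. \<alpha> i * z ^ i)" using F(2) by (intro aeq_sum aeq_cmult) auto
      finally show ?thesis .
    qed
    have an: "\<alpha> n \<noteq> 0" using l by (simp add: \<alpha>_def)
    have "aeq (Toep c (\<lambda>z. (1 / \<alpha> n) * (?v z - ?g z))) (\<lambda>z. (1 / \<alpha> n) * Toep c (\<lambda>z. ?v z - ?g z) z)"
      by (rule Toep_cmult[OF c Hp_diff[OF vH gH]])
    also have "aeq \<dots> (\<lambda>z. (1 / \<alpha> n) * (Toep c ?v z - Toep c ?g z))"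
      by (intro aeq_cmult Toep_diff[OF c vH gH])
    also have "aeq \<dots> (\<lambda>z. (1 / \<alpha> n) * ((\<Sum>i\<le>n. \<alpha> i * z ^ i) - (\<Sum>i<n. \<alpha> i * z ^ i)))"
      by (intro aeq_cmult aeq_diff w g)
    also have "(\<lambda>z. (1 / \<alpha> n) * ((\<Sum>i\<le>n. \<alpha> i * z ^ i) - (\<Sum>i<n. \<alpha> i * z ^ i))) = (\<lambda>z. z ^ n)"
      using an by (simp add: fun_eq_iff lessThan_Suc_atMost[symmetric])
    finally show ?case using Hp_cmult[OF Hp_diff[OF vH gH], of "1 / \<alpha> n"] by blast
  qed
qed

text \<open>Polynomials are dense and lie in the range, while by the open mapping theorem the coefficients of
  a representation are small for small vectors.\<close>
lemma coburn_step:
  assumes c: "Linf c" and c0: "AE \<theta> in cm. c (cis \<theta>) \<noteq> 0"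
    and s: "s \<in> Hp p" "\<not> aeq s (\<lambda>_. 0)" "aeq (Toep c s) (\<lambda>_. 0)"
    and gs: "set (e # es) \<subseteq> Hp p" and span: "spanning c (e # es)"
  shows "spanning c es"
proof -
  have rest: "represented c es f (\<lambda>i. d (Suc i)) (\<lambda>z. x z - d 0 * e z)" if "represented c (e # es) f d x" for f d x
  proof -
    have "aeq (\<lambda>z. x z - d 0 * e z) (\<lambda>z. Toep c f z + (\<Sum>i<length (e # es). d i * ((e # es) ! i) z) - d 0 * e z)"
      using that by (intro aeq_diff aeq_refl) (auto simp: represented_def)
    also have "(\<lambda>z. Toep c f z + (\<Sum>i<length (e # es). d i * ((e # es) ! i) z) - d 0 * e z)
       = (\<lambda>z. Toep c f z + (\<Sum>i<length es. d (Suc i) * (es ! i) z))"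
      by (simp add: fun_eq_iff sum.lessThan_Suc_shift del: sum.lessThan_Suc)
    finally show ?thesis using that by (simp add: represented_def)
  qed
  have eH: "e \<in> Hp p" using gs by simp
  obtain K where K: "0 \<le> K" "\<And>x \<delta>. x \<in> Hp p \<Longrightarrow> 0 < \<delta> \<Longrightarrow> normp p x < \<delta> \<Longrightarrow> rep_bound c (e # es) (K * \<delta>) x"
    using Toep_open_mapping[OF c gs span] by blast
  \<comment> \<open>Chosen so that a vector of norm below \<open>\<delta>\<close> has a
    representation whose coefficient of \<open>e\<close> is at most \<open>K * \<delta> < 1\<close>
    in modulus. Applied to \<open>e - q\<close>, this leaves \<open>1 - d 0\<close> nonzero, and the
    relation can be solved for \<open>e\<close>.\<close>
  define \<delta> where "\<delta> = 1 / (K + 1)"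
  have \<delta>: "0 < \<delta>" "K * \<delta> < 1" using K(1) by (auto simp: \<delta>_def)
  obtain N :: nat and a where N: "normp p (\<lambda>z. e z - (\<Sum>k\<le>N. a k * z ^ k)) < \<delta>"
    using polynomials_dense_Hp[OF eH \<delta>(1)] by blast
  define q where "q z = (\<Sum>k\<le>N. a k * z ^ k)" for z :: complex
  have qH: "q \<in> Hp p" unfolding q_def by (intro Hp_sum Hp_cmult Hp_power) auto
  have q: "\<exists>F. represented c es F (\<lambda>_. 0) q"
  proof -
    have "\<forall>n. \<exists>f\<in>Hp p. aeq (Toep c f) (\<lambda>z. z ^ n)" using Toep_range_powers[OF c c0 s] by blast
    then obtain F where F: "\<And>n. F n \<in> Hp p" "\<And>n. aeq (Toep c (F n)) (\<lambda>z. z ^ n)" by metis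
    let ?F = "\<lambda>z. \<Sum>k\<le>N. a k * F k z"
    have "aeq (Toep c ?F) (\<lambda>z. \<Sum>k\<le>N. Toep c (\<lambda>z. a k * F k z) z)"
      using F(1) by (intro Toep_sum c Hp_cmult) auto
    also have "aeq \<dots> (\<lambda>z. \<Sum>k\<le>N. a k * Toep c (F k) z)" using F(1) by (intro aeq_sum Toep_cmult c) auto
    also have "aeq \<dots> q" unfolding q_def[abs_def] using F(2) by (intro aeq_sum aeq_cmult) auto
    finally have "represented c es ?F (\<lambda>_. 0) q"
      using F(1) by (auto simp: represented_def intro!: Hp_sum Hp_cmult intro: aeq_sym)
    then show ?thesis by blast
  qed
  then obtain F where F: "represented c es F (\<lambda>_. 0) q" by blast
  have "rep_bound c (e # es) (K * \<delta>) (\<lambda>z. e z - q z)"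
    using N \<delta>(1) eH qH unfolding q_def[symmetric] by (intro K(2) Hp_diff)
  then obtain f d where fd: "represented c (e # es) f d (\<lambda>z. e z - q z)" "norm (d 0) \<le> K * \<delta>"
    by (auto simp: rep_bound_def)
  have d1: "1 - d 0 \<noteq> 0" using fd(2) \<delta>(2) by (metis eq_iff_diff_eq_0 norm_one not_less)
  have "represented c es (\<lambda>z. f z - (-1) * F z) (\<lambda>i. d (Suc i) - (-1) * 0) (\<lambda>z. (e z - q z - d 0 * e z) - (-1) * q z)"
    by (rule represented_diff[OF c rest[OF fd(1)] represented_cmult[OF c F]])
  from represented_cmult[OF c this, of "1 / (1 - d 0)"]
  obtain f1 d1' where "represented c es f1 d1' (\<lambda>z. 1 / (1 - d 0) * ((e z - q z - d 0 * e z) - (-1) * q z))" by blast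
  moreover have "(\<lambda>z. 1 / (1 - d 0) * ((e z - q z - d 0 * e z) - (-1) * q z)) = e"
    using d1 by (simp add: fun_eq_iff field_simps)
  ultimately have re: "represented c es f1 d1' e" by simp
  show ?thesis unfolding spanning_def
  proof
    fix x assume "x \<in> Hp p"
    then obtain g b where g: "represented c (e # es) g b x" using span by (auto simp: spanning_def)
    from represented_diff[OF c rest[OF g] represented_cmult[OF c re, of "- b 0"]]
    show "\<exists>f d. represented c es f d x" by auto
  qed
qed

text \<open>The complement vectors are removed one at a time until none is left. For the index this
  means that kernel and cokernel cannot both be nontrivial.\<close>

lemma coburn:
  assumes c: "Linf c" and c0: "AE \<theta> in cm. c (cis \<theta>) \<noteq> 0"
    and s: "s \<in> Hp p" "\<not> aeq s (\<lambda>_. 0)" "aeq (Toep c s) (\<lambda>_. 0)"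
    and gs: "set gs \<subseteq> Hp p" and span: "spanning c gs" and g: "g \<in> Hp p"
  shows "\<exists>f\<in>Hp p. aeq (Toep c f) g"
proof -
  have "spanning c gs \<Longrightarrow> set gs \<subseteq> Hp p \<Longrightarrow> spanning c []"
  proof (induction gs)
    case (Cons e es)
    then show ?case using coburn_step[OF c c0 s] by auto
  qed simp
  then have "spanning c []" using gs span by blast
  then show ?thesis using g unfolding spanning_def represented_def by (auto intro: aeq_sym)
qed

end

section \<open>Index considerations\<close>

context hardy
begin

text \<open>Operator equations become equations between coefficients of nonnegative index, where
  powers of \<open>z\<close> act as mere shifts.\<close>

lemma Toep_aeq_iff:
  assumes "Linf a" "f \<in> Hp p" "g \<in> Hp p"
  shows "aeq (Toep a f) g \<longleftrightarrow> (\<forall>n\<ge>0. fc (\<lambda>z. a z * f z) n = fc g n)"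
proof
  assume "aeq (Toep a f) g"
  then have "fc (Toep a f) = fc g" using assms by (intro fc_cong Hp_meas[OF Toep_Hp] Hp_meas)
  then show "\<forall>n\<ge>0. fc (\<lambda>z. a z * f z) n = fc g n" using fc_Toep[OF assms(1,2)] by metis
next
  assume *: "\<forall>n\<ge>0. fc (\<lambda>z. a z * f z) n = fc g n"
  show "aeq (Toep a f) g"
    using * assms HpD(2)[OF assms(3)] fc_Toep[OF assms(1,2)] by (intro fourier_unique Hp_Lp1 Toep_Hp) auto
qed

lemma Hp_eqI:
  assumes "f \<in> Hp p" "g \<in> Hp p" "\<And>n. 0 \<le> n \<Longrightarrow> fc f n = fc g n" shows "aeq f g"
proof (rule fourier_unique)
  show "fc f n = fc g n" for n using assms HpD(2)[of f p n] HpD(2)[of g p n] by (cases "0 \<le> n") auto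
qed (use assms Hp_Lp1 in auto)

lemma fc_linear_polynomial: "fc (\<lambda>z. x + y * z) n = (if n = 0 then x else if n = 1 then y else 0)"
proof -
  have "fc (\<lambda>z. x + y * z) n = fc (\<lambda>_. x) n + fc (\<lambda>z. y * z) n"
    using Hp_power[of 1] by (intro fc_add Hp_Lp1 Hp_const Hp_cmult) auto
  then show ?thesis using fc_powi[of 1 n] by (simp add: fc_const fc_cmult)
qed

lemma linear_polynomial_Hp: "(\<lambda>z. x + y * z) \<in> Hp p"
  using Hp_power[of 1] by (intro Hp_add Hp_const Hp_cmult) auto

lemma fc_shift2: "fc (\<lambda>z. c z * inverse z ^ 2 * f z) n = fc (\<lambda>z. c z * f z) (n + 2)"
  using fc_powi_mult[of "-2" "\<lambda>z. c z * f z" n] by (simp add: power_int_minus power_inverse mult_ac)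

lemma Linf_shift2: "Linf c \<Longrightarrow> Linf (\<lambda>z. c z * inverse z ^ 2)"
  by (intro Linf_mult Linf_power) auto

lemma fc_square_mult: "fc (\<lambda>z. z ^ 2 * f z) n = fc f (n - 2)"
  using fc_powi_mult[of 2 f n] by simp

lemma fc_symbol_lincomb:
  assumes "Linf c" "f \<in> Hp p" "g \<in> Hp p"
  shows "fc (\<lambda>z. c z * (x * f z + y * g z)) n = x * fc (\<lambda>z. c z * f z) n + y * fc (\<lambda>z. c z * g z) n"
proof -
  have "fc (\<lambda>z. x * (c z * f z) + y * (c z * g z)) n = fc (\<lambda>z. x * (c z * f z)) n + fc (\<lambda>z. y * (c z * g z)) n"
    using p assms by (intro fc_add Lp_Lp1 Lp_cmult Lp_symbol) auto
  then show ?thesis by (simp add: fc_cmult algebra_simps)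
qed

text \<open>A maximal family independent modulo the range spans a complement: appending
  \<open>x\<close> creates a dependence, and \<open>x\<close> must occur in it.\<close>

lemma cokerdim_spanning:
  assumes c: "Linf c" and coker: "cokerdim p (Toep c) n"
  obtains gs where "length gs = n" "set gs \<subseteq> Hp p" "spanning c gs"
    "indep_mod (\<lambda>h. \<exists>f\<in>Hp p. aeq h (Toep c f)) gs"
proof -
  let ?R = "\<lambda>h. \<exists>f\<in>Hp p. aeq h (Toep c f)"
  obtain gs where gs: "length gs = n" "set gs \<subseteq> Hp p" "indep_mod ?R gs"
    and max: "\<And>hs. length hs = Suc n \<Longrightarrow> set hs \<subseteq> Hp p \<Longrightarrow> \<not> indep_mod ?R hs"
    using coker unfolding cokerdim_def Let_def by blast
  have "spanning c gs" unfolding spanning_def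
  proof
    fix x assume x: "x \<in> Hp p"
    have "\<not> indep_mod ?R (gs @ [x])" using gs x by (intro max) auto
    then obtain k f i where k: "f \<in> Hp p" "aeq (\<lambda>z. \<Sum>i<Suc n. k i * ((gs @ [x]) ! i) z) (Toep c f)"
      "i < Suc n" "k i \<noteq> 0"
      unfolding indep_mod_def using gs(1) by auto
    have eq: "(\<Sum>i<Suc n. k i * ((gs @ [x]) ! i) z) = (\<Sum>i<n. k i * (gs ! i) z) + k n * x z" for z
      using gs(1) by (simp add: nth_append)
    have kn: "k n \<noteq> 0"
    proof
      assume 0: "k n = 0"
      then have "?R (\<lambda>z. \<Sum>i<length gs. k i * (gs ! i) z)" using k(1,2) gs(1) unfolding eq by auto
      then have "\<forall>i<n. k i = 0" using gs(3) unfolding indep_mod_def gs(1) by blast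
      with k(3,4) 0 show False by (metis less_antisym)
    qed
    define d where "d i = - k i / k n" for i
    have "aeq x (\<lambda>z. 1 / k n * Toep c f z + (\<Sum>i<length gs. d i * (gs ! i) z))"
      using k(2) unfolding aeq_cm eq
    proof eventually_elim
      case (elim \<theta>)
      have "(\<Sum>i<length gs. d i * (gs ! i) (cis \<theta>)) = - (1 / k n) * (\<Sum>i<n. k i * (gs ! i) (cis \<theta>))"
        unfolding sum_distrib_left gs(1) d_def by simp
      then show ?case unfolding elim[symmetric] using kn by (simp add: algebra_simps)
    qed
    also have "aeq \<dots> (\<lambda>z. Toep c (\<lambda>z. 1 / k n * f z) z + (\<Sum>i<length gs. d i * (gs ! i) z))"
      using k(1) c by (intro aeq_add aeq_refl aeq_sym[OF Toep_cmult])
    finally show "\<exists>f d. represented c gs f d x" unfolding represented_def using Hp_cmult[OF k(1)] by blast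
  qed
  then show thesis using that gs by blast
qed

lemma surj_cokerdim_0:
  assumes c: "Linf c" and coker: "cokerdim p (Toep c) n" and surj: "\<And>g. g \<in> Hp p \<Longrightarrow> \<exists>f\<in>Hp p. aeq (Toep c f) g"
  shows "n = 0"
proof (rule ccontr)
  assume n: "n \<noteq> 0"
  obtain gs where gs: "length gs = n" "set gs \<subseteq> Hp p" "indep_mod (\<lambda>h. \<exists>f\<in>Hp p. aeq h (Toep c f)) gs"
    using cokerdim_spanning[OF c coker] by blast
  have g0: "gs ! 0 \<in> Hp p" using gs n by auto
  have "(\<Sum>i<length gs. (if i = 0 then 1 else 0) * (gs ! i) z) = (gs ! 0) z" for z
    using gs n by (simp add: if_distrib[of "\<lambda>x. x * _"] sum.delta cong: if_cong)
  then have "\<exists>f\<in>Hp p. aeq (\<lambda>z. \<Sum>i<length gs. (if i = 0 then 1 else 0) * (gs ! i) z) (Toep c f)"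
    using surj[OF g0] by (auto intro: aeq_sym)
  then have "\<forall>i<length gs. (if i = 0 then 1 else 0 :: complex) = 0"
      using gs(3)[unfolded indep_mod_def, THEN spec[of _ "\<lambda>i. if i = 0 then 1 else 0"]] by blast
  then show False using gs n by auto
qed

lemma kerdim_nontrivial:
  assumes "kerdim p A m" "m \<noteq> 0"
  obtains s where "s \<in> Hp p" "\<not> aeq s (\<lambda>_. 0)" "aeq (A s) (\<lambda>_. 0)"
proof -
  obtain fs where fs: "length fs = m" "set fs \<subseteq> {f\<in>Hp p. aeq (A f) (\<lambda>_. 0)}" "indep_mod (\<lambda>h. aeq h (\<lambda>_. 0)) fs"
    using assms by (auto simp: kerdim_def)
  have f0: "fs ! 0 \<in> set fs" using fs assms by auto
  have "\<not> aeq (fs ! 0) (\<lambda>_. 0)"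
  proof
    assume a: "aeq (fs ! 0) (\<lambda>_. 0)"
    have "(\<Sum>i<length fs. (if i = 0 then 1 else 0) * (fs ! i) z) = (fs ! 0) z" for z
      using fs assms by (simp add: if_distrib[of "\<lambda>x. x * _"] sum.delta cong: if_cong)
    then have "aeq (\<lambda>z. \<Sum>i<length fs. (if i = 0 then 1 else 0) * (fs ! i) z) (\<lambda>_. 0)" using a by simp
    then have "\<forall>i<length fs. (if i = 0 then 1 else 0 :: complex) = 0"
      using fs(3)[unfolded indep_mod_def, THEN spec[of _ "\<lambda>i. if i = 0 then 1 else 0"]] by blast
    then show False using fs assms by auto
  qed
  then show thesis using that f0 fs(2) by blast
qed

lemma kerdim_0:
  assumes "kerdim p A 0" "f \<in> Hp p" "aeq (A f) (\<lambda>_. 0)" shows "aeq f (\<lambda>_. 0)"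
proof -
  have "\<not> indep_mod (\<lambda>h. aeq h (\<lambda>_. 0)) [f]" using assms by (auto simp: kerdim_def dest!: spec[of _ "[f]"])
  then obtain k where "k \<noteq> 0" "aeq (\<lambda>z. k * f z) (\<lambda>_. 0)" by (auto simp: indep_mod_def)
  then show ?thesis unfolding aeq_cm by (auto elim: AE_mp)
qed

text \<open>By Coburn's lemma \<open>Toep c\<close> is injective with range of codimension 2;
  dividing the symbol by \<open>z\<^sup>2\<close> discards the coefficients of index 0 and 1. A
  nonzero kernel element of the shifted operator would make that operator onto, so that
  \<open>1\<close> and \<open>z\<close> span a complement of the range of \<open>Toep c\<close> up
  to redundancy; but \<open>Toep c\<close> maps this element to a nonzero linear polynomial, leaving
  codimension at most 1. For surjectivity, \<open>1\<close>, \<open>z\<close> and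
  \<open>z\<^sup>2 g\<close> are dependent modulo the range, and injectivity forbids that
  \<open>z\<^sup>2 g\<close> drops out of the relation.\<close>

lemma Toep_index_neg2:
  assumes c: "Linf c" and c0: "AE \<theta> in cm. c (cis \<theta>) \<noteq> 0" and ind: "fredholm_index p (Toep c) (-2)"
  shows Toep_shift_inj: "f \<in> Hp p \<Longrightarrow> aeq (Toep (\<lambda>z. c z * inverse z ^ 2) f) (\<lambda>_. 0) \<Longrightarrow> aeq f (\<lambda>_. 0)"
    and Toep_shift_surj: "g \<in> Hp p \<Longrightarrow> \<exists>f\<in>Hp p. aeq (Toep (\<lambda>z. c z * inverse z ^ 2) f) g"
proof -
  let ?c = "\<lambda>z. c z * inverse z ^ 2"
  let ?R = "\<lambda>h. \<exists>f\<in>Hp p. aeq h (Toep c f)"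
  obtain m n where mn: "kerdim p (Toep c) m" "cokerdim p (Toep c) n" "- 2 = int m - int n"
    using ind by (auto simp: fredholm_index_def)
  obtain gs where gs: "length gs = n" "set gs \<subseteq> Hp p" "spanning c gs" "indep_mod ?R gs"
    using cokerdim_spanning[OF c mn(2)] by blast
  have m: "m = 0"
  proof (rule ccontr)
    assume "m \<noteq> 0"
    then obtain s where "s \<in> Hp p" "\<not> aeq s (\<lambda>_. 0)" "aeq (Toep c s) (\<lambda>_. 0)"
      using kerdim_nontrivial[OF mn(1)] by blast
    then have "n = 0" using coburn[OF c c0 _ _ _ gs(2,3)] by (intro surj_cokerdim_0[OF c mn(2)])
    then show False using mn(3) by simp
  qed
  then have n: "n = 2" using mn(3) by simp
  have inj: "aeq f (\<lambda>_. 0)" if "f \<in> Hp p" "aeq (Toep c f) (\<lambda>_. 0)" for f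
    using kerdim_0 mn(1) m that by blast
  have lc: "Linf ?c" by (rule Linf_shift2[OF c])
  have shift: "aeq (Toep ?c f) g \<longleftrightarrow> (\<forall>n\<ge>0. fc (\<lambda>z. c z * f z) (n + 2) = fc g n)" if "f \<in> Hp p" "g \<in> Hp p" for f g
    using Toep_aeq_iff[OF lc that] by (simp add: fc_shift2)
  have ker_low: "aeq (Toep c f) (\<lambda>z. fc (\<lambda>z. c z * f z) 0 + fc (\<lambda>z. c z * f z) 1 * z)"
    if f: "f \<in> Hp p" and z: "aeq (Toep ?c f) (\<lambda>_. 0)" for f
  proof -
    have hi: "fc (\<lambda>z. c z * f z) n = 0" if "2 \<le> n" for n
      using z that shift[OF f Hp_const[of 0]] by (auto dest: spec[of _ "n - 2"])
    show ?thesis unfolding Toep_aeq_iff[OF c f linear_polynomial_Hp] fc_linear_polynomial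
    proof (intro allI impI)
      fix n :: int assume "0 \<le> n"
      then have "n = 0 \<or> n = 1 \<or> 2 \<le> n" by linarith
      then show "fc (\<lambda>z. c z * f z) n = (if n = 0 then fc (\<lambda>z. c z * f z) 0 else if n = 1 then fc (\<lambda>z. c z * f z) 1 else 0)"
        using hi by auto
    qed
  qed
  show inj0: "aeq f (\<lambda>_. 0)" if f: "f \<in> Hp p" and z: "aeq (Toep ?c f) (\<lambda>_. 0)" for f
  proof (rule ccontr)
    assume nz: "\<not> aeq f (\<lambda>_. 0)"
    have c0': "AE \<theta> in cm. ?c (cis \<theta>) \<noteq> 0" using c0 by eventually_elim simp
    let ?S = "Toep (\<lambda>z. inverse z ^ 2)"
    have lS: "Linf (\<lambda>z. inverse z ^ 2)" by (intro Linf_power) auto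
    have fcS: "fc (?S g) k = (if 0 \<le> k then fc g (k + 2) else 0)" if "g \<in> Hp p" for g k
      using fc_Toep[OF lS that] fc_shift2[of "\<lambda>_. 1" g k] by simp
    have SH: "?S g \<in> Hp p" if "g \<in> Hp p" for g by (rule Toep_Hp[OF lS that])
    \<comment> \<open>Shifting backward by two maps \<open>Toep c F\<close> to
      \<open>Toep ?c F\<close>. It therefore carries a spanning family over to the shifted symbol,
      as Coburn's lemma requires.\<close>
    have "spanning ?c (map ?S gs)" unfolding spanning_def
    proof
      fix x assume x: "x \<in> Hp p"
      have xH: "(\<lambda>z. z ^ 2 * x z) \<in> Hp p" by (rule Hp_power_mult[OF x])
      then obtain F d where F: "represented c gs F d (\<lambda>z. z ^ 2 * x z)" using gs(3) by (auto simp: spanning_def)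
      then have FH: "F \<in> Hp p" by (simp add: represented_def)
      have gH: "gs ! i \<in> Hp p" if "i < length gs" for i using gs(2) that by auto
      have rH: "(\<lambda>z. Toep c F z + (\<Sum>i<length gs. d i * (gs ! i) z)) \<in> Hp p"
        using gH FH c by (intro Hp_add Toep_Hp Hp_sum Hp_cmult) auto
      have rH': "(\<lambda>z. Toep ?c F z + (\<Sum>i<length gs. d i * ?S (gs ! i) z)) \<in> Hp p"
        using gH FH by (intro Hp_add Toep_Hp[OF lc] Hp_sum Hp_cmult SH) auto
      have a1: "aeq x (\<lambda>z. Toep ?c F z + (\<Sum>i<length gs. d i * ?S (gs ! i) z))"
      proof (rule Hp_eqI[OF x rH'])
        fix k :: int assume k: "0 \<le> k"
        have "fc x k = fc (\<lambda>z. z ^ 2 * x z) (k + 2)" by (simp add: fc_square_mult)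
        also have "\<dots> = fc (\<lambda>z. Toep c F z + (\<Sum>i<length gs. d i * (gs ! i) z)) (k + 2)"
          by (rule fun_cong[OF fc_cong[OF F[unfolded represented_def, THEN conjunct2] Hp_meas[OF xH] Hp_meas[OF rH]]])
        also have "\<dots> = fc (Toep c F) (k + 2) + fc (\<lambda>z. \<Sum>i<length gs. d i * (gs ! i) z) (k + 2)"
          using gH FH c by (intro fc_add Hp_Lp1 Toep_Hp Hp_sum Hp_cmult) auto
        also have "fc (\<lambda>z. \<Sum>i<length gs. d i * (gs ! i) z) (k + 2) = (\<Sum>i<length gs. fc (\<lambda>z. d i * (gs ! i) z) (k + 2))"
          using gH by (intro fc_sum Hp_Lp1 Hp_cmult) auto
        also have "\<dots> = (\<Sum>i<length gs. fc (\<lambda>z. d i * ?S (gs ! i) z) k)"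
          using gH k by (intro sum.cong refl) (simp add: fc_cmult fcS)
        also have "\<dots> = fc (\<lambda>z. \<Sum>i<length gs. d i * ?S (gs ! i) z) k"
          using gH by (intro fc_sum[symmetric] Hp_Lp1 Hp_cmult SH) auto
        also have "fc (Toep c F) (k + 2) = fc (Toep ?c F) k"
          using k by (simp add: fc_Toep[OF c FH] fc_Toep[OF lc FH] fc_shift2)
        also have "fc (Toep ?c F) k + fc (\<lambda>z. \<Sum>i<length gs. d i * ?S (gs ! i) z) k
           = fc (\<lambda>z. Toep ?c F z + (\<Sum>i<length gs. d i * ?S (gs ! i) z)) k"
          using gH FH by (intro fc_add[symmetric] Hp_Lp1 Toep_Hp[OF lc] Hp_sum Hp_cmult SH) auto
        finally show "fc x k = fc (\<lambda>z. Toep ?c F z + (\<Sum>i<length gs. d i * ?S (gs ! i) z)) k" .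
      qed
      have e1: "(\<lambda>z. Toep ?c F z + (\<Sum>i<length gs. d i * ?S (gs ! i) z))
         = (\<lambda>z. Toep ?c F z + (\<Sum>i<length (map ?S gs). d i * (map ?S gs ! i) z))"
        by (simp add: fun_eq_iff)
      have "represented ?c (map ?S gs) F d x" unfolding represented_def e1[symmetric] using FH a1 by (rule conjI)
      then show "\<exists>F d. represented ?c (map ?S gs) F d x" by blast
    qed
    moreover have "set (map ?S gs) \<subseteq> Hp p" using gs(2) SH by auto
    ultimately have surj: "\<exists>F\<in>Hp p. aeq (Toep ?c F) g" if "g \<in> Hp p" for g
      using coburn[OF lc c0' f nz z _ _ that] by blast
    \<comment> \<open>Once all coefficients from index 2 on are matched, the only remaining
      obstruction is a linear polynomial.\<close>
    have low: "\<exists>F\<in>Hp p. \<exists>x y. \<forall>k\<ge>0. fc g k = fc (\<lambda>z. c z * F z) k + fc (\<lambda>z. x + y * z) k" if g: "g \<in> Hp p" for g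
    proof -
      obtain F where F: "F \<in> Hp p" "aeq (Toep ?c F) (?S g)" using surj[OF SH[OF g]] by blast
      have eq: "fc (\<lambda>z. c z * F z) (k + 2) = fc g (k + 2)" if "0 \<le> k" for k
        using F(2) that fcS[OF g] unfolding shift[OF F(1) SH[OF g]] by auto
      have "fc g k = fc (\<lambda>z. c z * F z) k + fc (\<lambda>z. (fc g 0 - fc (\<lambda>z. c z * F z) 0) + (fc g 1 - fc (\<lambda>z. c z * F z) 1) * z) k"
        if "0 \<le> k" for k
      proof -
        have "k = 0 \<or> k = 1 \<or> 2 \<le> k" using that by linarith
        then show ?thesis using eq[of "k - 2"] unfolding fc_linear_polynomial by auto
      qed
      then show ?thesis using F(1) by blast
    qed
    define \<alpha> where "\<alpha> = fc (\<lambda>z. c z * f z) 0"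
    define \<beta> where "\<beta> = fc (\<lambda>z. c z * f z) 1"
    have fl: "aeq (Toep c f) (\<lambda>z. \<alpha> + \<beta> * z)" unfolding \<alpha>_def \<beta>_def by (rule ker_low[OF f z])
    have ab: "\<alpha> \<noteq> 0 \<or> \<beta> \<noteq> 0" using fl inj[OF f] nz by auto
    have fk: "fc (\<lambda>z. c z * f z) k = fc (\<lambda>z. \<alpha> + \<beta> * z) k" if "0 \<le> k" for k
      using fl that unfolding Toep_aeq_iff[OF c f linear_polynomial_Hp] by blast
    have g01: "gs ! 0 \<in> Hp p" "gs ! 1 \<in> Hp p" using gs n by auto
    obtain F0 x0 y0 where F0: "F0 \<in> Hp p" "\<And>k. 0 \<le> k \<Longrightarrow> fc (gs ! 0) k = fc (\<lambda>z. c z * F0 z) k + fc (\<lambda>z. x0 + y0 * z) k"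
      using low[OF g01(1)] by blast
    obtain F1 x1 y1 where F1: "F1 \<in> Hp p" "\<And>k. 0 \<le> k \<Longrightarrow> fc (gs ! 1) k = fc (\<lambda>z. c z * F1 z) k + fc (\<lambda>z. x1 + y1 * z) k"
      using low[OF g01(2)] by blast
    have dep: "k0 = 0 \<and> k1 = 0" if kk: "k0 * x0 + k1 * x1 = t * \<alpha>" "k0 * y0 + k1 * y1 = t * \<beta>" for k0 k1 t
    proof -
      let ?G = "\<lambda>z. 1 * (k0 * F0 z + k1 * F1 z) + t * f z"
      have GH: "?G \<in> Hp p" using F0(1) F1(1) f by (intro Hp_add Hp_cmult)
      have LH: "(\<lambda>z. k0 * (gs ! 0) z + k1 * (gs ! 1) z) \<in> Hp p" using g01 by (intro Hp_add Hp_cmult)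
      have "aeq (Toep c ?G) (\<lambda>z. k0 * (gs ! 0) z + k1 * (gs ! 1) z)"
        unfolding Toep_aeq_iff[OF c GH LH]
      proof (intro allI impI)
        fix k :: int assume k: "0 \<le> k"
        have "fc (\<lambda>z. k0 * (gs ! 0) z + k1 * (gs ! 1) z) k = k0 * fc (gs ! 0) k + k1 * fc (gs ! 1) k"
          using g01 by (subst fc_add) (auto intro: Hp_Lp1 Hp_cmult simp: fc_cmult)
        also have "\<dots> = k0 * fc (\<lambda>z. c z * F0 z) k + k1 * fc (\<lambda>z. c z * F1 z) k + t * fc (\<lambda>z. c z * f z) k"
        proof -
          have "k0 * fc (\<lambda>z. x0 + y0 * z) k + k1 * fc (\<lambda>z. x1 + y1 * z) k = t * fc (\<lambda>z. \<alpha> + \<beta> * z) k"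
            using kk unfolding fc_linear_polynomial by auto
          then show ?thesis unfolding F0(2)[OF k] F1(2)[OF k] fk[OF k] by algebra
        qed
        also have "\<dots> = fc (\<lambda>z. c z * ?G z) k"
          using fc_symbol_lincomb[OF c Hp_add[OF Hp_cmult[OF F0(1)] Hp_cmult[OF F1(1)]] f, of 1 k0 k1 t k]
            fc_symbol_lincomb[OF c F0(1) F1(1), of k0 k1 k] by simp
        finally show "fc (\<lambda>z. c z * ?G z) k = fc (\<lambda>z. k0 * (gs ! 0) z + k1 * (gs ! 1) z) k" by simp
      qed
      moreover have "(\<Sum>i<length gs. (if i = 0 then k0 else k1) * (gs ! i) z) = k0 * (gs ! 0) z + k1 * (gs ! 1) z" for z
        using gs(1) n by (simp add: numeral_2_eq_2)
      ultimately have "?R (\<lambda>z. \<Sum>i<length gs. (if i = 0 then k0 else k1) * (gs ! i) z)"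
        using GH by (auto intro: aeq_sym)
      then have "\<forall>i<length gs. (if i = 0 then k0 else k1) = 0"
        using gs(4)[unfolded indep_mod_def, THEN spec[of _ "\<lambda>i. if i = 0 then k0 else k1"]] by blast
      then show ?thesis using gs(1) n by (auto dest: spec[of _ 0] spec[of _ 1])
    qed
    have par: "\<exists>t. x = t * \<alpha> \<and> y = t * \<beta>" if "\<beta> * x = \<alpha> * y" for x y
    proof (cases "\<alpha> = 0")
      case True
      then show ?thesis using ab that by (intro exI[of _ "y / \<beta>"]) auto
    next
      case False
      then show ?thesis using that by (intro exI[of _ "x / \<alpha>"]) (auto simp: field_simps)
    qed
    \<comment> \<open>Coordinates of \<open>(x0, y0)\<close> and \<open>(x1, y1)\<close> in the
      one-dimensional quotient by the line through \<open>(\<alpha>, \<beta>)\<close>. The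
      combination with weights \<open>?l1\<close> and \<open>- ?l0\<close> vanishes there, so
      \<open>dep\<close> makes both weights zero; but then \<open>gs ! 0\<close> alone is already
      dependent.\<close>
    let ?l0 = "\<beta> * x0 - \<alpha> * y0" and ?l1 = "\<beta> * x1 - \<alpha> * y1"
    have "?l1 = 0 \<and> - ?l0 = 0"
    proof -
      have "\<beta> * (?l1 * x0 + (- ?l0) * x1) = \<alpha> * (?l1 * y0 + (- ?l0) * y1)" by (simp add: algebra_simps)
      then obtain t where "?l1 * x0 + (- ?l0) * x1 = t * \<alpha>" "?l1 * y0 + (- ?l0) * y1 = t * \<beta>" using par by blast
      then show ?thesis by (rule dep)
    qed
    then have "\<beta> * x0 = \<alpha> * y0" by simp
    then obtain t where "x0 = t * \<alpha>" "y0 = t * \<beta>" using par by blast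
    then have "(1::complex) = 0 \<and> (0::complex) = 0" by (intro dep[of 1 0 t]) auto
    then show False by simp
  qed
  show "\<exists>f\<in>Hp p. aeq (Toep ?c f) g" if g: "g \<in> Hp p" for g
  proof -
    let ?x = "\<lambda>z. z ^ 2 * g z"
    have xH: "?x \<in> Hp p" by (rule Hp_power_mult[OF g])
    have zH: "(\<lambda>z. z) \<in> Hp p" using Hp_power[of 1] by simp
    let ?hs = "[\<lambda>_. 1, \<lambda>z. z, ?x]"
    have "\<not> indep_mod ?R ?hs"
      using mn(2) xH zH Hp_const[of 1] n unfolding cokerdim_def Let_def
      by (metis (no_types, lifting) insert_subset empty_subsetI list.set(1) list.set(2) list.size(3) list.size(4) numeral_2_eq_2 One_nat_def add.right_neutral add_Suc_right)
    then obtain k F i where k: "F \<in> Hp p" "aeq (\<lambda>z. \<Sum>i<length ?hs. k i * (?hs ! i) z) (Toep c F)"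
      "i < length ?hs" "k i \<noteq> 0"
      unfolding indep_mod_def by blast
    have eq: "(\<Sum>i<length ?hs. k i * (?hs ! i) z) = (k 0 + k 1 * z) + k 2 * ?x z" for z
      by (simp add: numeral_2_eq_2)
    have hH: "(\<lambda>z. (k 0 + k 1 * z) + k 2 * ?x z) \<in> Hp p" by (intro Hp_add linear_polynomial_Hp Hp_cmult xH)
    have T: "aeq (Toep c F) (\<lambda>z. (k 0 + k 1 * z) + k 2 * ?x z)" using k(2) unfolding eq by (rule aeq_sym)
    have fcF: "fc (\<lambda>z. c z * F z) j = fc (\<lambda>z. k 0 + k 1 * z) j + k 2 * fc g (j - 2)" if "0 \<le> j" for j
    proof -
      have "fc (\<lambda>z. c z * F z) j = fc (\<lambda>z. (k 0 + k 1 * z) + k 2 * ?x z) j"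
        using T that unfolding Toep_aeq_iff[OF c k(1) hH] by blast
      also have "\<dots> = fc (\<lambda>z. k 0 + k 1 * z) j + fc (\<lambda>z. k 2 * ?x z) j"
        by (intro fc_add Hp_Lp1 linear_polynomial_Hp Hp_cmult xH)
      finally show ?thesis by (simp add: fc_cmult fc_square_mult)
    qed
    have k2: "k 2 \<noteq> 0"
    proof
      assume 0: "k 2 = 0"
      have "aeq (Toep ?c F) (\<lambda>_. 0)" unfolding shift[OF k(1) Hp_const] using 0 by (auto simp: fcF fc_linear_polynomial)
      then have "aeq F (\<lambda>_. 0)" by (rule inj0[OF k(1)])
      then have "aeq (\<lambda>z. c z * F z) (\<lambda>z. c z * 0)" by (rule aeq_cmult)
      then have "fc (\<lambda>z. c z * F z) = fc (\<lambda>z. c z * 0)"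
        using Linf_meas[OF c] Hp_meas[OF k(1)] by (intro fc_cong) auto
      then have lp: "fc (\<lambda>z. k 0 + k 1 * z) j = 0" if "0 \<le> j" for j using fcF[OF that] 0 by simp
      have "k 0 = 0" "k 1 = 0"
        using lp[of 0] lp[of 1] unfolding fc_linear_polynomial by simp_all
      moreover have "i = 0 \<or> i = 1 \<or> i = 2" using k(3) by auto
      ultimately show False using k(4) 0 by auto
    qed
    have "aeq (Toep ?c (\<lambda>z. (1 / k 2) * F z)) g"
      unfolding shift[OF Hp_cmult[OF k(1)] g]
    proof (intro allI impI)
      fix j :: int assume j: "0 \<le> j"
      have "fc (\<lambda>z. c z * (1 / k 2 * F z)) (j + 2) = (1 / k 2) * fc (\<lambda>z. c z * F z) (j + 2)"
        using fc_cmult[of "1 / k 2" "\<lambda>z. c z * F z" "j + 2"] by (simp add: mult_ac)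
      also have "\<dots> = fc g j" using j k2 by (simp add: fcF fc_linear_polynomial)
      finally show "fc (\<lambda>z. c z * (1 / k 2 * F z)) (j + 2) = fc g j" .
    qed
    then show ?thesis using Hp_cmult[OF k(1)] by blast
  qed
qed

end

section \<open>Wiener--Hopf factorization\<close>

lemma aeqI_AE:
  assumes "AE \<theta> in cm. P (cis \<theta>)" "\<And>z. norm z = 1 \<Longrightarrow> P z \<Longrightarrow> f z = g z"
  shows "aeq f g"
  unfolding aeq_cm using assms(1) by eventually_elim (simp add: assms(2))

locale wiener_hopf = hardy +
  fixes q :: real and d dm dp :: cfun and m :: int
  assumes pq: "1/p + 1/q = 1"
    and d: "Linf d" and d_nz: "AE \<theta> in cm. d (cis \<theta>) \<noteq> 0"
    and fact: "aeq d (\<lambda>z. dm z * z powi m * dp z)"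
    and dp: "dp \<in> Hp q" and dpi: "(\<lambda>z. inverse (dp z)) \<in> Hp p"
    and dm: "dm \<in> Hbar p" and dmi: "(\<lambda>z. inverse (dm z)) \<in> Hbar q"
begin

lemma Hbar_tld: "f \<in> Hbar r \<Longrightarrow> tld f \<in> Hp r"
  by (rule HpI) (auto simp: Hbar_def Lp_tld fc_tld Lp_meas)

lemma Lp1_prod: "f \<in> Hp p \<Longrightarrow> g \<in> Hp q \<Longrightarrow> Lp 1 (\<lambda>z. f z * g z)"
  using Lp_mult[OF _ _ p pq] by (auto dest: HpD)

definition regular :: "complex \<Rightarrow> bool" where
  "regular z \<longleftrightarrow> dm z \<noteq> 0 \<and> dp z \<noteq> 0 \<and> d z = dm z * z powi m * dp z"

lemma regular_AE: "AE \<theta> in cm. regular (cis \<theta>)"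
  using d_nz fact unfolding aeq_cm regular_def by eventually_elim auto

text \<open>The product \<open>f * dp\<close> is analytic, and since \<open>d * f\<close> has only
  negative indices, dividing it by \<open>dm z\<^sup>m\<close> shows that \<open>f * dp\<close> is
  also \<open>z\<^sup>-\<^sup>m\<close> times a function with negative indices. Its coefficients
  thus live on \<open>0 \<le> n < - m\<close>.\<close>

lemma kernel_fc:
  assumes f: "f \<in> Hp p" and ker: "aeq (Toep d f) (\<lambda>_. 0)"
  shows "n < 0 \<Longrightarrow> fc (\<lambda>z. f z * dp z) n = 0" "- m \<le> n \<Longrightarrow> fc (\<lambda>z. f z * dp z) n = 0"
proof -
  show "n < 0 \<Longrightarrow> fc (\<lambda>z. f z * dp z) n = 0" by (rule fc_Hp_mult(1)[OF f dp pq])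
  define k where "k z = d z * f z" for z
  have Lk: "Lp p k" unfolding k_def by (rule Lp_symbol[OF d f])
  have k0: "fc k n = 0" if "0 \<le> n" for n
    using ker that unfolding Toep_aeq_iff[OF d f Hp_const] k_def by simp
  have kt: "tld k \<in> Hp p"
    using k0 by (intro HpI Lp_tld Lk) (simp add: fc_tld Lp_meas[OF Lk])
  define g where "g z = inverse (dm z)" for z
  have g: "tld g \<in> Hp q" unfolding g_def[abs_def] by (rule Hbar_tld[OF dmi])
  have "fc (tld k) 0 = 0" using k0[of 0] by (simp add: fc_tld Lp_meas[OF Lk])
  then have P: "fc (\<lambda>z. tld k z * tld g z) n = 0" if "n \<le> 0" for n
    using fc_Hp_mult[OF kt g pq] that by (cases "n = 0") auto
  have mk: "meas (\<lambda>z. k z * g z)"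
    by (rule meas_mult[OF Lp_meas[OF Lk] meas_tld[OF Hp_meas[OF g], unfolded tld_tld]])
  have Q: "fc (\<lambda>z. k z * g z) n = 0" if "0 \<le> n" for n
    using P[of "- n"] that fc_tld[OF mk, of "- n"] by (simp add: tld_def)
  have "aeq (\<lambda>z. f z * dp z) (\<lambda>z. z powi (- m) * (k z * g z))"
  proof (rule aeqI_AE[OF regular_AE])
    fix z :: complex assume z: "norm z = 1" "regular z"
    then have "z \<noteq> 0" by auto
    then show "f z * dp z = z powi (- m) * (k z * g z)"
      using z(2) by (simp add: regular_def k_def g_def power_int_minus field_simps)
  qed
  moreover have "meas (\<lambda>z. f z * dp z)" by (intro meas_mult Hp_meas[OF f] Hp_meas[OF dp])
  moreover have "meas (\<lambda>z. z powi (- m) * (k z * g z))" by (rule meas_mult[OF meas_powi mk])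
  ultimately have "fc (\<lambda>z. f z * dp z) = fc (\<lambda>z. z powi (- m) * (k z * g z))" by (rule fc_cong)
  then show "- m \<le> n \<Longrightarrow> fc (\<lambda>z. f z * dp z) n = 0" by (simp add: fc_powi_mult Q)
qed

lemma kernel_zero:
  assumes f: "f \<in> Hp p" and z: "\<And>n. fc (\<lambda>z. f z * dp z) n = 0" shows "aeq f (\<lambda>_. 0)"
proof -
  have "aeq (\<lambda>z. f z * dp z) (\<lambda>_. 0)" using z by (intro fourier_unique_zero Lp1_prod[OF f dp])
  then show ?thesis using regular_AE unfolding aeq_cm regular_def by eventually_elim auto
qed

text \<open>Multiplication by \<open>d\<close> cancels \<open>dp\<close> and leaves
  \<open>z powi (m + int k) * dm z\<close>, all of whose indices are negative.\<close>

lemma kernel_element: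
  assumes "m + int k < 0"
  shows "(\<lambda>z. z ^ k * inverse (dp z)) \<in> Hp p" "aeq (Toep d (\<lambda>z. z ^ k * inverse (dp z))) (\<lambda>_. 0)"
proof -
  show H: "(\<lambda>z. z ^ k * inverse (dp z)) \<in> Hp p" by (rule Hp_power_mult[OF dpi])
  have Ldm: "Lp p dm" using dm by (simp add: Hbar_def)
  have "aeq (\<lambda>z. d z * (z ^ k * inverse (dp z))) (\<lambda>z. z powi (m + int k) * dm z)"
  proof (rule aeqI_AE[OF regular_AE])
    fix z :: complex assume z: "norm z = 1" "regular z"
    then have "z \<noteq> 0" by auto
    then show "d z * (z ^ k * inverse (dp z)) = z powi (m + int k) * dm z"
      using z(2) by (simp add: regular_def power_int_add field_simps)
  qed
  moreover have "meas (\<lambda>z. d z * (z ^ k * inverse (dp z)))" using Linf_meas[OF d] Hp_meas[OF H] by (rule meas_mult)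
  moreover have "meas (\<lambda>z. z powi (m + int k) * dm z)" by (intro meas_mult meas_powi Lp_meas[OF Ldm])
  ultimately have "fc (\<lambda>z. d z * (z ^ k * inverse (dp z))) = fc (\<lambda>z. z powi (m + int k) * dm z)" by (rule fc_cong)
  then show "aeq (Toep d (\<lambda>z. z ^ k * inverse (dp z))) (\<lambda>_. 0)"
    unfolding Toep_aeq_iff[OF d H Hp_const] using dm assms by (auto simp: fc_powi_mult Hbar_def)
qed

text \<open>The kernel of \<open>Toep d\<close> consists of the polynomials of degree below
  \<open>- m\<close> divided by \<open>dp\<close>. This ties the exponent of the given factorization
  to the index.\<close>

lemma kerdim_2_index:
  assumes "kerdim p (Toep d) 2" shows "m = - 2"
proof -
  obtain fs where fs: "length fs = 2" "set fs \<subseteq> {f\<in>Hp p. aeq (Toep d f) (\<lambda>_. 0)}" "indep_mod (\<lambda>h. aeq h (\<lambda>_. 0)) fs"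
    and max: "\<And>hs. length hs = Suc 2 \<Longrightarrow> set hs \<subseteq> {f\<in>Hp p. aeq (Toep d f) (\<lambda>_. 0)} \<Longrightarrow> \<not> indep_mod (\<lambda>h. aeq h (\<lambda>_. 0)) hs"
    using assms unfolding kerdim_def by blast
  have le: "- m \<le> 2"
  proof (rule ccontr)
    assume "\<not> ?thesis"
    then have ke: "m + int 0 < 0" "m + int 1 < 0" "m + int 2 < 0" by auto
    let ?hs = "map (\<lambda>k z. z ^ k * inverse (dp z)) [0, 1, 2]"
    have "\<not> indep_mod (\<lambda>h. aeq h (\<lambda>_. 0)) ?hs"
      using kernel_element[OF ke(1)] kernel_element[OF ke(2)] kernel_element[OF ke(3)] by (intro max) auto
    then obtain k i where k: "aeq (\<lambda>z. \<Sum>i<length ?hs. k i * (?hs ! i) z) (\<lambda>_. 0)" "i < length ?hs" "k i \<noteq> 0"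
      unfolding indep_mod_def by blast
    have eq: "(\<Sum>i<length ?hs. k i * (?hs ! i) z) = (k 0 + k 1 * z + k 2 * z ^ 2) * inverse (dp z)" for z
      by (simp add: numeral_3_eq_3 numeral_2_eq_2 algebra_simps)
    have "aeq (\<lambda>z. (k 0 + k 1 * z) + k 2 * z ^ 2) (\<lambda>_. 0)"
      using k(1) regular_AE unfolding eq aeq_cm regular_def by eventually_elim auto
    then have "fc (\<lambda>z. (k 0 + k 1 * z) + k 2 * z ^ 2) = fc (\<lambda>_. 0)"
      by (intro fc_cong Hp_meas[OF Hp_add[OF linear_polynomial_Hp Hp_cmult[OF Hp_power]]]) auto
    moreover have "fc (\<lambda>z. (k 0 + k 1 * z) + k 2 * z ^ 2) j = fc (\<lambda>z. k 0 + k 1 * z) j + k 2 * fc (\<lambda>z. z powi 2) j" for j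
      using fc_add[OF Hp_Lp1[OF linear_polynomial_Hp] Hp_Lp1[OF Hp_cmult[OF Hp_power]]] by (simp add: fc_cmult)
    ultimately have z: "fc (\<lambda>z. k 0 + k 1 * z) j + k 2 * fc (\<lambda>z. z powi 2) j = 0" for j by (metis fc_zero)
    have "k 0 = 0" "k 1 = 0" "k 2 = 0"
      using z[of 0] z[of 1] z[of 2] unfolding fc_linear_polynomial fc_powi by simp_all
    moreover have "i = 0 \<or> i = 1 \<or> i = 2" using k(2) by auto
    ultimately show False using k(3) by auto
  qed
  have ge: "\<not> - m \<le> 1"
  proof
    assume m1: "- m \<le> 1"
    have f01: "fs ! 0 \<in> Hp p" "aeq (Toep d (fs ! 0)) (\<lambda>_. 0)" "fs ! 1 \<in> Hp p" "aeq (Toep d (fs ! 1)) (\<lambda>_. 0)"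
    proof -
      have "fs ! 0 \<in> set fs" "fs ! 1 \<in> set fs" using fs(1) by auto
      then show "fs ! 0 \<in> Hp p" "aeq (Toep d (fs ! 0)) (\<lambda>_. 0)" "fs ! 1 \<in> Hp p" "aeq (Toep d (fs ! 1)) (\<lambda>_. 0)"
        using fs(2) by auto
    qed
    have const: "fc (\<lambda>z. f z * dp z) n = 0" if "f \<in> Hp p" "aeq (Toep d f) (\<lambda>_. 0)" "n \<noteq> 0" for f n
      using kernel_fc[OF that(1,2), of n] that(3) m1 by (cases "n < 0") auto
    have dep: "k0 = 0 \<and> k1 = 0" if "aeq (\<lambda>z. k0 * (fs ! 0) z + k1 * (fs ! 1) z) (\<lambda>_. 0)" for k0 k1
    proof -
      have "(\<Sum>i<length fs. (if i = 0 then k0 else k1) * (fs ! i) z) = k0 * (fs ! 0) z + k1 * (fs ! 1) z" for z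
        using fs(1) by (simp add: numeral_2_eq_2)
      then have "aeq (\<lambda>z. \<Sum>i<length fs. (if i = 0 then k0 else k1) * (fs ! i) z) (\<lambda>_. 0)" using that by simp
      then have "\<forall>i<length fs. (if i = 0 then k0 else k1) = 0"
        using fs(3)[unfolded indep_mod_def, THEN spec[of _ "\<lambda>i. if i = 0 then k0 else k1"]] by blast
      then show ?thesis using fs(1) by (auto dest: spec[of _ 0] spec[of _ 1])
    qed
    \<comment> \<open>When \<open>- m \<le> 1\<close>, each kernel element times \<open>dp\<close>
      is a constant. Weighting the two elements with each other's constants produces a function that
      vanishes.\<close>
    define x0 where "x0 = fc (\<lambda>z. (fs ! 0) z * dp z) 0"
    define x1 where "x1 = fc (\<lambda>z. (fs ! 1) z * dp z) 0"
    let ?g = "\<lambda>z. x1 * (fs ! 0) z + (- x0) * (fs ! 1) z"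
    have "aeq ?g (\<lambda>_. 0)"
    proof (rule kernel_zero)
      show "?g \<in> Hp p" using f01 by (intro Hp_add Hp_cmult)
      fix n
      have "fc (\<lambda>z. ?g z * dp z) n = fc (\<lambda>z. x1 * ((fs ! 0) z * dp z) + (- x0) * ((fs ! 1) z * dp z)) n"
        by (simp add: algebra_simps)
      also have "\<dots> = x1 * fc (\<lambda>z. (fs ! 0) z * dp z) n + (- x0) * fc (\<lambda>z. (fs ! 1) z * dp z) n"
        using fc_add[OF Lp_cmult[OF Lp1_prod[OF f01(1) dp]] Lp_cmult[OF Lp1_prod[OF f01(3) dp]], of x1 "- x0" n]
        by (simp only: fc_cmult)
      also have "\<dots> = 0" using const[OF f01(1,2)] const[OF f01(3,4)] by (cases "n = 0") (auto simp: x0_def x1_def)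
      finally show "fc (\<lambda>z. ?g z * dp z) n = 0" .
    qed
    then have "x0 = 0" using dep by fastforce
    then have "fc (\<lambda>z. (fs ! 0) z * dp z) n = 0" for n using const[OF f01(1,2), of n] by (cases "n = 0") (auto simp: x0_def)
    then have "aeq (fs ! 0) (\<lambda>_. 0)" by (rule kernel_zero[OF f01(1)])
    then show False using dep[of 1 0] by simp
  qed
  show ?thesis using le ge by simp
qed

end

text \<open>The two products \<open>tld dm * dp\<close> and \<open>dm * tld dp\<close> are inverse to each other; the first is analytic and
  the inverse of the second is antianalytic, so both are constant.\<close>
locale wiener_hopf_index2 = wiener_hopf +
  assumes m: "m = - 2" and dd: "AE \<theta> in cm. d (cis \<theta>) * tld d (cis \<theta>) = 1" and norm: "fc dm 0 = 1"
begin

lemma regular_eq: "regular z \<Longrightarrow> d z = dm z * inverse z ^ 2 * dp z"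
  unfolding regular_def by (simp add: m power_int_minus power_inverse)

abbreviation \<sigma> :: complex where "\<sigma> \<equiv> fc dp 0"

lemma factor_relation: "AE \<theta> in cm. dm (cis \<theta>) * tld dp (cis \<theta>) = \<sigma>" and sigma_square: "\<sigma> * \<sigma> = 1"
proof -
  have Ldm: "meas dm" using dm by (auto simp: Hbar_def dest: Lp_meas)
  have dmt: "tld dm \<in> Hp p" by (rule Hbar_tld[OF dm])
  define g where "g z = inverse (dm z)" for z
  have g: "tld g \<in> Hp q" unfolding g_def[abs_def] by (rule Hbar_tld[OF dmi])
  define G where "G z = tld dm z * dp z" for z
  define H where "H z = inverse (dp z) * tld g z" for z
  have LG: "Lp 1 G" unfolding G_def by (rule Lp1_prod[OF dmt dp])
  have LH: "Lp 1 H" unfolding H_def by (rule Lp1_prod[OF dpi g])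
  have rel: "AE \<theta> in cm. G (cis \<theta>) * G (inverse (cis \<theta>)) = 1 \<and> G (cis \<theta>) = tld H (cis \<theta>)"
    using regular_AE AE_reflect[of regular, OF regular_AE] dd
  proof eventually_elim
    case (elim \<theta>)
    define z where "z = cis \<theta>"
    have z0: "z \<noteq> 0" by (simp add: z_def)
    note e = elim[folded z_def]
    have "dm z * inverse z ^ 2 * dp z * (dm (inverse z) * z ^ 2 * dp (inverse z)) = 1"
      using e(3) regular_eq[OF e(1)] regular_eq[OF e(2)] by (simp add: tld_def)
    then have "G z * G (inverse z) = 1"
      using z0 by (simp add: G_def tld_def field_simps)
    moreover have "G z = tld H z"
      using \<open>G z * G (inverse z) = 1\<close> e unfolding G_def H_def tld_def g_def regular_def by (simp add: field_simps)
    ultimately show ?case unfolding z_def by simp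
  qed
  have "aeq G (tld H)" using rel unfolding aeq_cm by eventually_elim simp
  then have GH: "fc G = fc (tld H)" using LG LH by (intro fc_cong meas_tld) (auto dest: Lp_meas)
  \<comment> \<open>The normalization \<open>fc dm 0 = 1\<close> turns the constant into the zeroth
    coefficient of \<open>dp\<close>, the factorization signature; its square is 1 because
    \<open>G z * G (inverse z) = 1\<close>.\<close>
  have G0: "fc G 0 = \<sigma>" unfolding G_def
    using fc_Hp_mult(2)[OF dmt dp pq] norm by (simp add: fc_tld Ldm)
  have "fc G n = fc (\<lambda>_. \<sigma>) n" for n
  proof (cases "n = 0")
    case False
    have "fc G n = 0"
    proof (cases "n < 0")
      case True then show ?thesis unfolding G_def by (rule fc_Hp_mult(1)[OF dmt dp pq])
    next
      case nn: False
      have "fc H (- n) = 0" unfolding H_def by (rule fc_Hp_mult(1)[OF dpi g pq]) (use False nn in auto)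
      then show ?thesis using GH fc_tld[OF Lp_meas[OF LH]] by simp
    qed
    then show ?thesis using False by (simp add: fc_const)
  qed (simp add: G0 fc_const)
  then have "aeq G (\<lambda>_. \<sigma>)" by (intro fourier_unique LG Lp_const) auto
  then have Gs: "AE \<theta> in cm. G (cis \<theta>) = \<sigma>" by (simp add: aeq_cm)
  have Gs': "AE \<theta> in cm. G (inverse (cis \<theta>)) = \<sigma>" by (rule AE_reflect[of "\<lambda>z. G z = \<sigma>", OF Gs])
  then show "AE \<theta> in cm. dm (cis \<theta>) * tld dp (cis \<theta>) = \<sigma>"
    by eventually_elim (simp add: G_def tld_def)
  have "aeq (\<lambda>_. \<sigma> * \<sigma>) (\<lambda>_. 1)" unfolding aeq_cm using rel Gs Gs' by eventually_elim metis
  then have "fc (\<lambda>_. \<sigma> * \<sigma>) = fc (\<lambda>_. 1)" by (rule fc_cong) auto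
  then have "fc (\<lambda>_. \<sigma> * \<sigma>) 0 = fc (\<lambda>_. 1) 0" by simp
  then show "\<sigma> * \<sigma> = 1" by (simp add: fc_const)
qed

definition hp :: cfun where "hp = (\<lambda>z. inverse (dp z) * (1 + \<sigma> * z))"

definition regular2 :: "complex \<Rightarrow> bool" where
  "regular2 z \<longleftrightarrow> dp z \<noteq> 0 \<and> dp (inverse z) \<noteq> 0 \<and> d z = \<sigma> * inverse (dp (inverse z)) * inverse z ^ 2 * dp z"

lemma regular2_AE: "AE \<theta> in cm. regular2 (cis \<theta>)"
  using regular_AE AE_reflect[of regular, OF regular_AE] factor_relation
proof eventually_elim
  case (elim \<theta>)
  define z where "z = cis \<theta>"
  note e = elim[folded z_def]
  have "dm z = \<sigma> * inverse (dp (inverse z))" using e by (auto simp: regular_def tld_def field_simps)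
  moreover have "d z = dm z * inverse z ^ 2 * dp z" by (rule regular_eq[OF e(1)])
  ultimately have "regular2 z" using e unfolding regular2_def regular_def by metis
  then show ?case unfolding z_def .
qed

lemma hp_Hp: "hp \<in> Hp p"
proof -
  have "(\<lambda>z. inverse (dp z) + \<sigma> * (z * inverse (dp z))) \<in> Hp p"
    by (intro Hp_add Hp_cmult Hp_ident_mult dpi)
  then show ?thesis by (simp add: hp_def algebra_simps)
qed

text \<open>Since \<open>\<sigma> * \<sigma> = 1\<close>, one has
  \<open>\<sigma> * (1 + \<sigma> * z) = z * (1 + \<sigma> / z)\<close>: the linear factor is
  self-reciprocal up to the very sign that occurs in the factorization of \<open>d\<close>.\<close>

lemma hp_eq: "aeq (\<lambda>z. d z * hp z) (Jop hp)"
proof (rule aeqI_AE[OF regular2_AE])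
  fix z :: complex assume z: "norm z = 1" "regular2 z"
  then have z0: "z \<noteq> 0" by auto
  have "\<sigma> * (1 + \<sigma> * z) = z * (1 + \<sigma> * inverse z)"
    using sigma_square z0 by (simp add: algebra_simps mult.assoc[symmetric])
  then have "inverse (dp (inverse z)) * inverse z ^ 2 * (\<sigma> * (1 + \<sigma> * z)) = inverse (dp (inverse z)) * inverse z ^ 2 * (z * (1 + \<sigma> * inverse z))"
    by simp
  moreover have "d z * hp z = inverse (dp (inverse z)) * inverse z ^ 2 * (\<sigma> * (1 + \<sigma> * z))"
    using z(2) by (simp add: regular2_def hp_def)
  moreover have "Jop hp z = inverse (dp (inverse z)) * inverse z ^ 2 * (z * (1 + \<sigma> * inverse z))"
    using z0 by (simp add: Jop_def hp_def power2_eq_square)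
  ultimately show "d z * hp z = Jop hp z" by simp
qed

text \<open>Such an \<open>x\<close> lies in the kernel of \<open>Toep d\<close>, so
  \<open>x * dp\<close> is a linear polynomial \<open>\<alpha> + \<beta> * z\<close>. The flip
  exchanges the two coefficients up to the factor \<open>\<sigma>\<close>, which leaves the single
  condition \<open>\<beta> = \<sigma> * \<alpha>\<close>.\<close>

lemma hp_unique:
  assumes x: "x \<in> Hp p" and eq: "aeq (\<lambda>z. d z * x z) (Jop x)"
  obtains \<gamma> where "aeq x (\<lambda>z. \<gamma> * hp z)"
proof -
  have md: "meas (\<lambda>z. d z * x z)" using Linf_meas[OF d] Hp_meas[OF x] by (rule meas_mult)
  have fcx: "fc (\<lambda>z. d z * x z) = fc (Jop x)" using eq md meas_Jop[OF Hp_meas[OF x]] by (rule fc_cong)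
  have ker: "aeq (Toep d x) (\<lambda>_. 0)"
    unfolding Toep_aeq_iff[OF d x Hp_const] fcx by (auto simp: fc_Jop_Hp[OF x])
  define \<alpha> where "\<alpha> = fc (\<lambda>z. x z * dp z) 0"
  define \<beta> where "\<beta> = fc (\<lambda>z. x z * dp z) 1"
  have "aeq (\<lambda>z. x z * dp z) (\<lambda>z. \<alpha> + \<beta> * z)"
  proof (rule fourier_unique)
    show "Lp 1 (\<lambda>z. x z * dp z)" by (rule Lp1_prod[OF x dp])
    show "Lp 1 (\<lambda>z. \<alpha> + \<beta> * z)" by (rule Hp_Lp1[OF linear_polynomial_Hp])
    fix n :: int
    have "n < 0 \<or> n = 0 \<or> n = 1 \<or> 2 \<le> n" by linarith
    then show "fc (\<lambda>z. x z * dp z) n = fc (\<lambda>z. \<alpha> + \<beta> * z) n"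
      unfolding fc_linear_polynomial using kernel_fc[OF x ker, of n] by (auto simp: m \<alpha>_def \<beta>_def)
  qed
  then have l: "AE \<theta> in cm. x (cis \<theta>) * dp (cis \<theta>) = \<alpha> + \<beta> * cis \<theta>" by (simp add: aeq_cm)
  have l': "AE \<theta> in cm. x (inverse (cis \<theta>)) * dp (inverse (cis \<theta>)) = \<alpha> + \<beta> * inverse (cis \<theta>)"
    by (rule AE_reflect[of "\<lambda>z. x z * dp z = \<alpha> + \<beta> * z", OF l])
  \<comment> \<open>The values of \<open>1 / dp\<close> at \<open>z\<close> and at
    \<open>inverse z\<close> are treated as independent unknowns, so their cancellation and the
    clearing of powers of \<open>z\<close> become two separate polynomial identities.\<close>
  have cancel: "s * t * u = v * w" if "s * X * t * Y * (u * iY) = v * (w * X)" "Y * iY = 1" "X \<noteq> 0"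
    for s t u v w X Y iY :: complex
  proof -
    have "X * (s * t * u) = X * (v * w)" using that(1,2) by algebra
    then show ?thesis using that(3) by simp
  qed
  have clear: "s * u + s * v * z = v + u * z" if "s * i ^ 2 * (u + v * z) = i * (u + v * i)" "z * i = 1"
    for s u v z i :: complex
    using that by algebra
  have "aeq (\<lambda>z. \<sigma> * \<alpha> + \<sigma> * \<beta> * z) (\<lambda>z. \<beta> + \<alpha> * z)"
    using l l' regular2_AE eq unfolding aeq_cm
  proof eventually_elim
    case (elim \<theta>)
    define z where "z = cis \<theta>"
    note e = elim[folded z_def]
    have z0: "z \<noteq> 0" by (simp add: z_def)
    have nz: "dp z \<noteq> 0" "dp (inverse z) \<noteq> 0" using e(3) by (auto simp: regular2_def)
    have x1: "x z = (\<alpha> + \<beta> * z) * inverse (dp z)" using e(1) nz by (simp add: field_simps)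
    have x2: "x (inverse z) = (\<alpha> + \<beta> * inverse z) * inverse (dp (inverse z))" using e(2) nz by (simp add: field_simps)
    have "\<sigma> * inverse (dp (inverse z)) * inverse z ^ 2 * dp z * ((\<alpha> + \<beta> * z) * inverse (dp z))
       = inverse z * ((\<alpha> + \<beta> * inverse z) * inverse (dp (inverse z)))"
      using e(3,4) unfolding regular2_def Jop_def x1 x2 by metis
    then have "\<sigma> * inverse z ^ 2 * (\<alpha> + \<beta> * z) = inverse z * (\<alpha> + \<beta> * inverse z)"
      by (rule cancel) (use nz in auto)
    then have "\<sigma> * \<alpha> + \<sigma> * \<beta> * z = \<beta> + \<alpha> * z" by (rule clear) (use z0 in simp)
    then show ?case unfolding z_def .
  qed
  then have "fc (\<lambda>z. \<sigma> * \<alpha> + \<sigma> * \<beta> * z) = fc (\<lambda>z. \<beta> + \<alpha> * z)"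
    by (intro fc_cong Hp_meas[OF linear_polynomial_Hp])
  then have "fc (\<lambda>z. \<sigma> * \<alpha> + \<sigma> * \<beta> * z) 0 = fc (\<lambda>z. \<beta> + \<alpha> * z) 0" by simp
  then have b: "\<beta> = \<sigma> * \<alpha>" unfolding fc_linear_polynomial by simp
  have "aeq x (\<lambda>z. \<alpha> * hp z)"
    using l regular2_AE unfolding aeq_cm
  proof eventually_elim
    case (elim \<theta>)
    define z where "z = cis \<theta>"
    note e = elim[folded z_def]
    have "dp z \<noteq> 0" using e(2) by (simp add: regular2_def)
    then have "x z = \<alpha> * hp z" using e(1) unfolding b hp_def by (simp add: field_simps)
    then show ?case unfolding z_def .
  qed
  then show thesis by (rule that)
qed

end

section \<open>Matching pairs\<close>

lemma Linf_cong: assumes "Linf f" "aeq f g" "meas g" shows "Linf g"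
proof -
  obtain C where C: "AE \<theta> in cm. norm (f (cis \<theta>)) \<le> C" using assms(1) by (rule Linf_E)
  have "AE \<theta> in cm. norm (g (cis \<theta>)) \<le> C" using C assms(2) unfolding aeq_cm by eventually_elim simp
  then show ?thesis using assms(3) by (auto simp: Linf_cm)
qed

text \<open>Invertibility is assumed of \<open>a\<close> alone. The matching identity recovers
  \<open>1 / b\<close> as \<open>tld b\<close> divided by \<open>a * tld a\<close>, which is
  bounded; this makes the quotients \<open>c\<close> and \<open>d\<close> bounded symbols.\<close>

lemma matching_pair_inverses:
  assumes "matching_pair a b"
  shows "Linf a" "Linf (\<lambda>z. inverse (a z))" "Linf b" "Linf (\<lambda>z. inverse (b z))"
    "AE \<theta> in cm. a (cis \<theta>) \<noteq> 0 \<and> b (cis \<theta>) \<noteq> 0 \<and> a (cis \<theta>) * tld a (cis \<theta>) = b (cis \<theta>) * tld b (cis \<theta>)"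
proof -
  obtain a' where a': "Linf a'" "aeq (\<lambda>z. a z * a' z) (\<lambda>_. 1)" using assms by (auto simp: matching_pair_def GLinf_def)
  show a: "Linf a" and b: "Linf b" using assms by (auto simp: matching_pair_def GLinf_def)
  have match: "AE \<theta> in cm. a (cis \<theta>) * tld a (cis \<theta>) = b (cis \<theta>) * tld b (cis \<theta>)"
    using assms by (simp add: matching_pair_def aeq_cm)
  have az: "AE \<theta> in cm. a (cis \<theta>) * a' (cis \<theta>) = 1" using a'(2) by (simp add: aeq_cm)
  have azr: "AE \<theta> in cm. tld a (cis \<theta>) * tld a' (cis \<theta>) = 1"
    using AE_reflect[of "\<lambda>z. a z * a' z = 1", OF az] by (simp add: tld_def)
  have nonzero: "x \<noteq> 0 \<and> y \<noteq> 0 \<and> x * x' = y * y'" if "x * x' = y * y'" "x * u = 1" "x' * v = 1"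
    for x x' y y' u v :: complex
    using that by auto
  show nz: "AE \<theta> in cm. a (cis \<theta>) \<noteq> 0 \<and> b (cis \<theta>) \<noteq> 0 \<and> a (cis \<theta>) * tld a (cis \<theta>) = b (cis \<theta>) * tld b (cis \<theta>)"
    using match az azr by eventually_elim (rule nonzero)
  have "aeq a' (\<lambda>z. inverse (a z))" using az unfolding aeq_cm by eventually_elim (metis inverse_unique)
  then show "Linf (\<lambda>z. inverse (a z))" by (rule Linf_cong[OF a'(1) _ meas_inverse[OF Linf_meas[OF a]]])
  have inv: "x * u * v = inverse y" if "a1 * a2 = y * x" "a1 * u = 1" "a2 * v = 1" for a1 a2 x y u v :: complex
  proof -
    have "y * (x * u * v) = 1" using that by algebra
    then show ?thesis by (metis inverse_unique)
  qed
  have "aeq (\<lambda>z. tld b z * a' z * tld a' z) (\<lambda>z. inverse (b z))"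
    using match az azr unfolding aeq_cm by eventually_elim (rule inv)
  then show "Linf (\<lambda>z. inverse (b z))"
    by (rule Linf_cong[OF Linf_mult[OF Linf_mult[OF Linf_tld[OF b] a'(1)] Linf_tld[OF a'(1)]] _ meas_inverse[OF Linf_meas[OF b]]])
qed

locale matching = hardy +
  fixes a b :: cfun
  assumes mp: "matching_pair a b"
begin

text \<open>Collects, at \<open>z\<close> and \<open>inverse z\<close> at once, everything that the
  algebra divides by. Identities involving the flip then become field identities in the values at
  the two points.\<close>

definition good :: "complex \<Rightarrow> bool" where
  "good z \<longleftrightarrow> z \<noteq> 0 \<and> a z \<noteq> 0 \<and> b z \<noteq> 0 \<and> a (inverse z) \<noteq> 0 \<and> b (inverse z) \<noteq> 0
     \<and> a z * a (inverse z) = b z * b (inverse z)"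

lemma good_AE: "AE \<theta> in cm. good (cis \<theta>)"
  using matching_pair_inverses(5)[OF mp]
    AE_reflect[of "\<lambda>z. a z \<noteq> 0 \<and> b z \<noteq> 0 \<and> a z * tld a z = b z * tld b z", OF matching_pair_inverses(5)[OF mp]]
  unfolding good_def tld_def by eventually_elim simp

lemma aeq_good1: "aeq f g \<Longrightarrow> (\<And>z. good z \<Longrightarrow> f z = g z \<Longrightarrow> f' z = g' z) \<Longrightarrow> aeq f' g'"
  using good_AE unfolding aeq_cm by (auto elim!: AE_mp)

lemma aeq_good: "(\<And>z. good z \<Longrightarrow> f' z = g' z) \<Longrightarrow> aeq f' g'"
  by (rule aeq_good1[of f' f']) auto

abbreviation c where "c \<equiv> sub_c a b"
abbreviation d where "d \<equiv> sub_d a b"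
abbreviation c0 where "c0 \<equiv> \<lambda>z. c z * inverse z ^ 2"
abbreviation e where "e \<equiv> \<lambda>z. inverse (tld a z) * inverse z"

lemma Linf_a: "Linf a" and Linf_b: "Linf b" and Linf_ai: "Linf (\<lambda>z. inverse (a z))"
  using matching_pair_inverses[OF mp] by auto

lemma Linf_c: "Linf c"
  using Linf_mult[OF Linf_a matching_pair_inverses(4)[OF mp]] by (simp add: sub_c_def divide_inverse)

lemma Linf_d: "Linf d"
  using Linf_mult[OF Linf_a Linf_tld[OF matching_pair_inverses(4)[OF mp]]] by (simp add: sub_d_def divide_inverse tld_def)

lemma Linf_e: "Linf e"
  using Linf_mult[OF Linf_tld[OF Linf_ai] Linf_inverse_ident] by (simp add: tld_def)

lemma Linf_c0: "Linf c0" by (rule Linf_shift2[OF Linf_c])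

text \<open>With \<open>J\<close> the flip, \<open>blend y\<close> is \<open>(a + b J) (y / z)\<close>; the matching condition makes \<open>a + b J\<close> a zero divisor,
  which is what relates it to \<open>c\<close> and \<open>d\<close>.\<close>
definition blend :: "cfun \<Rightarrow> cfun" where
  "blend y = (\<lambda>z. a z * (inverse z * y z) + b z * (z * Jop y z))"

lemma Lp_blend: assumes "y \<in> Hp p" shows "Lp p (blend y)"
proof -
  have "Lp p (\<lambda>z. inverse z * y z)" "Lp p (\<lambda>z. z * Jop y z)" using assms by (auto intro: Lp_symbol Lp_symbol_J)
  from Lp_add[OF Lp_mult_Linf[OF Linf_a this(1)] Lp_mult_Linf[OF Linf_b this(2)]]
  show ?thesis unfolding blend_def using p by simp
qed

lemma blend_cong: "aeq y y' \<Longrightarrow> aeq (blend y) (blend y')"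
  unfolding blend_def by (intro aeq_add aeq_cmult aeq_Jop)

lemma blend_lincomb: "blend (\<lambda>z. y z - k * x z) = (\<lambda>z. blend y z - k * blend x z)"
  unfolding blend_def Jop_def by (simp add: fun_eq_iff algebra_simps)

lemma fc_e_eq:
  assumes "\<rho> \<in> Hp p" "u \<in> Hp p" "aeq (Toep c0 u) (Toep e \<rho>)" "0 \<le> n"
  shows "fc (\<lambda>z. c0 z * u z) n = fc (\<lambda>z. e z * \<rho> z) n"
  using assms(3,4) fc_Toep[OF Linf_e assms(1), of n]
  unfolding Toep_aeq_iff[OF Linf_c0 assms(2) Toep_Hp[OF Linf_e assms(1)]] by simp

text \<open>On the circle \<open>corr \<rho> u\<close> is the flip of \<open>c0 u - e \<rho>\<close>.\<close>
definition corr :: "cfun \<Rightarrow> cfun \<Rightarrow> cfun" where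
  "corr \<rho> u = (\<lambda>z. z ^ 2 * tld c z * Jop u z - inverse (a z) * z * Jop \<rho> z)"

text \<open>The equation for \<open>u\<close> says that \<open>c0 u - e \<rho>\<close> has no
  coefficient of nonnegative index, which is exactly when its flip lies in
  \<open>Hp p\<close>.\<close>

lemma corr_Hp:
  assumes \<rho>: "\<rho> \<in> Hp p" and u: "u \<in> Hp p" and T: "aeq (Toep c0 u) (Toep e \<rho>)"
  shows "corr \<rho> u \<in> Hp p"
proof -
  let ?v = "\<lambda>z. c0 z * u z - e z * \<rho> z"
  have L: "Lp p (\<lambda>z. c0 z * u z)" "Lp p (\<lambda>z. e z * \<rho> z)"
    by (rule Lp_symbol[OF Linf_c0 u], rule Lp_symbol[OF Linf_e \<rho>])
  have Lv: "Lp p ?v" using L p by (intro Lp_diff) auto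
  have "fc ?v n = 0" if "0 \<le> n" for n
    using fc_diff[OF L[THEN Lp_Lp1], of n] fc_e_eq[OF \<rho> u T that] by simp
  then have J: "Jop ?v \<in> Hp p" by (rule Jop_Hp[OF Lv])
  have "aeq (Jop ?v) (corr \<rho> u)"
  proof (rule aeq_good)
    fix z assume "good z"
    then have "z \<noteq> 0" by (simp add: good_def)
    then show "Jop ?v z = corr \<rho> u z"
      by (simp add: Jop_def corr_def tld_def algebra_simps)
  qed
  moreover have "meas (corr \<rho> u)" unfolding corr_def
    by (intro meas_diff meas_mult meas_power meas_ident meas_tld meas_Jop Linf_meas[OF Linf_c] Linf_meas[OF Linf_ai] Hp_meas[OF \<rho>] Hp_meas[OF u])
  ultimately show ?thesis by (rule Hp_cong[OF J])
qed

text \<open>Both contributions of \<open>u\<close> cancel by the matching identity. Of those of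
  \<open>\<rho>\<close>, one is \<open>Jop \<rho>\<close> and the other carries the factor
  \<open>b / tld a\<close>, which equals \<open>d\<close>.\<close>

lemma blend_corr: "aeq (blend (\<lambda>z. u z - corr \<rho> u z)) (\<lambda>z. d z * \<rho> z + Jop \<rho> z)"
proof (rule aeq_good)
  fix z assume g: "good z"
  define i A A' B B' where "i = inverse z" "A = a z" "A' = a (inverse z)" "B = b z" "B' = b (inverse z)"
  have zi: "z * i = 1" and nz: "A \<noteq> 0" "A' \<noteq> 0" "B \<noteq> 0" "B' \<noteq> 0" and AB: "A * A' = B * B'"
    using g by (auto simp: good_def i_A_A'_B_B'_def)
  have z0: "z \<noteq> 0" using g by (simp add: good_def)
  have c1: "corr \<rho> u z = z ^ 2 * (A' / B') * (i * u i) - inverse A * z * (i * \<rho> i)"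
    unfolding corr_def by (simp add: tld_def sub_c_def Jop_def i_A_A'_B_B'_def)
  have c2: "corr \<rho> u i = i ^ 2 * (A / B) * (z * u z) - inverse A' * i * (z * \<rho> z)"
    unfolding corr_def using z0 by (simp add: tld_def sub_c_def Jop_def i_A_A'_B_B'_def)
  have "blend (\<lambda>z. u z - corr \<rho> u z) z = A * (i * (u z - corr \<rho> u z)) + B * (z * (i * (u i - corr \<rho> u i)))"
    by (simp add: blend_def Jop_def i_A_A'_B_B'_def)
  also have "\<dots> = A / B' * \<rho> z + i * \<rho> i"
  proof -
    define iA iA' iB iB' where "iA = inverse A" "iA' = inverse A'" "iB = inverse B" "iB' = inverse B'"
    have inv: "A * iA = 1" "A' * iA' = 1" "B * iB = 1" "B' * iB' = 1" using nz by (auto simp: iA_iA'_iB_iB'_def)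
    have "A * (i * (u z - (z ^ 2 * (A' * iB') * (i * u i) - iA * z * (i * \<rho> i))))
        + B * (z * (i * (u i - (i ^ 2 * (A * iB) * (z * u z) - iA' * i * (z * \<rho> z))))) = A * iB' * \<rho> z + i * \<rho> i"
      using zi inv AB by algebra
    then show ?thesis unfolding c1 c2 divide_inverse iA_iA'_iB_iB'_def .
  qed
  finally show "blend (\<lambda>z. u z - corr \<rho> u z) z = d z * \<rho> z + Jop \<rho> z"
    by (simp add: sub_d_def tld_def Jop_def i_A_A'_B_B'_def)
qed

text \<open>As operators, \<open>d J a = d (tld a) J = b J\<close> and
  \<open>d J b J = d (tld b) = a\<close>, both by the matching identity; hence \<open>d J\<close>
  fixes everything of the form \<open>(a + b J) x\<close>.\<close>

lemma blend_flip: "aeq (\<lambda>z. d z * Jop (blend y) z) (blend y)"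
proof (rule aeq_good)
  fix z assume g: "good z"
  define i A A' B B' where "i = inverse z" "A = a z" "A' = a (inverse z)" "B = b z" "B' = b (inverse z)"
  have zi: "z * i = 1" and nz: "B' \<noteq> 0" and AB: "A * A' = B * B'"
    using g by (auto simp: good_def i_A_A'_B_B'_def)
  have z0: "z \<noteq> 0" using g by (simp add: good_def)
  have b1: "blend y z = A * (i * y z) + B * (z * (i * y i))"
    by (simp add: blend_def Jop_def i_A_A'_B_B'_def)
  have b2: "Jop (blend y) z = i * (A' * (z * y i) + B' * (i * (z * y z)))"
    using z0 by (simp add: blend_def Jop_def i_A_A'_B_B'_def)
  define iB' where "iB' = inverse B'"
  have inv: "B' * iB' = 1" using nz by (simp add: iB'_def)
  have "A * iB' * (i * (A' * (z * y i) + B' * (i * (z * y z)))) = A * (i * y z) + B * (z * (i * y i))"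
    using zi inv AB by algebra
  then show "d z * Jop (blend y) z = blend y z" unfolding b1 b2
    by (simp add: sub_d_def tld_def divide_inverse i_A_A'_B_B'_def iB'_def)
qed

lemma d_tld_d: "AE \<theta> in cm. d (cis \<theta>) * tld d (cis \<theta>) = 1"
proof -
  have "aeq (\<lambda>z. d z * tld d z) (\<lambda>_. 1)"
    by (rule aeq_good) (auto simp: good_def sub_d_def tld_def field_simps)
  then show ?thesis by (simp add: aeq_cm)
qed

lemma c_nz: "AE \<theta> in cm. c (cis \<theta>) \<noteq> 0"
  using good_AE by eventually_elim (simp add: good_def sub_c_def)

lemma d_nz: "AE \<theta> in cm. d (cis \<theta>) \<noteq> 0"
  using d_tld_d by eventually_elim auto

text \<open>The substitution \<open>y = z * f\<close> embeds the domain of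
  \<open>T(a) + H(b)\<close> into that of the shifted operator, as the functions with vanishing
  zeroth coefficient.\<close>

lemma sum_operator:
  assumes "f \<in> Hp p"
  shows "aeq (\<lambda>z. Toep a f z + Hank b f z) (Pr (blend (\<lambda>z. z * f z)))"
proof -
  have "aeq (Pr (\<lambda>z. a z * f z + b z * Jop f z)) (\<lambda>z. Toep a f z + Hank b f z)"
    unfolding Toep_def Hank_eq[OF assms Linf_meas[OF Linf_b]]
    by (rule Pr_add[OF Lp_symbol[OF Linf_a assms] Lp_symbol_J[OF Linf_b assms]])
  moreover have "Pr (\<lambda>z. a z * f z + b z * Jop f z) = Pr (blend (\<lambda>z. z * f z))"
  proof (rule Pr_aeq_cong)
    show "aeq (\<lambda>z. a z * f z + b z * Jop f z) (blend (\<lambda>z. z * f z))"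
      by (rule aeq_good) (auto simp: good_def blend_def Jop_def field_simps)
    show "meas (\<lambda>z. a z * f z + b z * Jop f z)"
      by (intro meas_add meas_mult meas_Jop Linf_meas[OF Linf_a] Linf_meas[OF Linf_b] Hp_meas[OF assms])
    show "meas (blend (\<lambda>z. z * f z))" by (rule Lp_meas[OF Lp_blend[OF Hp_ident_mult[OF assms]]])
  qed
  ultimately show ?thesis by (simp add: aeq_sym)
qed

section \<open>Kernel and preimages of the shifted operator\<close>

context
  fixes hp \<omega> :: cfun
  assumes inj: "\<And>y. y \<in> Hp p \<Longrightarrow> aeq (Toep c0 y) (\<lambda>_. 0) \<Longrightarrow> aeq y (\<lambda>_. 0)"
    and hp: "hp \<in> Hp p" and hp_eq: "aeq (\<lambda>z. d z * hp z) (Jop hp)"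
    and hp_unique: "\<And>x. x \<in> Hp p \<Longrightarrow> aeq (\<lambda>z. d z * x z) (Jop x) \<Longrightarrow> \<exists>\<gamma>. aeq x (\<lambda>z. \<gamma> * hp z)"
    and \<omega>: "\<omega> \<in> Hp p" and \<omega>_eq: "aeq (Toep c0 \<omega>) (Toep e hp)"
begin

text \<open>Dividing \<open>blend y = 0\<close> by \<open>b z\<close> gives
  \<open>c0 y = - Jop y\<close>, which has only negative indices; so \<open>y\<close> is in the
  kernel of the injective \<open>Toep c0\<close>.\<close>

lemma blend_inj:
  assumes y: "y \<in> Hp p" and z: "aeq (blend y) (\<lambda>_. 0)" shows "aeq y (\<lambda>_. 0)"
proof (rule inj[OF y])
  have "aeq (\<lambda>z. c0 z * y z) (\<lambda>z. - Jop y z)"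
  proof (rule aeq_good1[OF z])
    fix z assume g: "good z" and eq: "blend y z = 0"
    define iz iB where "iz = inverse z" "iB = inverse (b z)"
    have inv: "z * iz = 1" "b z * iB = 1" using g by (auto simp: good_def iz_iB_def)
    have "a z * (iz * y z) + b z * (z * Jop y z) = 0" using eq by (simp add: blend_def iz_iB_def)
    then have "a z * iB * iz ^ 2 * y z = - Jop y z" using inv by algebra
    then show "c0 z * y z = - Jop y z" by (simp add: sub_c_def divide_inverse iz_iB_def)
  qed
  then have "fc (\<lambda>z. c0 z * y z) = fc (\<lambda>z. - Jop y z)"
    using meas_mult[OF Linf_meas[OF Linf_c0] Hp_meas[OF y]] meas_minus[OF meas_Jop[OF Hp_meas[OF y]]] by (rule fc_cong)
  then show "aeq (Toep c0 y) (\<lambda>_. 0)"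
    unfolding Toep_aeq_iff[OF Linf_c0 y Hp_const] by (simp add: fc_minus fc_Jop_Hp[OF y])
qed

text \<open>With \<open>d hp = Jop hp\<close>, multiplying the correction by \<open>c0\<close> gives
  \<open>Jop \<omega> - e hp\<close>. Its coefficients of nonnegative index are the negatives of
  those of \<open>c0 \<omega>\<close>, and injectivity of \<open>Toep c0\<close> yields the claim.
  For the datum \<open>hp\<close> the correction is therefore just
  \<open>- \<omega>\<close>.\<close>

lemma corr_omega: "aeq (\<lambda>z. corr hp \<omega> z + \<omega> z) (\<lambda>_. 0)"
proof (rule inj)
  have cH: "corr hp \<omega> \<in> Hp p" by (rule corr_Hp[OF hp \<omega> \<omega>_eq])
  then show sH: "(\<lambda>z. corr hp \<omega> z + \<omega> z) \<in> Hp p" using \<omega> by (rule Hp_add)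
  have "aeq (\<lambda>z. c0 z * corr hp \<omega> z) (\<lambda>z. Jop \<omega> z - e z * hp z)"
  proof (rule aeq_good1[OF hp_eq])
    fix z assume g: "good z" and eq: "d z * hp z = Jop hp z"
    define iz iA iA' iB iB' where "iz = inverse z" "iA = inverse (a z)" "iA' = inverse (a (inverse z))" "iB = inverse (b z)" "iB' = inverse (b (inverse z))"
    have inv: "z * iz = 1" "a z * iA = 1" "a (inverse z) * iA' = 1" "b z * iB = 1" "b (inverse z) * iB' = 1" "a z * a (inverse z) = b z * b (inverse z)"
      using g by (auto simp: good_def iz_iA_iA'_iB_iB'_def)
    have "a z * iB * iz ^ 2 * (z ^ 2 * (a (inverse z) * iB') * Jop \<omega> z - iA * z * (a z * iB' * hp z)) = Jop \<omega> z - iA' * iz * hp z"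
      using inv by algebra
    then show "c0 z * corr hp \<omega> z = Jop \<omega> z - e z * hp z"
      unfolding corr_def eq[symmetric] by (simp add: sub_c_def sub_d_def tld_def divide_inverse iz_iA_iA'_iB_iB'_def)
  qed
  then have "fc (\<lambda>z. c0 z * corr hp \<omega> z) = fc (\<lambda>z. Jop \<omega> z - e z * hp z)"
    using meas_mult[OF Linf_meas[OF Linf_c0] Hp_meas[OF cH]]
      meas_diff[OF meas_Jop[OF Hp_meas[OF \<omega>]] meas_mult[OF Linf_meas[OF Linf_e] Hp_meas[OF hp]]] by (rule fc_cong)
  moreover have "fc (\<lambda>z. Jop \<omega> z - e z * hp z) n = fc (Jop \<omega>) n - fc (\<lambda>z. e z * hp z) n" for n
    by (rule fc_diff[OF Lp_Lp1[OF Lp_Jop_Hp[OF \<omega>]] Lp_Lp1[OF Lp_symbol[OF Linf_e hp]]])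
  ultimately have "fc (\<lambda>z. c0 z * (1 * corr hp \<omega> z + 1 * \<omega> z)) n = 0" if "0 \<le> n" for n
    using fc_symbol_lincomb[OF Linf_c0 cH \<omega>, of 1 1 n] fc_e_eq[OF hp \<omega> \<omega>_eq that] fc_Jop_Hp[OF \<omega> that] by simp
  then show "aeq (Toep c0 (\<lambda>z. corr hp \<omega> z + \<omega> z)) (\<lambda>_. 0)"
    unfolding Toep_aeq_iff[OF Linf_c0 sH Hp_const] by simp
qed

text \<open>Because \<open>a * tld c = b\<close>, multiplying
  \<open>corr hp \<omega> + \<omega> = 0\<close> by \<open>a / z\<close> turns its terms into those
  of \<open>blend \<omega> - Jop hp\<close>.\<close>

lemma blend_omega: "aeq (blend \<omega>) (Jop hp)"
proof (rule aeq_good1[OF corr_omega])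
  fix z assume g: "good z" and eq: "corr hp \<omega> z + \<omega> z = 0"
  define iz iA iB' where "iz = inverse z" "iA = inverse (a z)" "iB' = inverse (b (inverse z))"
  have inv: "z * iz = 1" "a z * iA = 1" "b (inverse z) * iB' = 1" "a z * a (inverse z) = b z * b (inverse z)"
    using g by (auto simp: good_def iz_iA_iB'_def)
  have "z ^ 2 * (a (inverse z) * iB') * Jop \<omega> z - iA * z * Jop hp z + \<omega> z = 0"
    using eq by (simp add: corr_def sub_c_def tld_def divide_inverse iz_iA_iB'_def)
  then have "a z * (iz * \<omega> z) + b z * (z * Jop \<omega> z) = Jop hp z" using inv by algebra
  then show "blend \<omega> z = Jop hp z" by (simp add: blend_def iz_iA_iB'_def)
qed

text \<open>The flip \<open>x\<close> of \<open>blend y\<close> lies in \<open>Hp p\<close>, and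
  \<open>blend_flip\<close> makes it a solution of \<open>d x = Jop x\<close>, so \<open>x\<close>
  is a multiple of \<open>hp\<close>. Since \<open>blend \<omega>\<close> is the flip of
  \<open>hp\<close>, subtracting the same multiple of \<open>\<omega>\<close> from \<open>y\<close>
  gives a zero of \<open>blend\<close>.\<close>

lemma blend_kernel:
  assumes y: "y \<in> Hp p" and z: "\<And>n. 0 \<le> n \<Longrightarrow> fc (blend y) n = 0"
  shows "\<exists>\<gamma>. aeq y (\<lambda>z. \<gamma> * \<omega> z)"
proof -
  define x where "x = Jop (blend y)"
  have x: "x \<in> Hp p" unfolding x_def by (rule Jop_Hp[OF Lp_blend[OF y] z])
  have Jx: "aeq (Jop x) (blend y)" unfolding x_def by (rule Jop_Jop)
  have "aeq (\<lambda>z. d z * x z) (Jop x)" unfolding x_def by (rule aeq_trans[OF blend_flip aeq_sym[OF Jop_Jop]])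
  then obtain \<gamma> where \<gamma>: "aeq x (\<lambda>z. \<gamma> * hp z)" using hp_unique[OF x] by blast
  have "aeq (blend y) (Jop (\<lambda>z. \<gamma> * hp z))" by (rule aeq_trans[OF aeq_sym[OF Jx] aeq_Jop[OF \<gamma>]])
  then have "aeq (\<lambda>z. blend y z - \<gamma> * blend \<omega> z) (\<lambda>z. Jop (\<lambda>z. \<gamma> * hp z) z - \<gamma> * Jop hp z)"
    by (intro aeq_diff aeq_cmult blend_omega)
  moreover have "(\<lambda>z. Jop (\<lambda>z. \<gamma> * hp z) z - \<gamma> * Jop hp z) = (\<lambda>_. 0)" by (simp add: Jop_def fun_eq_iff)
  ultimately have "aeq (blend (\<lambda>z. y z - \<gamma> * \<omega> z)) (\<lambda>_. 0)" by (simp add: blend_lincomb)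
  then have "aeq (\<lambda>z. y z - \<gamma> * \<omega> z) (\<lambda>_. 0)" by (rule blend_inj[OF Hp_diff[OF y Hp_cmult[OF \<omega>]]])
  then have "aeq y (\<lambda>z. \<gamma> * \<omega> z)" by (simp add: aeq_cm)
  then show ?thesis by blast
qed

text \<open>Surjectivity yields \<open>f\<close> such that \<open>z * f - 1\<close> is annihilated
  by the shifted operator and is thus a multiple of \<open>\<omega>\<close>; but its zeroth
  coefficient is \<open>-1\<close>.\<close>

lemma omega_nonzero:
  assumes surj: "\<And>g. g \<in> Hp p \<Longrightarrow> \<exists>f\<in>Hp p. aeq (\<lambda>z. Toep a f z + Hank b f z) g"
  shows "fc \<omega> 0 \<noteq> 0"
proof
  assume 0: "fc \<omega> 0 = 0"
  have L1: "Lp p (blend (\<lambda>_. 1))" by (rule Lp_blend[OF Hp_const])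
  obtain f where f: "f \<in> Hp p" "aeq (\<lambda>z. Toep a f z + Hank b f z) (Pr (blend (\<lambda>_. 1)))"
    using surj[OF Pr_Hp[OF L1]] by blast
  let ?y = "\<lambda>z. z * f z - 1 * 1"
  have zf: "(\<lambda>z. z * f z) \<in> Hp p" by (rule Hp_ident_mult[OF f(1)])
  have yH: "?y \<in> Hp p" using Hp_diff[OF zf Hp_const[of 1]] by simp
  have Lf: "Lp p (blend (\<lambda>z. z * f z))" by (rule Lp_blend[OF zf])
  have "aeq (Pr (blend (\<lambda>z. z * f z))) (Pr (blend (\<lambda>_. 1)))"
    by (rule aeq_trans[OF aeq_sym[OF sum_operator[OF f(1)]] f(2)])
  then have "fc (Pr (blend (\<lambda>z. z * f z))) = fc (Pr (blend (\<lambda>_. 1)))"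
    by (rule fc_cong[OF _ meas_Pr[OF Lf] meas_Pr[OF L1]])
  then have eq: "fc (blend (\<lambda>z. z * f z)) n = fc (blend (\<lambda>_. 1)) n" if "0 \<le> n" for n
    using Pr_spec(2)[OF Lf, of n] Pr_spec(2)[OF L1, of n] that by simp
  have "fc (blend ?y) n = 0" if "0 \<le> n" for n
    unfolding blend_lincomb[of "\<lambda>z. z * f z" 1 "\<lambda>_. 1"]
    using eq[OF that] fc_diff[OF Lp_Lp1[OF Lf] Lp_Lp1[OF L1], of n] by simp
  then obtain \<gamma> where "aeq ?y (\<lambda>z. \<gamma> * \<omega> z)" using blend_kernel[OF yH] by blast
  then have "fc ?y = fc (\<lambda>z. \<gamma> * \<omega> z)" by (rule fc_cong[OF _ Hp_meas[OF yH] Hp_meas[OF Hp_cmult[OF \<omega>]]])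
  then have "fc ?y 0 = 0" using 0 by (simp add: fc_cmult)
  moreover have "fc ?y 0 = - 1"
    using fc_diff[OF Hp_Lp1[OF zf] Hp_Lp1[OF Hp_const[of 1]], of 0] HpD(2)[OF f(1), of "- 1"]
    by (simp add: fc_ident_mult fc_const)
  ultimately show False by simp
qed

text \<open>Both \<open>h\<close> and \<open>z * \<phi>\<close> are preimages of \<open>g\<close>
  under the shifted operator, so they differ by a multiple of \<open>\<omega>\<close>, and the
  zeroth coefficient determines which.\<close>

lemma solution_formula:
  assumes \<rho>: "\<rho> \<in> Hp p" and u: "u \<in> Hp p" and T: "aeq (Toep c0 u) (Toep e \<rho>)"
    and g: "g \<in> Hp p" "aeq (Toep d \<rho>) g"
    and \<phi>: "\<phi> \<in> Hp p" "aeq (\<lambda>z. Toep a \<phi> z + Hank b \<phi> z) g"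
    and h: "h \<in> Hp p" "aeq h (\<lambda>z. u z - corr \<rho> u z)" and nz: "fc \<omega> 0 \<noteq> 0"
  shows "aeq \<phi> (Toep (\<lambda>z. inverse z) (\<lambda>z. h z - (1 / fc \<omega> 0) * \<omega> z * (z * Qr (\<lambda>w. inverse w * h w) z)))"
proof -
  have zf: "(\<lambda>z. z * \<phi> z) \<in> Hp p" by (rule Hp_ident_mult[OF \<phi>(1)])
  have Lf: "Lp p (blend (\<lambda>z. z * \<phi> z))" by (rule Lp_blend[OF zf])
  have Lh: "Lp p (blend h)" by (rule Lp_blend[OF h(1)])
  have "aeq (Pr (blend (\<lambda>z. z * \<phi> z))) g" by (rule aeq_trans[OF aeq_sym[OF sum_operator[OF \<phi>(1)]] \<phi>(2)])
  then have "fc (Pr (blend (\<lambda>z. z * \<phi> z))) = fc g" by (rule fc_cong[OF _ meas_Pr[OF Lf] Hp_meas[OF g(1)]])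
  then have f1: "fc (blend (\<lambda>z. z * \<phi> z)) n = fc g n" if "0 \<le> n" for n
    using Pr_spec(2)[OF Lf, of n] that by simp
  have Ld: "Lp p (\<lambda>z. d z * \<rho> z)" by (rule Lp_symbol[OF Linf_d \<rho>])
  have "aeq (blend h) (\<lambda>z. d z * \<rho> z + Jop \<rho> z)" by (rule aeq_trans[OF blend_cong[OF h(2)] blend_corr])
  then have "fc (blend h) = fc (\<lambda>z. d z * \<rho> z + Jop \<rho> z)"
    by (rule fc_cong[OF _ Lp_meas[OF Lh] meas_add[OF Lp_meas[OF Ld] meas_Jop[OF Hp_meas[OF \<rho>]]]])
  then have f2: "fc (blend h) n = fc g n" if "0 \<le> n" for n
    using fc_add[OF Lp_Lp1[OF Ld] Lp_Lp1[OF Lp_Jop_Hp[OF \<rho>]], of n] fc_Jop_Hp[OF \<rho> that]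
      g(2) that unfolding Toep_aeq_iff[OF Linf_d \<rho> g(1)] by simp
  let ?y = "\<lambda>z. z * \<phi> z - 1 * h z"
  have yH: "?y \<in> Hp p" using Hp_diff[OF zf h(1)] by simp
  have "fc (blend ?y) n = 0" if "0 \<le> n" for n
    unfolding blend_lincomb[of "\<lambda>z. z * \<phi> z" 1 h]
    using f1[OF that] f2[OF that] fc_diff[OF Lp_Lp1[OF Lf] Lp_Lp1[OF Lh], of n] by simp
  then obtain \<gamma> where \<gamma>: "aeq ?y (\<lambda>z. \<gamma> * \<omega> z)" using blend_kernel[OF yH] by blast
  then have "fc ?y = fc (\<lambda>z. \<gamma> * \<omega> z)" by (rule fc_cong[OF _ Hp_meas[OF yH] Hp_meas[OF Hp_cmult[OF \<omega>]]])
  then have "fc ?y 0 = \<gamma> * fc \<omega> 0" by (simp add: fc_cmult)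
  moreover have "fc ?y 0 = - fc h 0"
    using fc_diff[OF Hp_Lp1[OF zf] Hp_Lp1[OF h(1)], of 0] HpD(2)[OF \<phi>(1), of "- 1"]
    by (simp add: fc_ident_mult)
  \<comment> \<open>\<open>z * \<phi>\<close> has no zeroth coefficient, so the one of
    \<open>h\<close> must be cancelled by that of \<open>\<gamma> * \<omega>\<close>.\<close>
  ultimately have \<gamma>_eq: "\<gamma> = - (1 / fc \<omega> 0) * fc h 0" using nz by (simp add: field_simps)
  have Li: "Lp p (\<lambda>w. inverse w * h w)" by (rule Lp_symbol[OF Linf_inverse_ident h(1)])
  \<comment> \<open>Division by \<open>z\<close> moves precisely the constant term of
    \<open>h\<close> to a negative index; \<open>Q\<close> isolates it and the factor
    \<open>z\<close> brings it back.\<close>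
  have Q: "aeq (\<lambda>z. z * Qr (\<lambda>w. inverse w * h w) z) (\<lambda>_. fc h 0)"
  proof -
    have "aeq (Pr (\<lambda>w. inverse w * h w)) (\<lambda>z. inverse z * (h z - fc h 0))"
    proof (rule Pr_unique[OF Li])
      have L: "Lp p (\<lambda>z. inverse z * (h z - fc h 0))"
        by (rule Lp_symbol[OF Linf_inverse_ident Hp_diff[OF h(1) Hp_const]])
      show "Lp 1 (\<lambda>z. inverse z * (h z - fc h 0))" by (rule Lp_Lp1[OF L])
      have fcd: "fc (\<lambda>z. h z - fc h 0) n = fc h n - fc (\<lambda>_. fc h 0) n" for n
        by (rule fc_diff[OF Hp_Lp1[OF h(1)] Hp_Lp1[OF Hp_const]])
      show "fc (\<lambda>z. inverse z * (h z - fc h 0)) n = fc (\<lambda>w. inverse w * h w) n" if "0 \<le> n" for n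
        using that by (simp add: fc_inverse_mult fcd fc_const)
      show "fc (\<lambda>z. inverse z * (h z - fc h 0)) n = 0" if "n < 0" for n
        using that HpD(2)[OF h(1), of "n + 1"] by (cases "n = - 1") (auto simp: fc_inverse_mult fcd fc_const)
    qed
    then show ?thesis
    proof (rule aeq_good1)
      fix z assume "good z" and eq: "Pr (\<lambda>w. inverse w * h w) z = inverse z * (h z - fc h 0)"
      then have "z \<noteq> 0" by (simp add: good_def)
      then show "z * Qr (\<lambda>w. inverse w * h w) z = fc h 0" unfolding Qr_def eq by (simp add: field_simps)
    qed
  qed
  let ?w = "\<lambda>z. h z - (1 / fc \<omega> 0) * \<omega> z * (z * Qr (\<lambda>w. inverse w * h w) z)"
  have mQ: "meas (Qr (\<lambda>w. inverse w * h w))" unfolding Qr_def by (rule meas_diff[OF Lp_meas[OF Li] meas_Pr[OF Li]])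
  have mw: "meas ?w" by (intro meas_diff meas_mult meas_const meas_ident mQ Hp_meas[OF h(1)] Hp_meas[OF \<omega>])
  have "aeq (\<lambda>z. z * \<phi> z) ?w"
    using \<gamma> Q unfolding aeq_cm
  proof eventually_elim
    case (elim \<theta>)
    show ?case unfolding elim(2) using elim(1) unfolding \<gamma>_eq by (simp add: algebra_simps)
  qed
  then have "Toep (\<lambda>z. inverse z) ?w = Toep (\<lambda>z. inverse z) (\<lambda>z. z * \<phi> z)"
    using mw Hp_meas[OF zf] by (intro Toep_cong[OF aeq_sym]) auto
  moreover have "aeq (Toep (\<lambda>z. inverse z) (\<lambda>z. z * \<phi> z)) \<phi>"
  proof -
    have "fc (\<lambda>z. inverse z * (z * \<phi> z)) n = fc \<phi> n" for n by (simp add: fc_inverse_mult fc_ident_mult)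
    then show ?thesis by (simp add: Toep_aeq_iff[OF Linf_inverse_ident zf \<phi>(1)])
  qed
  ultimately show ?thesis by (simp add: aeq_sym)
qed

end

text \<open>The two Hankel terms are the projections of the two summands of \<open>corr\<close>.
  Neither summand need be analytic by itself, but their difference is, so the projection leaves it
  unchanged.\<close>

lemma Hank_corr:
  assumes \<rho>: "\<rho> \<in> Hp p" and u: "u \<in> Hp p" and T: "aeq (Toep c0 u) (Toep e \<rho>)"
  shows "aeq (\<lambda>z. (u z - Hank (\<lambda>x. x ^ 2 * tld c x) u z) + Hank (\<lambda>x. inverse (a x) * x) \<rho> z) (\<lambda>z. u z - corr \<rho> u z)"
    and "(\<lambda>z. (u z - Hank (\<lambda>x. x ^ 2 * tld c x) u z) + Hank (\<lambda>x. inverse (a x) * x) \<rho> z) \<in> Hp p"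
proof -
  have l1: "Linf (\<lambda>x. x ^ 2 * tld c x)" by (intro Linf_mult Linf_power Linf_ident Linf_tld Linf_c)
  have l2: "Linf (\<lambda>x. inverse (a x) * x)" by (intro Linf_mult Linf_ai Linf_ident)
  have cH: "corr \<rho> u \<in> Hp p" by (rule corr_Hp[OF assms])
  have "aeq (Pr (corr \<rho> u)) (\<lambda>z. Hank (\<lambda>x. x ^ 2 * tld c x) u z - Hank (\<lambda>x. inverse (a x) * x) \<rho> z)"
    using Pr_diff[OF Lp_symbol_J[OF l1 u] Lp_symbol_J[OF l2 \<rho>]]
    unfolding Hank_eq[OF u Linf_meas[OF l1]] Hank_eq[OF \<rho> Linf_meas[OF l2]] corr_def .
  then have "aeq (corr \<rho> u) (\<lambda>z. Hank (\<lambda>x. x ^ 2 * tld c x) u z - Hank (\<lambda>x. inverse (a x) * x) \<rho> z)"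
    by (rule aeq_trans[OF aeq_sym[OF Pr_Hp_id[OF cH]]])
  then show "aeq (\<lambda>z. (u z - Hank (\<lambda>x. x ^ 2 * tld c x) u z) + Hank (\<lambda>x. inverse (a x) * x) \<rho> z) (\<lambda>z. u z - corr \<rho> u z)"
    unfolding aeq_cm by eventually_elim simp
  show "(\<lambda>z. (u z - Hank (\<lambda>x. x ^ 2 * tld c x) u z) + Hank (\<lambda>x. inverse (a x) * x) \<rho> z) \<in> Hp p"
    by (intro Hp_add Hp_diff u \<rho> Hank_Hp l1 l2)
qed

end

section \<open>The inversion formula\<close>

theorem theorem5p2:
  fixes p :: real and a b dm dp :: cfun and m :: int and R :: "cfun \<Rightarrow> cfun"
  assumes "1 < p"
    and "F_TH p a b (-2) 2"
    and "invertible_on p (\<lambda>f z. Toep a f z + Hank b f z)"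
    and "WH_fact_norm p (sub_d a b) dm m dp"
    and "\<forall>g\<in>Hp p. R g \<in> Hp p \<and> aeq (Toep (sub_d a b) (R g)) g"
  shows
   "let c = sub_c a b;
        \<sigma> = fc dp 0;
        Tinv = opinv p (Toep (\<lambda>z. c z * inverse z ^ 2));
        \<omega> = Tinv (Toep (\<lambda>z. inverse (tld a z) * inverse z)
                (\<lambda>z. inverse (dp z) * (1 + \<sigma> * z)));
        \<omega>0 = fc \<omega> 0
    in \<omega>0 \<noteq> 0 \<and>
       (\<forall>g\<in>Hp p.
          aeq (opinv p (\<lambda>f z. Toep a f z + Hank b f z) g)
              (Toep (\<lambda>z. inverse z)
                 (let h = (\<lambda>z. (\<lambda>w. Tinv (Toep (\<lambda>x. inverse (tld a x) * inverse x) (R g)) w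
                                     - Hank (\<lambda>x. x ^ 2 * tld c x)
                                         (Tinv (Toep (\<lambda>x. inverse (tld a x) * inverse x) (R g))) w) z
                                + Hank (\<lambda>x. inverse (a x) * x) (R g) z)
                  in (\<lambda>z. h z - (1 / \<omega>0) * \<omega> z * (z * Qr (\<lambda>w. inverse w * h w) z)))))"
proof -
  interpret matching p a b
    using assms(1,2) by unfold_locales (auto simp: F_TH_def)
  define q where "q = p / (p - 1)"
  have pq: "1/p + 1/q = 1" using p by (auto simp: q_def field_simps)
  have WH: "WH_fact p d dm m dp" "fc dm 0 = 1" using assms(4) by (auto simp: WH_fact_norm_def)
  interpret wiener_hopf p q d dm dp m
    using WH(1) pq Linf_d d_nz unfolding WH_fact_def Let_def q_def[symmetric] by unfold_locales auto
  have R: "R g \<in> Hp p" "aeq (Toep d (R g)) g" if "g \<in> Hp p" for g using assms(5) that by auto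
  obtain k n where kn: "kerdim p (Toep d) k" "cokerdim p (Toep d) n" "2 = int k - int n"
    using assms(2) by (auto simp: F_TH_def fredholm_index_def)
  \<comment> \<open>A right inverse makes \<open>Toep d\<close> onto, so the index 2 is the
    dimension of its kernel and fixes the exponent of the factorization.\<close>
  have "n = 0" by (rule surj_cokerdim_0[OF Linf_d kn(2)]) (use R in blast)
  then have "k = 2" using kn(3) by simp
  then have m: "m = - 2" using kn(1) kerdim_2_index by simp
  interpret wiener_hopf_index2 p q d dm dp m
    using m d_tld_d WH(2) by unfold_locales auto
  have ind: "fredholm_index p (Toep c) (- 2)" using assms(2) by (simp add: F_TH_def)
  note inj = Toep_shift_inj[OF Linf_c c_nz ind]
  \<comment> \<open>\<open>opinv\<close> is a choice and carries no information until some inverse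
    is exhibited. Preimages chosen pointwise serve as one; injectivity makes them a left inverse as
    well.\<close>
  have "inv_on p (Toep c0) (\<lambda>g. SOME f. f \<in> Hp p \<and> aeq (Toep c0 f) g)"
    unfolding inv_on_def
  proof (intro conjI ballI)
    fix g assume g: "g \<in> Hp p"
    have "\<exists>f. f \<in> Hp p \<and> aeq (Toep c0 f) g" using Toep_shift_surj[OF Linf_c c_nz ind g] by blast
    from someI_ex[OF this]
    show "(SOME f. f \<in> Hp p \<and> aeq (Toep c0 f) g) \<in> Hp p" "aeq (Toep c0 (SOME f. f \<in> Hp p \<and> aeq (Toep c0 f) g)) g" by auto
  next
    fix f assume f: "f \<in> Hp p"
    let ?f = "SOME f'. f' \<in> Hp p \<and> aeq (Toep c0 f') (Toep c0 f)"
    have "\<exists>f'. f' \<in> Hp p \<and> aeq (Toep c0 f') (Toep c0 f)" using f by blast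
    from someI_ex[OF this] have f': "?f \<in> Hp p" "aeq (Toep c0 ?f) (Toep c0 f)" by auto
    have "aeq (Toep c0 (\<lambda>z. ?f z - f z)) (\<lambda>z. Toep c0 ?f z - Toep c0 f z)" by (rule Toep_diff[OF Linf_c0 f'(1) f])
    also have "aeq \<dots> (\<lambda>_. 0)" using f'(2) by (simp add: aeq_cm)
    finally have "aeq (\<lambda>z. ?f z - f z) (\<lambda>_. 0)" by (rule inj[OF Hp_diff[OF f'(1) f]])
    then show "aeq ?f f" by (simp add: aeq_cm)
  qed
  then have "inv_on p (Toep c0) (opinv p (Toep c0))" unfolding opinv_def by (rule someI[of "inv_on p (Toep c0)"])
  then have Tinv: "opinv p (Toep c0) g \<in> Hp p" "aeq (Toep c0 (opinv p (Toep c0) g)) g" if "g \<in> Hp p" for g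
    using that by (auto simp: inv_on_def)
  let ?A = "\<lambda>f z. Toep a f z + Hank b f z"
  obtain B where "inv_on p ?A B" using assms(3) by (auto simp: invertible_on_def)
  then have "inv_on p ?A (opinv p ?A)" unfolding opinv_def by (rule someI[of "inv_on p ?A"])
  then have Ainv: "opinv p ?A g \<in> Hp p" "aeq (?A (opinv p ?A g)) g" if "g \<in> Hp p" for g
    using that by (auto simp: inv_on_def)
  define \<omega> where "\<omega> = opinv p (Toep c0) (Toep e hp)"
  have \<omega>: "\<omega> \<in> Hp p" "aeq (Toep c0 \<omega>) (Toep e hp)"
    unfolding \<omega>_def using Tinv[OF Toep_Hp[OF Linf_e hp_Hp]] by auto
  have hpu: "\<exists>\<gamma>. aeq x (\<lambda>z. \<gamma> * hp z)" if "x \<in> Hp p" "aeq (\<lambda>z. d z * x z) (Jop x)" for x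
    using hp_unique[OF that] by blast
  have surj: "\<exists>f\<in>Hp p. aeq (\<lambda>z. Toep a f z + Hank b f z) g" if "g \<in> Hp p" for g
    by (rule bexI[of _ "opinv p ?A g"]) (rule Ainv[OF that])+
  have nz: "fc \<omega> 0 \<noteq> 0"
    by (rule omega_nonzero[OF inj hp_Hp hp_eq hpu \<omega> surj])
  \<comment> \<open>Stated for variables \<open>u\<close> and \<open>h\<close> with defining
    equations, so that the nested terms of the formula can be instantiated by reflexivity at the
    end.\<close>
  have main: "aeq (opinv p ?A g) (Toep (\<lambda>z. inverse z) (\<lambda>z. h z - (1 / fc \<omega> 0) * \<omega> z * (z * Qr (\<lambda>w. inverse w * h w) z)))"
    if g: "g \<in> Hp p" and u: "u = opinv p (Toep c0) (Toep e (R g))"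
      and h: "h = (\<lambda>z. (u z - Hank (\<lambda>x. x ^ 2 * tld c x) u z) + Hank (\<lambda>x. inverse (a x) * x) (R g) z)" for g u h
  proof -
    have uT: "u \<in> Hp p" "aeq (Toep c0 u) (Toep e (R g))"
      unfolding u using Tinv[OF Toep_Hp[OF Linf_e R(1)[OF g]]] by auto
    show ?thesis
      by (rule solution_formula[OF inj hp_Hp hp_eq hpu \<omega> R(1)[OF g] uT g R(2)[OF g] Ainv[OF g] _ _ nz])
        (use Hank_corr[OF R(1)[OF g] uT] in \<open>auto simp: h\<close>)
  qed
  show ?thesis
    unfolding Let_def hp_def[symmetric] \<omega>_def[symmetric]
    by (intro conjI ballI nz main[OF _ refl refl])
qed

end
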